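(* For every integer $t\ge2$, $\operatorname{reg}(\mathbb{K}[G_t])=4$ and $\deg h_{\mathbb{K}[G_t]}(x)=t+3$.
   Context: $\mathbb{K}$ is an algebraically closed field of characteristic zero. For $t\ge2$, $G_t$ is the graph with vertex set $\{x_1,x_2,y_1,\dots,y_t,z_1,z_2,w_1,w_2\}$ and edges $a_i=\{x_1,y_i\}$, $b_i=\{x_2,y_i\}$ ($1\le i\le t$), $e_1=\{x_1,z_1\}$, $e_2=\{z_1,z_2\}$, $e_3=\{z_2,x_1\}$, $f_1=\{x_2,w_1\}$, $f_2=\{w_1,w_2\}$, $f_3=\{w_2,x_2\}$. Its toric ideal $I_{G_t}$ is the kernel of the $\mathbb{K}$-algebra map from the standard graded ring $\mathbb{K}[E_t]=\mathbb{K}[a_1,\dots,a_t,f_1,f_2,f_3,e_1,e_2,e_3,b_1,\dots,b_t]$ to the polynomial ring on the vertices sending each edge variable to the product of its two endpoints, and $\mathbb{K}[G_t]=\mathbb{K}[E_t]/I_{G_t}$. $\operatorname{reg}$ is Castelnuovo–Mumford regularity; $h_{\mathbb{K}[G_t]}(x)$ is the $h$-polynomial, i.e. $HS_{\mathbb{K}[G_t]}(x)=h(x)/(1-x)^{\dim\mathbb{K}[G_t]}$ with $h(1)\neq0$. *)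

theory Defs
  imports "HOL-Computational_Algebra.Polynomial_FPS" "HOL-Library.Multiset"
begin

text \<open>General edge rings.  A graph is given by a finite set of edge indices Ed (natural
numbers, ordered as the variables of the polynomial ring K[E]) and a map ends sending an edge
to the multiset of its two endpoints.  The edge monomial of e is the vertex monomial ends e
(monomials in the vertex ring are multisets of vertices).\<close>

text \<open>K[G] is the monomial subalgebra generated by the edge monomials; its degree-k graded piece
has as K-basis the distinct vertex monomials that are products of k edge monomials.\<close>
definition edge_monos :: "nat set \<Rightarrow> (nat \<Rightarrow> 'v multiset) \<Rightarrow> nat \<Rightarrow> 'v multiset set" where
  "edge_monos Ed ends k =
     {sum_mset (image_mset ends M) | M. set_mset M \<subseteq> Ed \<and> size M = k}"

definition hilb :: "nat set \<Rightarrow> (nat \<Rightarrow> 'v multiset) \<Rightarrow> nat \<Rightarrow> nat" where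
  "hilb Ed ends k = card (edge_monos Ed ends k)"

definition is_h_poly :: "nat set \<Rightarrow> (nat \<Rightarrow> 'v multiset) \<Rightarrow> nat \<Rightarrow> int poly \<Rightarrow> bool" where
  "is_h_poly Ed ends d h \<longleftrightarrow>
     (1 - fps_X) ^ d * Abs_fps (\<lambda>k. int (hilb Ed ends k)) = fps_of_poly h \<and> poly h 1 \<noteq> 0"

text \<open>Graded Betti numbers beta_{i,j} = dim_K Tor_i^{K[E]}(K[G],K)_j, computed as the homology of
the Koszul complex of K[G] with respect to the variables of K[E].  The component of homological
degree i and internal degree j has K-basis the pairs (F,m) with F a set of i edges and m a
monomial of K[G] of degree j - i.\<close>
definition kos_basis :: "nat set \<Rightarrow> (nat \<Rightarrow> 'v multiset) \<Rightarrow> nat \<Rightarrow> nat \<Rightarrow> (nat set \<times> 'v multiset) set" where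
  "kos_basis Ed ends i j =
     {(F, m). F \<subseteq> Ed \<and> finite F \<and> card F = i \<and> i \<le> j \<and> m \<in> edge_monos Ed ends (j - i)}"

text \<open>Matrix entry of the Koszul differential: e_F \<otimes> m \<mapsto>
  sum over f in F of (-1)^(position of f in F) e_(F - f) \<otimes> (x_f m).\<close>
definition kos_entry :: "(nat \<Rightarrow> 'v multiset) \<Rightarrow> nat set \<times> 'v multiset \<Rightarrow> nat set \<times> 'v multiset \<Rightarrow> 'k::field" where
  "kos_entry ends r c =
     (\<Sum>f\<in>fst c. if fst r = fst c - {f} \<and> snd r = snd c + ends f
                  then (-1) ^ card {g\<in>fst c. g < f} else 0)"

definition lin_indep_cols :: "'r set \<Rightarrow> 'c set \<Rightarrow> ('r \<Rightarrow> 'c \<Rightarrow> 'k::field) \<Rightarrow> bool" where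
  "lin_indep_cols R S A \<longleftrightarrow>
     (\<forall>c. (\<forall>r\<in>R. (\<Sum>s\<in>S. c s * A r s) = 0) \<longrightarrow> (\<forall>s\<in>S. c s = 0))"

definition mat_rank :: "'r set \<Rightarrow> 'c set \<Rightarrow> ('r \<Rightarrow> 'c \<Rightarrow> 'k::field) \<Rightarrow> nat" where
  "mat_rank R C A = Max {card S | S. S \<subseteq> C \<and> lin_indep_cols R S A}"

definition kos_rank :: "'k::field itself \<Rightarrow> nat set \<Rightarrow> (nat \<Rightarrow> 'v multiset) \<Rightarrow> nat \<Rightarrow> nat \<Rightarrow> nat" where
  "kos_rank K Ed ends i j =
     (if i = 0 then 0
      else mat_rank (kos_basis Ed ends (i - 1) j) (kos_basis Ed ends i j)
             (kos_entry ends :: _ \<Rightarrow> _ \<Rightarrow> 'k))"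

definition betti :: "'k::field itself \<Rightarrow> nat set \<Rightarrow> (nat \<Rightarrow> 'v multiset) \<Rightarrow> nat \<Rightarrow> nat \<Rightarrow> int" where
  "betti K Ed ends i j =
     int (card (kos_basis Ed ends i j)) - int (kos_rank K Ed ends i j)
       - int (kos_rank K Ed ends (Suc i) j)"

definition cm_reg :: "'k::field itself \<Rightarrow> nat set \<Rightarrow> (nat \<Rightarrow> 'v multiset) \<Rightarrow> int" where
  "cm_reg K Ed ends = Max {int j - int i | i j. betti K Ed ends i j \<noteq> 0}"

datatype gvert = X nat | Y nat | Z nat | W nat

text \<open>Edge indices in the variable order a_1..a_t, f_1,f_2,f_3, e_1,e_2,e_3, b_1..b_t:
  a_i = i-1, f_k = t+k-1, e_k = t+k+2, b_i = t+5+i.\<close>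
definition Gt_edges :: "nat \<Rightarrow> nat set" where
  "Gt_edges t = {..<2 * t + 6}"

definition Gt_ends :: "nat \<Rightarrow> nat \<Rightarrow> gvert multiset" where
  "Gt_ends t k =
     (if k < t then {#X 1, Y (k + 1)#}
      else if k = t then {#X 2, W 1#}
      else if k = t + 1 then {#W 1, W 2#}
      else if k = t + 2 then {#W 2, X 2#}
      else if k = t + 3 then {#X 1, Z 1#}
      else if k = t + 4 then {#Z 1, Z 2#}
      else if k = t + 5 then {#Z 2, X 1#}
      else {#X 2, Y (k - t - 5)#})"

end

theory Submission
  imports Defs
begin

text \<open>With A = e1 e3 f2 and B = e2 f1 f3, the toric ideal is generated by the 2-minors of the matrix
with rows a and b together with the binomials A b_i b_j - B a_i a_j. The variables e1, e3, f2 form a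
regular sequence on K[G_t] with quotient R[e2,f1,f3] / B (a)^2, where R is the Segre ring
K[a,b] / (2-minors). This quotient is an extension of R[e2,f1,f3] / (B), of regularity 3 and
projective dimension at most t + 1, by (R / (a)^2)[e2,f1,f3] shifted by deg B = 3. On the submodule
(a) / (a)^2 of R / (a)^2 the variables a act by zero, and over K[b] it is the maximal ideal;
this gives regularity 1 + 3 = 4 and a class in homological degree 2t - 1 and internal degree 2t + 3,
which survives because every other piece has smaller projective dimension. The same exact sequences
yield h(x) = 1 + t x + t x^2 + (t+1) x^3 - x^3 (1-x)^t.

All modules involved are multigraded with components of dimension at most one, so Tor is computed
one multidegree at a time, by a complex spanned by sets of edges.\<close>

section \<open>Chain complexes spanned by families of finite sets\<close>

text \<open>The relation A b_i b_j = B a_i a_j comes from the closed walk that runs around the first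
  triangle, crosses to x2 through y_i, runs around the second triangle and returns through y_j: its
  edges in odd and in even positions multiply to the two sides. Killing e1 alone already turns the
  relation into B a_i a_j = 0; e3 and f2 are free variables after that.

  The obstacle is that K[G_t] is not Cohen-Macaulay. Its projective dimension 2t - 1 leaves depth 7
  against dimension t + 6, so the regularity cannot be read off the degree of h, and the two numbers
  need separate computations. The value 2t - 1 is t - 1 for the maximal ideal of K[b] plus t for the
  variables a acting by zero. The extremal class is the top Koszul class of the residue field, in
  homological and internal degree 2t, moved down one homological degree by a connecting map and
  shifted by 3 through B.

  Only vanishing and non-vanishing of Betti numbers matter. Long exact sequences are therefore used
  as three implications between exactness statements, and the ranks in the definition of
  \<open>betti\<close> enter through a single vanishing criterion.\<close>

definition pos_sign :: "nat \<Rightarrow> nat set \<Rightarrow> 'k::field_char_0" where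
  "pos_sign f G = (-1) ^ card {g\<in>G. g < f}"

lemma pos_sign_square [simp]: "pos_sign f G * pos_sign f G = (1::'k::field_char_0)"
  by (simp add: pos_sign_def flip: power_mult_distrib)

lemma pos_sign_insert:
  assumes "finite G" "g \<notin> G"
  shows "pos_sign f (insert g G) = (if g < f then -1 else 1) * (pos_sign f G :: 'k::field_char_0)"
proof -
  have "{x\<in>insert g G. x < f} = (if g < f then insert g {x\<in>G. x < f} else {x\<in>G. x < f})"
    by auto
  then show ?thesis
    using assms by (simp add: pos_sign_def)
qed

text \<open>Coefficient form of the boundary: \<open>c F\<close> is the coefficient of the face
  \<open>F\<close> in a chain, and the value at \<open>G\<close> collects the contributions of the
  faces of \<open>S\<close> with one more element. Values of \<open>c\<close> off \<open>S\<close>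
  are ignored, so a chain needs no support condition.\<close>

definition bd :: "nat set set \<Rightarrow> (nat set \<Rightarrow> 'k::field_char_0) \<Rightarrow> nat set \<Rightarrow> 'k" where
  "bd S c G = (\<Sum>f | f \<notin> G \<and> insert f G \<in> S. pos_sign f G * c (insert f G))"

text \<open>For finite faces only the values of \<open>c\<close> in cardinality \<open>i\<close>
  enter. For \<open>i = 0\<close> the cycle condition is vacuous, so exactness there says that every
  chain is a boundary.\<close>

definition exact_at :: "'k::field_char_0 itself \<Rightarrow> nat set set \<Rightarrow> nat \<Rightarrow> bool" where
  "exact_at K S i \<longleftrightarrow>
     (\<forall>c :: nat set \<Rightarrow> 'k. (\<forall>G\<in>S. Suc (card G) = i \<longrightarrow> bd S c G = 0) \<longrightarrow>
        (\<exists>b :: nat set \<Rightarrow> 'k. \<forall>F\<in>S. card F = i \<longrightarrow> c F = bd S b F))"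

lemma exact_atI:
  assumes "\<And>c :: nat set \<Rightarrow> 'k::field_char_0.
      (\<And>G. G \<in> S \<Longrightarrow> Suc (card G) = i \<Longrightarrow> bd S c G = 0) \<Longrightarrow>
      \<exists>b. \<forall>F\<in>S. card F = i \<longrightarrow> c F = bd S b F"
  shows "exact_at (K :: 'k itself) S i"
  using assms unfolding exact_at_def by blast

lemma exact_atE:
  fixes c :: "nat set \<Rightarrow> 'k::field_char_0"
  assumes "exact_at (K :: 'k itself) S i"
    and "\<And>G. G \<in> S \<Longrightarrow> Suc (card G) = i \<Longrightarrow> bd S c G = 0"
  obtains b where "\<And>F. F \<in> S \<Longrightarrow> card F = i \<Longrightarrow> c F = bd S b F"
  using assms unfolding exact_at_def by blast

lemma exact_at_no_faces:
  assumes "\<And>F. F \<in> S \<Longrightarrow> card F \<noteq> i"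
  shows "exact_at K S i"
  using assms by (auto simp: exact_at_def)

text \<open>The diamond condition behind vanishing of the squared boundary: with both ends of a
  diamond, the two intermediate faces are present as well. Closure under subsets would be too
  strong, since faces whose coefficient is zero in the module are missing.\<close>

definition skew_convex :: "nat set set \<Rightarrow> bool" where
  "skew_convex S \<longleftrightarrow> (\<forall>G f g. G \<in> S \<longrightarrow> f \<notin> G \<longrightarrow> g \<notin> G \<longrightarrow> f \<noteq> g \<longrightarrow>
     insert f (insert g G) \<in> S \<longrightarrow> insert f G \<in> S)"

lemma skew_convexD:
  "skew_convex S \<Longrightarrow> G \<in> S \<Longrightarrow> f \<notin> G \<Longrightarrow> g \<notin> G \<Longrightarrow> f \<noteq> g \<Longrightarrow>
     insert f (insert g G) \<in> S \<Longrightarrow> insert f G \<in> S"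
  unfolding skew_convex_def by blast

lemma finite_bd_index:
  assumes "finite (\<Union>S)"
  shows "finite {f. f \<notin> G \<and> insert f G \<in> S}"
  by (rule finite_subset[OF _ assms]) auto

lemma bd_diff:
  "bd S (\<lambda>F. b F - c F) G = bd S b G - (bd S c G :: 'k::field_char_0)"
  by (simp add: bd_def right_diff_distrib sum_subtractf)

lemma bd_cong:
  assumes "\<And>f. f \<notin> G \<Longrightarrow> insert f G \<in> S \<Longrightarrow> b (insert f G) = c (insert f G)"
  shows "bd S b G = bd S c G"
  unfolding bd_def using assms by (auto intro!: sum.cong)

text \<open>Removing two elements in the two possible orders gives opposite signs, and skew
  convexity puts both orders into the index set. The double sum equals its own negative, hence
  vanishes in characteristic zero.\<close>

lemma bd_bd:
  fixes c :: "nat set \<Rightarrow> 'k::field_char_0"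
  assumes fin: "finite (\<Union>S)" and cv: "skew_convex S" and G: "G \<in> S"
  shows "bd S (bd S c) G = 0"
proof -
  define I where "I = {f. f \<notin> G \<and> insert f G \<in> S}"
  define J where "J f = {g. g \<notin> insert f G \<and> insert g (insert f G) \<in> S}" for f
  define h :: "nat \<Rightarrow> nat \<Rightarrow> 'k" where
    "h f g = pos_sign f G * (pos_sign g (insert f G) * c (insert g (insert f G)))" for f g
  have finG: "finite G"
    using fin G by (meson Union_upper finite_subset)
  have finI: "finite I" "\<And>f. finite (J f)"
    unfolding I_def J_def using fin by (rule finite_bd_index)+
  have "bd S (bd S c) G = (\<Sum>f\<in>I. \<Sum>g\<in>J f. h f g)"
    by (simp add: bd_def I_def J_def h_def sum_distrib_left)
  also have "\<dots> = (\<Sum>(f, g)\<in>Sigma I J. h f g)"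
    using finI by (subst sum.Sigma) auto
  finally have eq: "bd S (bd S c) G = (\<Sum>(f, g)\<in>Sigma I J. h f g)" .
  have sym: "(g, f) \<in> Sigma I J" if "(f, g) \<in> Sigma I J" for f g
  proof -
    have 1: "f \<notin> G" "g \<notin> G" "f \<noteq> g" "insert g (insert f G) \<in> S"
      using that by (auto simp: I_def J_def)
    then have "insert g G \<in> S"
      using skew_convexD[OF cv G] by metis
    with 1 show ?thesis
      by (auto simp: I_def J_def insert_commute)
  qed
  have anti: "h g f = - h f g" if "(f, g) \<in> Sigma I J" for f g
  proof -
    have 1: "f \<notin> G" "g \<notin> G" "f \<noteq> g"
      using that by (auto simp: I_def J_def)
    then show ?thesis
      using finG by (auto simp: h_def pos_sign_insert insert_commute)
  qed
  have "(\<Sum>(f, g)\<in>Sigma I J. h f g) = (\<Sum>(f, g)\<in>Sigma I J. h g f)"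
  proof (rule sum.reindex_bij_witness[of _ prod.swap prod.swap])
    show "prod.swap p \<in> Sigma I J" if "p \<in> Sigma I J" for p
      using sym[of "fst p" "snd p"] that by (metis prod.collapse prod.swap_def)
    then show "prod.swap p \<in> Sigma I J" if "p \<in> Sigma I J" for p
      using that by blast
  qed (simp_all add: split_beta)
  also have "\<dots> = - (\<Sum>(f, g)\<in>Sigma I J. h f g)"
    unfolding sum_negf[symmetric] by (rule sum.cong) (use anti in auto)
  finally show ?thesis
    using eq by simp
qed

section \<open>Subcomplexes, quotient complexes and the long exact sequence\<close>

definition subcomplex :: "nat set set \<Rightarrow> nat set set \<Rightarrow> bool" where
  "subcomplex A S \<longleftrightarrow> A \<subseteq> S \<and> (\<forall>G f. G \<in> S \<longrightarrow> f \<notin> G \<longrightarrow> insert f G \<in> A \<longrightarrow> G \<in> A)"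

text \<open>A subcomplex is closed under the boundary, so no face outside \<open>A\<close> has a
  coface inside it. This is why the plain set difference carries the quotient complex.\<close>

lemma bd_quotient:
  assumes "subcomplex A S" "G \<in> S - A"
  shows "bd (S - A) c G = bd S c G"
proof -
  have "{f. f \<notin> G \<and> insert f G \<in> S - A} = {f. f \<notin> G \<and> insert f G \<in> S}"
    using assms by (auto simp: subcomplex_def)
  then show ?thesis
    by (simp add: bd_def)
qed

lemma bd_sub:
  assumes "subcomplex A S" "finite (\<Union>S)"
    and "\<And>F. F \<in> S \<Longrightarrow> F \<notin> A \<Longrightarrow> card F = Suc (card G) \<Longrightarrow> c F = 0" "finite G"
  shows "bd A c G = bd S c G"
proof -
  have "A \<subseteq> S"
    using assms(1) by (simp add: subcomplex_def)
  then show ?thesis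
    unfolding bd_def using assms(3)[of "insert _ G"] assms(4)
    by (intro sum.mono_neutral_left finite_bd_index assms(2)) fastforce+
qed

lemma finite_face: "finite (\<Union>S) \<Longrightarrow> F \<in> S \<Longrightarrow> finite F"
  by (meson Union_upper finite_subset)

text \<open>The segment H_i(A) -> H_i(S) -> H_i(S/A). A cycle of \<open>S\<close> bounds modulo
  \<open>A\<close>; subtracting that boundary leaves a cycle supported on \<open>A\<close>, which
  bounds there.\<close>

lemma exact_extension:
  assumes fin: "finite (\<Union>S)" and cv: "skew_convex S" and sub: "subcomplex A S"
    and A: "exact_at K A i" and Q: "exact_at K (S - A) i"
  shows "exact_at (K :: 'k::field_char_0 itself) S i"
proof (rule exact_atI)
  fix c :: "nat set \<Rightarrow> 'k"
  assume c: "\<And>G. G \<in> S \<Longrightarrow> Suc (card G) = i \<Longrightarrow> bd S c G = 0"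
  have AS: "A \<subseteq> S"
    using sub by (simp add: subcomplex_def)
  have "bd (S - A) c G = 0" if "G \<in> S - A" "Suc (card G) = i" for G
    using that c by (simp add: bd_quotient[OF sub])
  then obtain b where b: "\<And>F. F \<in> S - A \<Longrightarrow> card F = i \<Longrightarrow> c F = bd (S - A) b F"
    using exact_atE[OF Q] by blast
  define c' where "c' F = c F - bd S b F" for F
  have c'0: "c' F = 0" if "F \<in> S" "F \<notin> A" "card F = i" for F
    using b[of F] that by (simp add: c'_def bd_quotient[OF sub])
  have "bd A c' G = 0" if G: "G \<in> A" "Suc (card G) = i" for G
  proof -
    have GS: "G \<in> S"
      using G AS by auto
    have "bd A c' G = bd S c' G"
      by (rule bd_sub[OF sub fin]) (use c'0 G finite_face[OF fin GS] in auto)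
    also have "\<dots> = 0"
      unfolding c'_def bd_diff using bd_bd[OF fin cv GS] c[OF GS] G by simp
    finally show ?thesis .
  qed
  then obtain b' where b': "\<And>F. F \<in> A \<Longrightarrow> card F = i \<Longrightarrow> c' F = bd A b' F"
    using exact_atE[OF A] by blast
  define b'' where "b'' F = (if F \<in> A then b' F else 0)" for F
  have "c F = bd S (\<lambda>F. b F - - b'' F) F" if F: "F \<in> S" "card F = i" for F
  proof -
    have "bd S b'' F = bd A b'' F"
      by (rule bd_sub[OF sub fin, symmetric]) (use finite_face[OF fin F(1)] in \<open>auto simp: b''_def\<close>)
    also have "\<dots> = bd A b' F"
      by (rule bd_cong) (simp add: b''_def)
    finally have 1: "bd S b'' F = bd A b' F" .
    have 2: "c' F = bd S b'' F"
    proof (cases "F \<in> A")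
      case True
      then show ?thesis
        using b' F 1 by simp
    next
      case False
      then have "insert f F \<notin> A" if "f \<notin> F" for f
        using sub F that by (auto simp: subcomplex_def)
      then have "{f. f \<notin> F \<and> insert f F \<in> A} = {}"
        by blast
      then have "bd A b' F = 0"
        by (simp only: bd_def sum.empty)
      then show ?thesis
        using c'0 False F 1 by simp
    qed
    have "bd S (\<lambda>F. b F - - b'' F) F = bd S b F + bd S b'' F"
      by (simp add: bd_def algebra_simps sum.distrib)
    then show ?thesis
      using 2 by (simp add: c'_def algebra_simps)
  qed
  then show "\<exists>b. \<forall>F\<in>S. card F = i \<longrightarrow> c F = bd S b F"
    by blast
qed

lemma bd_outside_sub:
  assumes sub: "subcomplex A S" and F: "F \<in> S" "F \<notin> A" and c: "\<And>H. H \<notin> A \<Longrightarrow> c H = 0"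
  shows "bd S c F = 0"
proof -
  have "insert f F \<notin> A" if "f \<notin> F" for f
    using sub F that by (auto simp: subcomplex_def)
  then show ?thesis
    unfolding bd_def using c by (auto intro!: sum.neutral)
qed

text \<open>The segment H_{i+1}(S/A) -> H_i(A) -> H_i(S). A cycle of \<open>A\<close> bounds some
  \<open>b\<close> in \<open>S\<close>, and \<open>b\<close> is itself a cycle modulo
  \<open>A\<close>.\<close>

lemma exact_sub:
  assumes fin: "finite (\<Union>S)" and cv: "skew_convex S" and sub: "subcomplex A S"
    and S: "exact_at K S i" and Q: "exact_at K (S - A) (Suc i)"
  shows "exact_at (K :: 'k::field_char_0 itself) A i"
proof (rule exact_atI)
  fix c :: "nat set \<Rightarrow> 'k"
  assume c: "\<And>G. G \<in> A \<Longrightarrow> Suc (card G) = i \<Longrightarrow> bd A c G = 0"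
  have AS: "A \<subseteq> S"
    using sub by (simp add: subcomplex_def)
  define c' where "c' F = (if F \<in> A then c F else 0)" for F
  have "bd S c' G = 0" if G: "G \<in> S" "Suc (card G) = i" for G
  proof (cases "G \<in> A")
    case True
    have "bd S c' G = bd A c' G"
      by (rule bd_sub[OF sub fin, symmetric]) (use finite_face[OF fin G(1)] in \<open>auto simp: c'_def\<close>)
    also have "\<dots> = bd A c G"
      by (rule bd_cong) (simp add: c'_def)
    finally show ?thesis
      using c True G by simp
  next
    case False
    then show ?thesis
      by (intro bd_outside_sub[OF sub G(1)]) (auto simp: c'_def)
  qed
  then obtain b where b: "\<And>F. F \<in> S \<Longrightarrow> card F = i \<Longrightarrow> c' F = bd S b F"
    using exact_atE[OF S] by blast
  have "bd (S - A) b G = 0" if "G \<in> S - A" "Suc (card G) = Suc i" for G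
    using b[of G] that by (simp add: bd_quotient[OF sub] c'_def)
  then obtain b' where b': "\<And>F. F \<in> S - A \<Longrightarrow> card F = Suc i \<Longrightarrow> b F = bd (S - A) b' F"
    using exact_atE[OF Q] by blast
  \<comment> \<open>Subtracting the boundary of \<open>b'\<close> removes the part of
    \<open>b\<close> outside \<open>A\<close> in cardinality \<open>i + 1\<close> and does not
    change the boundary of \<open>b\<close>.\<close>
  have "c F = bd A (\<lambda>F. b F - bd S b' F) F" if F: "F \<in> A" "card F = i" for F
  proof -
    have FS: "F \<in> S"
      using F AS by auto
    have "bd A (\<lambda>F. b F - bd S b' F) F = bd S (\<lambda>F. b F - bd S b' F) F"
      by (rule bd_sub[OF sub fin])
        (use finite_face[OF fin FS] F b' in \<open>auto simp: bd_quotient[OF sub]\<close>)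
    also have "\<dots> = bd S b F"
      by (simp add: bd_diff bd_bd[OF fin cv FS])
    also have "\<dots> = c F"
      using b[OF FS] F by (simp add: c'_def)
    finally show ?thesis by simp
  qed
  then show "\<exists>b. \<forall>F\<in>A. card F = i \<longrightarrow> c F = bd A b F"
    by blast
qed

text \<open>The segment H_i(S) -> H_i(S/A) -> H_{i-1}(A). The boundary of a cycle modulo
  \<open>A\<close> is a cycle of \<open>A\<close>; once it bounds there, the cycle can be corrected
  on \<open>A\<close> to a cycle of \<open>S\<close>. In degree 0 there is no boundary to
  correct.\<close>

lemma exact_quotient:
  assumes fin: "finite (\<Union>S)" and cv: "skew_convex S" and sub: "subcomplex A S"
    and S: "exact_at K S i" and A: "i > 0 \<Longrightarrow> exact_at K A (i - 1)"
  shows "exact_at (K :: 'k::field_char_0 itself) (S - A) i"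
proof (rule exact_atI)
  fix c :: "nat set \<Rightarrow> 'k"
  assume c: "\<And>G. G \<in> S - A \<Longrightarrow> Suc (card G) = i \<Longrightarrow> bd (S - A) c G = 0"
  have AS: "A \<subseteq> S"
    using sub by (simp add: subcomplex_def)
  have "\<exists>b. \<forall>F\<in>A. Suc (card F) = i \<longrightarrow> bd S c F = bd A b F"
  proof (cases "i > 0")
    case True
    have "bd A (bd S c) G = 0" if G: "G \<in> A" "Suc (card G) = i - 1" for G
    proof -
      have GS: "G \<in> S"
        using G AS by auto
      have "bd A (bd S c) G = bd S (bd S c) G"
        by (rule bd_sub[OF sub fin])
          (use finite_face[OF fin GS] G c True in \<open>auto simp: bd_quotient[OF sub]\<close>)
      then show ?thesis
        by (simp add: bd_bd[OF fin cv GS])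
    qed
    from exact_atE[OF A[OF True] this] obtain b
      where "\<And>F. F \<in> A \<Longrightarrow> card F = i - 1 \<Longrightarrow> bd S c F = bd A b F"
      by blast
    then show ?thesis
      using True by (metis diff_Suc_1)
  qed simp
  then obtain b where b: "\<And>F. F \<in> A \<Longrightarrow> Suc (card F) = i \<Longrightarrow> bd S c F = bd A b F"
    by blast
  define b' where "b' F = (if F \<in> A then b F else 0)" for F
  have "bd S (\<lambda>F. c F - b' F) G = 0" if G: "G \<in> S" "Suc (card G) = i" for G
  proof (cases "G \<in> A")
    case True
    have "bd S b' G = bd A b' G"
      by (rule bd_sub[OF sub fin, symmetric]) (use finite_face[OF fin G(1)] in \<open>auto simp: b'_def\<close>)
    also have "\<dots> = bd A b G"
      by (rule bd_cong) (simp add: b'_def)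
    finally show ?thesis
      using b True G by (simp add: bd_diff)
  next
    case False
    then have "bd S b' G = 0"
      by (intro bd_outside_sub[OF sub G(1)]) (auto simp: b'_def)
    then show ?thesis
      using c[of G] G False by (simp add: bd_diff bd_quotient[OF sub])
  qed
  then obtain a where a: "\<And>F. F \<in> S \<Longrightarrow> card F = i \<Longrightarrow> c F - b' F = bd S a F"
    using exact_atE[OF S, of "\<lambda>F. c F - b' F"] by blast
  have "c F = bd (S - A) a F" if "F \<in> S - A" "card F = i" for F
    using a[of F] that by (simp add: bd_quotient[OF sub] b'_def)
  then show "\<exists>b. \<forall>F\<in>S - A. card F = i \<longrightarrow> c F = bd (S - A) b F"
    by blast
qed

text \<open>Adding the apex \<open>e\<close> is a contracting homotopy, and \<open>b\<close> is its
  value at \<open>c\<close>. On a face without \<open>e\<close> only the coface through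
  \<open>e\<close> contributes; on a face with \<open>e\<close> the cycle condition at the face
  without \<open>e\<close> gives the value.\<close>

lemma exact_cone:
  assumes fin: "finite (\<Union>S)"
    and ins: "\<And>F. F \<in> S \<Longrightarrow> insert e F \<in> S" and del: "\<And>F. F \<in> S \<Longrightarrow> F - {e} \<in> S"
  shows "exact_at (K :: 'k::field_char_0 itself) S i"
proof (rule exact_atI)
  fix c :: "nat set \<Rightarrow> 'k"
  assume c: "\<And>G. G \<in> S \<Longrightarrow> Suc (card G) = i \<Longrightarrow> bd S c G = 0"
  define b where "b F = (if e \<in> F then pos_sign e (F - {e}) * c (F - {e}) else 0)" for F
  have "c G = bd S b G" if G: "G \<in> S" "card G = i" for G
  proof (cases "e \<in> G")
    case False
    have "bd S b G = (\<Sum>f\<in>{e}. pos_sign f G * b (insert f G))"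
      unfolding bd_def using finite_bd_index[OF fin] ins[OF G(1)] False
      by (intro sum.mono_neutral_right) (auto simp: b_def)
    also have "\<dots> = c G"
      using False by (simp add: b_def flip: mult.assoc)
    finally show ?thesis by simp
  next
    case True
    define H where "H = G - {e}"
    have HS: "H \<in> S" and GH: "G = insert e H" and eH: "e \<notin> H"
      using del[OF G(1)] True by (auto simp: H_def)
    have finH: "finite H"
      using finite_face[OF fin HS] .
    have cardH: "Suc (card H) = i"
      using G finH eH GH by simp
    define J where "J = {f. f \<notin> G \<and> insert f G \<in> S}"
    have J: "{f. f \<notin> H \<and> insert f H \<in> S} = insert e J"
    proof -
      have "insert f G \<in> S \<longleftrightarrow> insert f H \<in> S" if "f \<notin> G" for f
      proof
        assume "insert f G \<in> S"
        from del[OF this] show "insert f H \<in> S"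
          using that True by (simp add: H_def insert_Diff_if split: if_splits)
      next
        assume "insert f H \<in> S"
        from ins[OF this] show "insert f G \<in> S"
          by (simp add: GH insert_commute)
      qed
      then show ?thesis
        using eH G(1) by (auto simp: J_def GH)
    qed
    have finJ: "finite J" "e \<notin> J"
      unfolding J_def using finite_bd_index[OF fin] True by auto
    have "0 = bd S c H"
      using c[OF HS cardH] by simp
    also have "\<dots> = pos_sign e H * c G + (\<Sum>f\<in>J. pos_sign f H * c (insert f H))"
      unfolding bd_def J using finJ by (simp add: GH)
    finally have 1: "(\<Sum>f\<in>J. pos_sign f H * c (insert f H)) = - (pos_sign e H * c G)"
      by (simp add: eq_neg_iff_add_eq_0 add.commute)
    have "bd S b G = (\<Sum>f\<in>J. - pos_sign e H * (pos_sign f H * c (insert f H)))"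
      unfolding bd_def J_def[symmetric]
    proof (rule sum.cong[OF refl])
      fix f assume "f \<in> J"
      then have f: "f \<notin> H" "f \<noteq> e"
        by (auto simp: J_def GH)
      then have "insert f G - {e} = insert f H"
        using eH by (auto simp: GH)
      then show "pos_sign f G * b (insert f G) = - pos_sign e H * (pos_sign f H * c (insert f H))"
        using f eH finH by (auto simp: b_def GH pos_sign_insert)
    qed
    also have "\<dots> = - pos_sign e H * - (pos_sign e H * c G)"
      by (simp only: sum_distrib_left[symmetric] 1)
    also have "\<dots> = c G"
      by (simp flip: mult.assoc)
    finally show ?thesis by simp
  qed
  then show "\<exists>b. \<forall>F\<in>S. card F = i \<longrightarrow> c F = bd S b F"
    by blast
qed

text \<open>Faces that all contain \<open>e\<close> form a copy of the complex \<open>S\<close>, one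
  homological degree higher and up to signs.\<close>

lemma exact_star:
  assumes fin: "finite (\<Union>S)" and e: "e \<notin> \<Union>S" and S: "exact_at K S i"
  shows "exact_at (K :: 'k::field_char_0 itself) (insert e ` S) (Suc i)"
proof (rule exact_atI)
  fix c :: "nat set \<Rightarrow> 'k"
  assume c: "\<And>G. G \<in> insert e ` S \<Longrightarrow> Suc (card G) = Suc i \<Longrightarrow> bd (insert e ` S) c G = 0"
  \<comment> \<open>The position of \<open>f\<close> changes on inserting \<open>e\<close> exactly
    if \<open>e < f\<close>; rescaling each face by the parity of its elements above
    \<open>e\<close> absorbs these signs.\<close>
  define u :: "nat set \<Rightarrow> 'k" where "u F = (-1) ^ card {g\<in>F. e < g}" for F
  have uu: "u F * u F = 1" for F
    by (simp add: u_def flip: power_mult_distrib)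
  have u_insert: "u (insert f F) = (if e < f then -1 else 1) * u F" if "finite F" "f \<notin> F" for f F
  proof -
    have "{g\<in>insert f F. e < g} = (if e < f then insert f {g\<in>F. e < g} else {g\<in>F. e < g})"
      by auto
    then show ?thesis
      using that by (simp add: u_def)
  qed
  have inS: "insert e F \<in> insert e ` S \<longleftrightarrow> F \<in> S" if "e \<notin> F" for F
  proof
    assume "insert e F \<in> insert e ` S"
    then obtain F' where F': "F' \<in> S" "insert e F = insert e F'"
      by auto
    then have "F = F'"
      using e that by (metis Diff_insert_absorb UnionI)
    with F' show "F \<in> S" by simp
  qed simp
  have bd_eq: "bd (insert e ` S) a (insert e F) = u F * bd S (\<lambda>F. u F * a (insert e F)) F"
    if F: "F \<in> S" for F and a :: "nat set \<Rightarrow> 'k"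
  proof -
    have eF: "e \<notin> F" and finF: "finite F"
      using e F finite_face[OF fin] by auto
    have I: "{f. f \<notin> insert e F \<and> insert f (insert e F) \<in> insert e ` S} = {f. f \<notin> F \<and> insert f F \<in> S}"
    proof -
      have "insert f (insert e F) \<in> insert e ` S \<longleftrightarrow> insert f F \<in> S" if "f \<noteq> e" for f
        using inS[of "insert f F"] eF that by (auto simp: insert_commute)
      moreover have "f \<noteq> e" if "insert f F \<in> S" for f
        using e that by auto
      ultimately show ?thesis
        by auto
    qed
    show ?thesis
      unfolding bd_def I sum_distrib_left
    proof (rule sum.cong[OF refl], clarify)
      fix f assume f: "f \<notin> F" "insert f F \<in> S"
      have "u F * (pos_sign f F * (u (insert f F) * a (insert e (insert f F)))) =
          (u F * u F) * ((if e < f then -1 else 1) * (pos_sign f F * a (insert e (insert f F))))"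
        using f finF by (simp add: u_insert)
      then show "pos_sign f (insert e F) * a (insert f (insert e F)) =
          u F * (pos_sign f F * (u (insert f F) * a (insert e (insert f F))))"
        using eF finF by (auto simp: uu pos_sign_insert insert_commute)
    qed
  qed
  have "bd S (\<lambda>F. u F * c (insert e F)) G = 0" if G: "G \<in> S" "Suc (card G) = i" for G
  proof -
    have "Suc (card (insert e G)) = Suc i"
      using G e finite_face[OF fin G(1)] by (subst card_insert_disjoint) auto
    then have "u G * bd S (\<lambda>F. u F * c (insert e F)) G = 0"
      using c[of "insert e G"] G bd_eq[OF G(1), of c] by simp
    moreover have "u G \<noteq> 0"
      by (simp add: u_def)
    ultimately show ?thesis by simp
  qed
  from exact_atE[OF S, of "\<lambda>F. u F * c (insert e F)", OF this] obtain b
    where b: "\<And>F. F \<in> S \<Longrightarrow> card F = i \<Longrightarrow> u F * c (insert e F) = bd S b F"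
    by blast
  define b' where "b' F = u (F - {e}) * b (F - {e})" for F
  have "c (insert e F) = bd (insert e ` S) b' (insert e F)" if F: "F \<in> S" "card F = i" for F
  proof -
    have "bd S (\<lambda>F. u F * b' (insert e F)) F = bd S b F"
    proof (rule bd_cong)
      fix f assume "f \<notin> F" "insert f F \<in> S"
      then have "e \<notin> insert f F"
        using e by blast
      then show "u (insert f F) * b' (insert e (insert f F)) = b (insert f F)"
        by (simp add: b'_def uu flip: mult.assoc)
    qed
    then have "bd (insert e ` S) b' (insert e F) = u F * (u F * c (insert e F))"
      using b[OF F] by (simp add: bd_eq[OF F(1)])
    then show ?thesis
      by (simp add: uu flip: mult.assoc)
  qed
  moreover have "card F = i" if "F \<in> S" "card (insert e F) = Suc i" for F
    using that e finite_face[OF fin that(1)] by (subst (asm) card_insert_disjoint) auto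
  ultimately show "\<exists>b. \<forall>F\<in>insert e ` S. card F = Suc i \<longrightarrow> c F = bd (insert e ` S) b F"
    by blast
qed

section \<open>Koszul homology of monomial subquotients\<close>

locale edge_koszul =
  fixes K :: "'k::field_char_0 itself" and ends :: "nat \<Rightarrow> 'v multiset"
  assumes size_ends: "size (ends e) = 2"
begin

text \<open>A set \<open>P\<close> of vertex monomials stands for the module with basis \<open>P\<close> in which a product
leaving \<open>P\<close> is zero. Then \<open>strand T P \<mu>\<close> indexes a basis of the multidegree \<open>\<mu>\<close> part of the Koszul
complex of \<open>P\<close> on the variables \<open>T\<close>: the coefficient monomial of a face is determined by \<open>\<mu>\<close>.\<close>

definition strand :: "nat set \<Rightarrow> 'v multiset set \<Rightarrow> 'v multiset \<Rightarrow> nat set set" where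
  "strand T P \<mu> = {F. F \<subseteq> T \<and> (\<exists>m\<in>P. m + (\<Sum>f\<in>F. ends f) = \<mu>)}"

text \<open>The internal degree \<open>n\<close> is the size of the vertex monomial, twice the degree in the edge
variables.\<close>

definition tor_zero :: "nat set \<Rightarrow> 'v multiset set \<Rightarrow> nat \<Rightarrow> nat \<Rightarrow> bool" where
  "tor_zero T P i n \<longleftrightarrow> (\<forall>\<mu>. size \<mu> = n \<longrightarrow> exact_at K (strand T P \<mu>) i)"

text \<open>A non-zero product of an element with two variables has non-zero partial products. This
  makes multiplication with the convention "zero outside \<open>P\<close>" associative, and becomes
  the diamond condition on strands.\<close>

definition convex_mod :: "nat set \<Rightarrow> 'v multiset set \<Rightarrow> bool" where
  "convex_mod T P \<longleftrightarrow> (\<forall>m\<in>P. \<forall>e\<in>T. \<forall>f\<in>T. m + ends e + ends f \<in> P \<longrightarrow> m + ends e \<in> P)"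

definition submod :: "nat set \<Rightarrow> 'v multiset set \<Rightarrow> 'v multiset set \<Rightarrow> bool" where
  "submod T A P \<longleftrightarrow> A \<subseteq> P \<and> (\<forall>m\<in>A. \<forall>e\<in>T. m + ends e \<in> P \<longrightarrow> m + ends e \<in> A)"

lemma convex_modD:
  "convex_mod T P \<Longrightarrow> m \<in> P \<Longrightarrow> e \<in> T \<Longrightarrow> f \<in> T \<Longrightarrow> m + ends e + ends f \<in> P \<Longrightarrow> m + ends e \<in> P"
  unfolding convex_mod_def by blast

lemma finite_strand: "finite T \<Longrightarrow> finite (\<Union> (strand T P \<mu>))"
  by (rule finite_subset[of _ T]) (auto simp: strand_def)

lemma strand_insert_iff:
  assumes "finite T" "f \<notin> G"
  shows "insert f G \<in> strand T P \<mu> \<longleftrightarrow>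
    f \<in> T \<and> G \<subseteq> T \<and> (\<exists>m\<in>P. m + ends f + (\<Sum>g\<in>G. ends g) = \<mu>)"
proof (cases "finite G")
  case True
  then show ?thesis
    using assms by (auto simp: strand_def add.assoc)
next
  case False
  then show ?thesis
    using assms by (auto simp: strand_def dest: finite_subset)
qed

text \<open>If the largest face of the diamond has coefficient \<open>m'\<close>, the smallest has
  \<open>m' + ends g + ends f\<close>, and the intermediate face \<open>insert f G\<close> has
  \<open>m' + ends g\<close>, which is what convexity provides.\<close>

lemma skew_convex_strand:
  assumes fin: "finite T" and cv: "convex_mod T P"
  shows "skew_convex (strand T P \<mu>)"
  unfolding skew_convex_def
proof (intro allI impI)
  fix G f g
  assume G: "G \<in> strand T P \<mu>" and fg: "f \<notin> G" "g \<notin> G" "f \<noteq> g"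
    and H: "insert f (insert g G) \<in> strand T P \<mu>"
  from G obtain m where m: "m \<in> P" "m + (\<Sum>g\<in>G. ends g) = \<mu>" and GT: "G \<subseteq> T"
    by (auto simp: strand_def)
  have finG: "finite G"
    using GT fin by (rule finite_subset)
  from H obtain m' where m': "m' \<in> P" "m' + ends f + (\<Sum>h\<in>insert g G. ends h) = \<mu>"
    and T: "f \<in> T" "g \<in> T"
    using strand_insert_iff[OF fin, of f "insert g G"] fg by auto
  have "m' + ends g + ends f + (\<Sum>g\<in>G. ends g) = m + (\<Sum>g\<in>G. ends g)"
    using m m' finG fg by (simp add: ac_simps)
  then have "m = m' + ends g + ends f"
    by simp
  then have 1: "m' + ends g \<in> P"
    using convex_modD[OF cv m'(1) T(2,1)] m by simp
  have "m' + ends g + ends f + (\<Sum>g\<in>G. ends g) = \<mu>"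
    using m' finG fg by (simp add: ac_simps)
  with 1 show "insert f G \<in> strand T P \<mu>"
    using T GT fg by (auto simp: strand_insert_iff[OF fin])
qed

lemma strand_diff:
  assumes "A \<subseteq> P"
  shows "strand T (P - A) \<mu> = strand T P \<mu> - strand T A \<mu>"
proof -
  have "m = m'" if "m + (\<Sum>g\<in>G. ends g) = \<mu>" "m' + (\<Sum>g\<in>G. ends g) = \<mu>" for m m' G
    using that by (metis add_right_cancel)
  then show ?thesis
    using assms unfolding strand_def by blast
qed

lemma subcomplex_strand:
  assumes fin: "finite T" and sub: "submod T A P"
  shows "subcomplex (strand T A \<mu>) (strand T P \<mu>)"
  unfolding subcomplex_def
proof (intro conjI allI impI)
  show "strand T A \<mu> \<subseteq> strand T P \<mu>"
    using sub by (auto simp: strand_def submod_def)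
next
  fix G f
  assume G: "G \<in> strand T P \<mu>" and f: "f \<notin> G" and H: "insert f G \<in> strand T A \<mu>"
  from G obtain m where m: "m \<in> P" "m + (\<Sum>g\<in>G. ends g) = \<mu>" and GT: "G \<subseteq> T"
    by (auto simp: strand_def)
  from H obtain m' where m': "m' \<in> A" "m' + ends f + (\<Sum>g\<in>G. ends g) = \<mu>" and T: "f \<in> T"
    using strand_insert_iff[OF fin f] by auto
  then have "m' + ends f = m"
    using m by (metis add_right_cancel)
  then have "m \<in> A"
    using sub m' m T by (auto simp: submod_def)
  then show "G \<in> strand T A \<mu>"
    using m GT by (auto simp: strand_def)
qed

lemma tor_zero_extension:
  assumes "finite T" "convex_mod T P" "submod T A P"
    and "tor_zero T A i n" "tor_zero T (P - A) i n"
  shows "tor_zero T P i n"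
  using assms unfolding tor_zero_def
  by (auto simp: strand_diff submod_def
      intro: exact_extension[OF finite_strand skew_convex_strand subcomplex_strand])

lemma tor_zero_sub:
  assumes "finite T" "convex_mod T P" "submod T A P"
    and "tor_zero T P i n" "tor_zero T (P - A) (Suc i) n"
  shows "tor_zero T A i n"
  using assms unfolding tor_zero_def
  by (auto simp: strand_diff submod_def
      intro: exact_sub[OF finite_strand skew_convex_strand subcomplex_strand])

lemma tor_zero_quotient:
  assumes "finite T" "convex_mod T P" and sub: "submod T A P"
    and "tor_zero T P i n" "i > 0 \<Longrightarrow> tor_zero T A (i - 1) n"
  shows "tor_zero T (P - A) i n"
proof -
  have "A \<subseteq> P"
    using sub by (simp add: submod_def)
  then show ?thesis
    using assms unfolding tor_zero_def
    by (auto simp: strand_diff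
        intro: exact_quotient[OF finite_strand skew_convex_strand subcomplex_strand])
qed

lemma strand_shift: "strand T ((+) s ` P) (s + \<mu>) = strand T P \<mu>"
  by (auto simp: strand_def add.assoc)

lemma tor_zero_shift:
  "tor_zero T ((+) s ` P) i (size s + n) \<longleftrightarrow> tor_zero T P i n"
proof
  assume *: "tor_zero T ((+) s ` P) i (size s + n)"
  show "tor_zero T P i n"
    unfolding tor_zero_def
  proof (intro allI impI)
    fix \<mu> :: "'v multiset" assume "size \<mu> = n"
    then show "exact_at K (strand T P \<mu>) i"
      using *[unfolded tor_zero_def, rule_format, of "s + \<mu>"] by (simp add: strand_shift)
  qed
next
  assume *: "tor_zero T P i n"
  show "tor_zero T ((+) s ` P) i (size s + n)"
    unfolding tor_zero_def
  proof (intro allI impI)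
    fix \<mu> :: "'v multiset" assume n: "size \<mu> = size s + n"
    show "exact_at K (strand T ((+) s ` P) \<mu>) i"
    proof (cases "s \<subseteq># \<mu>")
      case True
      then obtain \<nu> where \<nu>: "\<mu> = s + \<nu>"
        by (metis subset_mset.add_diff_inverse)
      then show ?thesis
        using * n by (simp add: strand_shift tor_zero_def)
    next
      case False
      then have "strand T ((+) s ` P) \<mu> = {}"
        by (auto simp: strand_def add.assoc)
      then show ?thesis
        by (auto intro: exact_at_no_faces)
    qed
  qed
qed

text \<open>The Koszul complex on one more variable is a mapping cone, whatever the action of
  \<open>e\<close>: the faces without \<open>e\<close> form the old strand, and those with
  \<open>e\<close> a copy of the old strand in the multidegree divided by \<open>e\<close>, moved up
  by one homological degree.\<close>

lemma tor_zero_add_variable: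
  assumes fin: "finite T" and e: "e \<notin> T" and cv: "convex_mod (insert e T) P"
    and 0: "tor_zero T P i n" and 1: "\<And>j. i = Suc j \<Longrightarrow> n \<ge> 2 \<Longrightarrow> tor_zero T P j (n - 2)"
  shows "tor_zero (insert e T) P i n"
  unfolding tor_zero_def
proof (intro allI impI)
  fix \<mu> :: "'v multiset" assume n: "size \<mu> = n"
  let ?S = "strand (insert e T) P \<mu>" and ?A = "strand T P \<mu>"
  have finI: "finite (insert e T)"
    using fin by simp
  have sub: "subcomplex ?A ?S"
    using e by (auto simp: subcomplex_def strand_def)
  show "exact_at K ?S i"
  proof (rule exact_extension[OF finite_strand[OF finI] skew_convex_strand[OF finI cv] sub])
    show "exact_at K ?A i"
      using 0 n by (simp add: tor_zero_def)
    have Q: "F \<in> ?S - ?A \<longleftrightarrow> e \<in> F \<and> F - {e} \<subseteq> T \<and> (\<exists>m\<in>P. m + ends e + (\<Sum>f\<in>F - {e}. ends f) = \<mu>)" for F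
    proof -
      have "F \<in> ?S - ?A \<longleftrightarrow> e \<in> F \<and> F \<in> ?S"
        using e by (auto simp: strand_def)
      also have "\<dots> \<longleftrightarrow> e \<in> F \<and> insert e (F - {e}) \<in> ?S"
        by (auto simp: insert_absorb)
      also have "\<dots> \<longleftrightarrow> e \<in> F \<and> F - {e} \<subseteq> T \<and> (\<exists>m\<in>P. m + ends e + (\<Sum>f\<in>F - {e}. ends f) = \<mu>)"
        using strand_insert_iff[OF finI, of e "F - {e}"] by auto
      finally show ?thesis .
    qed
    show "exact_at K (?S - ?A) i"
    proof (cases "ends e \<subseteq># \<mu> \<and> i > 0")
      case True
      then obtain \<nu> j where \<nu>: "\<mu> = ends e + \<nu>" and j: "i = Suc j"
        by (metis gr0_conv_Suc subset_mset.add_diff_inverse)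
      have "?S - ?A = insert e ` strand T P \<nu>"
      proof (intro set_eqI iffI)
        fix F assume "F \<in> ?S - ?A"
        then obtain m where "e \<in> F" "F - {e} \<subseteq> T" "m \<in> P"
          "m + ends e + (\<Sum>f\<in>F - {e}. ends f) = ends e + \<nu>"
          unfolding Q unfolding \<nu> by blast
        moreover from this(4) have "m + (\<Sum>f\<in>F - {e}. ends f) = \<nu>"
          by (simp add: add.commute[of m] add.assoc)
        ultimately have "e \<in> F" "F - {e} \<in> strand T P \<nu>"
          by (auto simp: strand_def)
        then show "F \<in> insert e ` strand T P \<nu>"
          by (metis image_eqI insert_Diff)
      next
        fix F assume "F \<in> insert e ` strand T P \<nu>"
        then obtain G where G: "G \<in> strand T P \<nu>" "F = insert e G"
          by auto
        then have "e \<notin> G"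
          using e by (auto simp: strand_def)
        then show "F \<in> ?S - ?A"
          unfolding Q using G by (auto simp: \<nu> strand_def ac_simps)
      qed
      moreover have "exact_at K (strand T P \<nu>) j"
        using 1[OF j] n size_ends[of e] by (simp add: \<nu> tor_zero_def)
      moreover have "e \<notin> \<Union> (strand T P \<nu>)"
        using e by (auto simp: strand_def)
      ultimately show ?thesis
        unfolding j by (metis exact_star finite_strand[OF fin])
    next
      case False
      have "card F \<noteq> i" if "F \<in> ?S - ?A" for F
      proof -
        from that have F: "e \<in> F" "F - {e} \<subseteq> T" "\<exists>m\<in>P. m + ends e + (\<Sum>f\<in>F - {e}. ends f) = \<mu>"
          unfolding Q by auto
        then have "ends e \<subseteq># \<mu>"
          by (metis mset_subset_eq_add_left mset_subset_eq_add_right subset_mset.order_trans)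
        moreover have "finite F"
          using F fin by (meson finite_Diff_insert finite.emptyI finite_subset finite_Diff2)
        ultimately show ?thesis
          using False F by (auto simp: card_gt_0_iff)
      qed
      then show ?thesis
        by (rule exact_at_no_faces)
    qed
  qed
qed

section \<open>Quotients by a variable\<close>

definition mod_quot :: "nat \<Rightarrow> 'v multiset set \<Rightarrow> 'v multiset set" where
  "mod_quot e P = P - (\<lambda>m. m + ends e) ` P"

lemma mod_quot_iff: "m \<in> mod_quot e P \<longleftrightarrow> m \<in> P \<and> (\<forall>m'\<in>P. m \<noteq> m' + ends e)"
  by (auto simp: mod_quot_def)

lemma convex_mod_mono: "convex_mod T P \<Longrightarrow> T' \<subseteq> T \<Longrightarrow> convex_mod T' P"
  unfolding convex_mod_def by blast

text \<open>Convexity of \<open>P\<close> with respect to \<open>e\<close> is essential: if m f = m'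
  e and m f g lies in \<open>P\<close>, then m' g lies in \<open>P\<close>, and m f g would be a
  multiple of \<open>e\<close>.\<close>

lemma convex_mod_quot:
  assumes cv: "convex_mod (insert e T) P"
  shows "convex_mod T (mod_quot e P)"
  unfolding convex_mod_def
proof (intro ballI impI)
  fix m f g assume m: "m \<in> mod_quot e P" and fg: "f \<in> T" "g \<in> T"
    and h: "m + ends f + ends g \<in> mod_quot e P"
  have 1: "m + ends f \<in> P"
    using convex_modD[OF cv, of m f g] m fg h by (auto simp: mod_quot_def)
  moreover have "m + ends f \<noteq> m' + ends e" if m': "m' \<in> P" for m'
  proof
    assume eq: "m + ends f = m' + ends e"
    have "m' + ends g + ends e \<in> P"
      using h eq by (simp add: mod_quot_def ac_simps)
    then have "m' + ends g \<in> P"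
      using convex_modD[OF cv m', of g e] fg by simp
    then have "m + ends f + ends g \<in> (\<lambda>m. m + ends e) ` P"
      using eq by (auto simp: ac_simps image_iff)
    then show False
      using h by (simp add: mod_quot_def)
  qed
  ultimately show "m + ends f \<in> mod_quot e P"
    by (auto simp: mod_quot_def)
qed

text \<open>The faces to which \<open>e\<close> can be added form a cone with apex \<open>e\<close>, and the remaining ones are
the strand of the quotient.\<close>

lemma tor_zero_regular:
  assumes fin: "finite T" and e: "e \<notin> T" and cv: "convex_mod (insert e T) P"
    and reg: "\<And>m. m \<in> P \<Longrightarrow> m + ends e \<in> P"
  shows "tor_zero (insert e T) P i n \<longleftrightarrow> tor_zero T (mod_quot e P) i n"
proof -
  have "exact_at K (strand (insert e T) P \<mu>) i \<longleftrightarrow> exact_at K (strand T (mod_quot e P) \<mu>) i" for \<mu>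
  proof -
    let ?S = "strand (insert e T) P \<mu>"
    define A where "A = {F\<in>?S. insert e F \<in> ?S}"
    have finI: "finite (insert e T)"
      using fin by simp
    have finS: "finite (\<Union>?S)" and cvS: "skew_convex ?S"
      using finite_strand[OF finI] skew_convex_strand[OF finI cv] by auto
    \<comment> \<open>Here regularity enters: dropping \<open>e\<close> from a face multiplies its
      coefficient by \<open>e\<close>, and the product has to stay in \<open>P\<close>.\<close>
    have del: "F - {e} \<in> ?S" if "F \<in> ?S" for F
    proof (cases "e \<in> F")
      case True
      then have "insert e (F - {e}) \<in> ?S"
        using that by (simp add: insert_absorb)
      then obtain m where "m \<in> P" "m + ends e + (\<Sum>f\<in>F - {e}. ends f) = \<mu>" "F - {e} \<subseteq> insert e T"
        by (subst (asm) strand_insert_iff[OF finI]) auto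
      then show ?thesis
        using reg by (auto simp: strand_def)
    qed (use that in simp)
    have sub: "subcomplex A ?S"
      unfolding subcomplex_def
    proof (intro conjI allI impI)
      fix G f assume G: "G \<in> ?S" "f \<notin> G" "insert f G \<in> A"
      show "G \<in> A"
      proof (cases "e = f \<or> e \<in> G")
        case True
        then show ?thesis
          using G by (auto simp: A_def insert_absorb)
      next
        case False
        then have "insert e (insert f G) \<in> ?S"
          using G by (simp add: A_def)
        then have "insert e G \<in> ?S"
          using skew_convexD[OF cvS G(1)] False G by metis
        then show ?thesis
          using G by (simp add: A_def)
      qed
    qed (auto simp: A_def)
    have finA: "finite (\<Union>A)"
      by (rule finite_subset[OF _ finS]) (auto simp: A_def)
    have A: "exact_at K A j" for j
    proof (rule exact_cone[OF finA, of e])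
      show "insert e F \<in> A" if "F \<in> A" for F
        using that by (auto simp: A_def)
      show "F - {e} \<in> A" if "F \<in> A" for F
        using that del by (auto simp: A_def)
    qed
    have "?S - A = strand T (mod_quot e P) \<mu>"
    proof (intro set_eqI iffI)
      fix F assume F: "F \<in> ?S - A"
      then have eF: "e \<notin> F"
        by (auto simp: A_def insert_absorb)
      from F obtain m where m: "m \<in> P" "m + (\<Sum>f\<in>F. ends f) = \<mu>" "F \<subseteq> insert e T"
        by (auto simp: strand_def)
      have "m \<noteq> m' + ends e" if "m' \<in> P" for m'
        using F m that by (auto simp: A_def strand_insert_iff[OF finI eF])
      then show "F \<in> strand T (mod_quot e P) \<mu>"
        using m eF by (auto simp: strand_def mod_quot_def)
    next
      fix F assume "F \<in> strand T (mod_quot e P) \<mu>"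
      then obtain m where m: "m \<in> P" "m + (\<Sum>f\<in>F. ends f) = \<mu>" "F \<subseteq> T"
        and m': "\<And>m'. m' \<in> P \<Longrightarrow> m \<noteq> m' + ends e"
        by (auto simp: strand_def mod_quot_def)
      have eF: "e \<notin> F"
        using m e by auto
      have "insert e F \<notin> ?S"
        unfolding strand_insert_iff[OF finI eF] using m m' by (metis add_right_cancel)
      then show "F \<in> ?S - A"
        using m by (auto simp: A_def strand_def)
    qed
    \<comment> \<open>The cone \<open>A\<close> is exact in every degree, so exactness passes
      between the strand and its quotient in both directions.\<close>
    then show ?thesis
      using exact_extension[OF finS cvS sub A] exact_quotient[OF finS cvS sub _ A] by metis
  qed
  then show ?thesis
    by (simp add: tor_zero_def)
qed

text \<open>Upper bounds for regularity and projective dimension. As \<open>n\<close> counts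
  vertices, \<open>r\<close> is twice the regularity in the edge grading; odd values arise for
  modules shifted by a single vertex.\<close>

definition reg_pd_le :: "nat set \<Rightarrow> 'v multiset set \<Rightarrow> nat \<Rightarrow> nat \<Rightarrow> bool" where
  "reg_pd_le T P r p \<longleftrightarrow> (\<forall>i n. n > 2 * i + r \<or> i > p \<longrightarrow> tor_zero T P i n)"

lemma reg_pd_leD: "reg_pd_le T P r p \<Longrightarrow> n > 2 * i + r \<or> i > p \<Longrightarrow> tor_zero T P i n"
  unfolding reg_pd_le_def by blast

lemma reg_pd_le_mono: "reg_pd_le T P r p \<Longrightarrow> r \<le> r' \<Longrightarrow> p \<le> p' \<Longrightarrow> reg_pd_le T P r' p'"
  unfolding reg_pd_le_def by (meson le_less_trans add_left_mono)

lemma reg_pd_le_no_variables: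
  assumes "\<And>m. m \<in> P \<Longrightarrow> size m \<le> r"
  shows "reg_pd_le {} P r 0"
  unfolding reg_pd_le_def tor_zero_def
  by (auto simp: strand_def intro!: exact_at_no_faces dest!: assms)

lemma reg_pd_le_extension:
  assumes "finite T" "convex_mod T P" "submod T A P" "reg_pd_le T A r p" "reg_pd_le T (P - A) r p"
  shows "reg_pd_le T P r p"
  using assms tor_zero_extension unfolding reg_pd_le_def by blast

text \<open>The form reg A <= max (reg P) (reg (P/A) + 1). The bound at homological degree
  \<open>i + 1\<close> for the quotient costs one edge, hence 2 in the doubled grading.\<close>

lemma reg_pd_le_sub:
  assumes "finite T" "convex_mod T P" "submod T A P" "reg_pd_le T P r p" "reg_pd_le T (P - A) r (Suc p)"
  shows "reg_pd_le T A (r + 2) p"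
  unfolding reg_pd_le_def
proof (intro allI impI)
  fix i n :: nat assume "n > 2 * i + (r + 2) \<or> i > p"
  then show "tor_zero T A i n"
    by (intro tor_zero_sub[OF assms(1-3)] reg_pd_leD[OF assms(4)] reg_pd_leD[OF assms(5)]) auto
qed

text \<open>The form reg (P/A) <= max (reg P) (reg A - 1), with the projective dimension of
  \<open>A\<close> counted one higher.\<close>

lemma reg_pd_le_quotient:
  assumes "finite T" "convex_mod T P" "submod T A P"
    "reg_pd_le T P r (Suc p)" "reg_pd_le T A (r + 2) p"
  shows "reg_pd_le T (P - A) r (Suc p)"
  unfolding reg_pd_le_def
proof (intro allI impI)
  fix i n :: nat assume "n > 2 * i + r \<or> i > Suc p"
  then show "tor_zero T (P - A) i n"
    by (intro tor_zero_quotient[OF assms(1-3)] reg_pd_leD[OF assms(4)] reg_pd_leD[OF assms(5)]) auto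
qed

lemma reg_pd_le_shift:
  "reg_pd_le T P r p \<Longrightarrow> reg_pd_le T ((+) s ` P) (size s + r) p"
  unfolding reg_pd_le_def
proof (intro allI impI)
  fix i n assume *: "\<forall>i n. n > 2 * i + r \<or> i > p \<longrightarrow> tor_zero T P i n"
    and n: "n > 2 * i + (size s + r) \<or> i > p"
  show "tor_zero T ((+) s ` P) i n"
  proof (cases "n \<ge> size s")
    case True
    then obtain n' where "n = size s + n'"
      by (auto simp: le_iff_add)
    then show ?thesis
      using * n by (auto simp: tor_zero_shift)
  next
    case False
    have "strand T ((+) s ` P) \<mu> = {}" if "size \<mu> = n" for \<mu>
      using False that by (auto simp: strand_def)
    then show ?thesis
      by (auto simp: tor_zero_def intro: exact_at_no_faces)
  qed
qed

lemma reg_pd_le_unshift: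
  assumes "reg_pd_le T ((+) s ` P) (size s + r) p"
  shows "reg_pd_le T P r p"
  unfolding reg_pd_le_def
  using reg_pd_leD[OF assms] by (metis add.left_commute nat_add_left_cancel_less tor_zero_shift)

text \<open>No regularity of \<open>e\<close> is assumed; the intended case is a variable acting by
  zero. Its Koszul generator has homological and edge degree one, so the projective dimension may
  grow by one while the regularity bound stays.\<close>

lemma reg_pd_le_add_variable:
  assumes "finite T" "e \<notin> T" "convex_mod (insert e T) P" "reg_pd_le T P r p"
  shows "reg_pd_le (insert e T) P r (Suc p)"
  unfolding reg_pd_le_def
proof (intro allI impI)
  fix i n :: nat assume "n > 2 * i + r \<or> i > Suc p"
  then show "tor_zero (insert e T) P i n"
    by (intro tor_zero_add_variable[OF assms(1-3)] reg_pd_leD[OF assms(4)]) auto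
qed

lemma reg_pd_le_add_variables:
  assumes "finite A" "finite T" "A \<inter> T = {}" "convex_mod (A \<union> T) P" "reg_pd_le T P r p"
  shows "reg_pd_le (A \<union> T) P r (card A + p)"
  using assms(1,3,4)
proof (induction A)
  case (insert e A)
  have "reg_pd_le (A \<union> T) P r (card A + p)"
    using insert by (auto intro: convex_mod_mono)
  then have "reg_pd_le (insert e (A \<union> T)) P r (Suc (card A + p))"
    using insert assms(2) by (intro reg_pd_le_add_variable) auto
  then show ?case
    using insert by simp
qed (use assms in simp)

lemma reg_pd_le_regular:
  assumes "finite T" "e \<notin> T" "convex_mod (insert e T) P" "\<And>m. m \<in> P \<Longrightarrow> m + ends e \<in> P"
    "reg_pd_le T (mod_quot e P) r p"
  shows "reg_pd_le (insert e T) P r p"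
  using assms(5) tor_zero_regular[OF assms(1-4)] unfolding reg_pd_le_def by blast

end

section \<open>Ranks and exactness\<close>

text \<open>Gaussian elimination by induction on the equations: \<open>A'\<close> is the system
  after clearing the row \<open>r\<close> with the pivot column \<open>p\<close>, and a solution of
  it extends by solving row \<open>r\<close> for the coordinate at \<open>p\<close>.\<close>

lemma homogeneous_solution:
  fixes A :: "'r \<Rightarrow> 'c \<Rightarrow> 'k::field"
  assumes "finite D" "finite S" "card D < card S"
  shows "\<exists>c. (\<exists>s\<in>S. c s \<noteq> 0) \<and> (\<forall>r\<in>D. (\<Sum>s\<in>S. c s * A r s) = 0)"
  using assms
proof (induction D arbitrary: S A rule: finite_induct)
  case empty
  then have "S \<noteq> {}" by auto
  then show ?case by (intro exI[of _ "\<lambda>_. 1"]) auto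
next
  case (insert r D)
  show ?case
  proof (cases "\<forall>s\<in>S. A r s = 0")
    case True
    then show ?thesis
      using insert.IH[of S A] insert.prems insert.hyps by auto
  next
    case False
    then obtain p where p: "p \<in> S" "A r p \<noteq> 0" by auto
    define S' where "S' = S - {p}"
    define A' where "A' q s = A q s - A q p * A r s / A r p" for q s
    have S: "S = insert p S'" "p \<notin> S'" "finite S'"
      using p insert.prems by (auto simp: S'_def)
    then have "card D < card S'"
      using insert by simp
    from insert.IH[OF S(3) this, of A'] obtain c where
      c: "\<exists>s\<in>S'. c s \<noteq> 0" "\<And>q. q \<in> D \<Longrightarrow> (\<Sum>s\<in>S'. c s * A' q s) = 0"
      by auto
    define t where "t = (\<Sum>s\<in>S'. c s * A r s)"
    define c' where "c' = c(p := - t / A r p)"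
    have eq: "(\<Sum>s\<in>S. c' s * A q s) = - t / A r p * A q p + (\<Sum>s\<in>S'. c s * A q s)" for q
      using S by (auto simp: c'_def intro!: sum.cong)
    have "(\<Sum>s\<in>S. c' s * A q s) = 0" if "q \<in> insert r D" for q
    proof (cases "q = r")
      case True
      then show ?thesis
        using p by (simp add: eq t_def)
    next
      case False
      have "0 = (\<Sum>s\<in>S'. c s * A q s - c s * A r s * (A q p / A r p))"
        using c(2)[of q] that False by (simp add: A'_def algebra_simps)
      also have "\<dots> = (\<Sum>s\<in>S'. c s * A q s) - t * (A q p / A r p)"
        by (simp add: sum_subtractf t_def sum_distrib_right sum_divide_distrib)
      finally show ?thesis
        by (simp add: eq)
    qed
    moreover have "\<exists>s\<in>S. c' s \<noteq> 0"
      using c(1) S by (auto simp: c'_def)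
    ultimately show ?thesis by blast
  qed
qed

lemma lin_indep_cols_card_le:
  assumes "finite D" "finite S" "lin_indep_cols D S A"
  shows "card S \<le> card D"
  using homogeneous_solution[OF assms(1,2), of A] assms(3)
  unfolding lin_indep_cols_def by (meson not_le)

lemma lin_indep_cols_spanned:
  fixes A :: "'r \<Rightarrow> 'c \<Rightarrow> 'k::field"
  assumes "finite S" "c \<notin> S" "lin_indep_cols R S A" "\<not> lin_indep_cols R (insert c S) A"
  shows "\<exists>l. \<forall>r\<in>R. A r c = (\<Sum>s\<in>S. l s * A r s)"
proof -
  from assms(4) obtain a where a: "\<And>r. r \<in> R \<Longrightarrow> (\<Sum>s\<in>insert c S. a s * A r s) = 0"
    and nz: "\<exists>s\<in>insert c S. a s \<noteq> 0"
    unfolding lin_indep_cols_def by blast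
  have eq: "a c * A r c + (\<Sum>s\<in>S. a s * A r s) = 0" if "r \<in> R" for r
    using a[OF that] assms by simp
  have "a c \<noteq> 0"
    using eq nz assms(3) unfolding lin_indep_cols_def by force
  then have "A r c = (\<Sum>s\<in>S. - a s / a c * A r s)" if "r \<in> R" for r
  proof -
    have "(\<Sum>s\<in>S. - a s / a c * A r s) = - (\<Sum>s\<in>S. a s * A r s) / a c"
      by (simp add: sum_negf sum_divide_distrib)
    then show ?thesis
      using eq[OF that] \<open>a c \<noteq> 0\<close> by (simp add: add_eq_0_iff)
  qed
  then show ?thesis
    by (intro exI[of _ "\<lambda>s. - a s / a c"] ballI)
qed

text \<open>An independent set of columns of maximal size cannot be enlarged, so it spans all
  columns.\<close>

lemma mat_rank_witness:
  fixes A :: "'r \<Rightarrow> 'c \<Rightarrow> 'k::field"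
  assumes "finite C"
  obtains S where "S \<subseteq> C" "lin_indep_cols R S A" "card S = mat_rank R C A"
    "\<And>c. c \<in> C \<Longrightarrow> \<exists>l. \<forall>r\<in>R. A r c = (\<Sum>s\<in>S. l s * A r s)"
proof -
  let ?M = "{card S | S. S \<subseteq> C \<and> lin_indep_cols R S A}"
  have fin: "finite ?M"
    by (rule finite_subset[of _ "card ` Pow C"]) (use assms in auto)
  have "card {} \<in> ?M"
    by (rule CollectI, rule exI[of _ "{}"]) (simp add: lin_indep_cols_def)
  then have "Max ?M \<in> ?M"
    using fin by (intro Max_in) auto
  then obtain S where S: "S \<subseteq> C" "lin_indep_cols R S A" "card S = mat_rank R C A"
    by (auto simp: mat_rank_def)
  have finS: "finite S"
    using S assms by (auto intro: finite_subset)
  have "\<exists>l. \<forall>r\<in>R. A r c = (\<Sum>s\<in>S. l s * A r s)" if c: "c \<in> C" for c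
  proof (cases "c \<in> S")
    case True
    then show ?thesis
      using finS by (intro exI[of _ "\<lambda>s. if s = c then 1 else 0"]) (simp add: if_distrib[of "\<lambda>x. x * _"] cong: if_cong)
  next
    case False
    have "\<not> lin_indep_cols R (insert c S) A"
    proof
      assume "lin_indep_cols R (insert c S) A"
      then have "card (insert c S) \<in> ?M"
        using S c by blast
      then have "card (insert c S) \<le> mat_rank R C A"
        unfolding mat_rank_def using fin by (rule Max_ge[rotated])
      then show False
        using S False finS by simp
    qed
    then show ?thesis
      using lin_indep_cols_spanned[OF finS False S(2)] by blast
  qed
  then show ?thesis
    using S that by blast
qed

text \<open>Rank-nullity in coordinates. For a column basis \<open>S\<close> of \<open>A\<close>,
  kernel vectors are determined by their entries on \<open>D = C - S\<close>, and every unit vector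
  on \<open>D\<close> extends to a kernel vector. A column basis \<open>S'\<close> of
  \<open>A'\<close> stays independent after restriction to \<open>D\<close>, so exactness amounts to
  \<open>card S' = card D\<close>.\<close>

lemma rank_sum_iff_exact:
  fixes A :: "'r \<Rightarrow> 'c \<Rightarrow> 'k::field" and A' :: "'c \<Rightarrow> 'd \<Rightarrow> 'k"
  assumes finC: "finite C" and finC': "finite C'"
    and comp: "\<And>b r. r \<in> R \<Longrightarrow> (\<Sum>c\<in>C. (\<Sum>d\<in>C'. b d * A' c d) * A r c) = 0"
  shows "card C = mat_rank R C A + mat_rank C C' A' \<longleftrightarrow>
    (\<forall>z. (\<forall>r\<in>R. (\<Sum>c\<in>C. z c * A r c) = 0) \<longrightarrow> (\<exists>b. \<forall>c\<in>C. z c = (\<Sum>d\<in>C'. b d * A' c d)))"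
    (is "_ \<longleftrightarrow> ?exact")
proof -
  obtain S where S: "S \<subseteq> C" "lin_indep_cols R S A" "card S = mat_rank R C A"
    "\<And>c. c \<in> C \<Longrightarrow> \<exists>l. \<forall>r\<in>R. A r c = (\<Sum>s\<in>S. l s * A r s)"
    using mat_rank_witness[OF finC] by blast
  obtain S' where S': "S' \<subseteq> C'" "lin_indep_cols C S' A'" "card S' = mat_rank C C' A'"
    "\<And>d. d \<in> C' \<Longrightarrow> \<exists>l. \<forall>c\<in>C. A' c d = (\<Sum>s\<in>S'. l s * A' c s)"
    using mat_rank_witness[OF finC'] by blast
  have finS: "finite S" and finS': "finite S'"
    using S(1) S'(1) finC finC' by (auto intro: finite_subset)
  define D where "D = C - S"
  have finD: "finite D" and CD: "C = D \<union> S" "D \<inter> S = {}"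
    using finC S(1) by (auto simp: D_def)
  have cardC: "card C = card D + mat_rank R C A"
    using CD finD finS S(3) by (simp add: card_Un_disjoint)
  have ker_vec: "\<exists>k. (\<forall>x\<in>D. k x = (if x = d then 1 else 0)) \<and> (\<forall>r\<in>R. (\<Sum>c\<in>C. k c * A r c) = 0)"
    if d: "d \<in> D" for d
  proof -
    obtain l where l: "\<And>r. r \<in> R \<Longrightarrow> A r d = (\<Sum>s\<in>S. l s * A r s)"
      using S(4)[of d] d by (auto simp: D_def)
    define k where "k x = (if x \<in> S then - l x else if x = d then 1 else 0)" for x
    have "(\<Sum>c\<in>C. k c * A r c) = 0" if r: "r \<in> R" for r
    proof -
      have "(\<Sum>c\<in>C. k c * A r c) = (\<Sum>c\<in>D. k c * A r c) + (\<Sum>c\<in>S. k c * A r c)"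
        unfolding CD(1) using finD finS CD(2) by (rule sum.union_disjoint)
      also have "(\<Sum>c\<in>D. k c * A r c) = (\<Sum>c\<in>D. if c = d then A r c else 0)"
        using CD(2) by (intro sum.cong) (auto simp: k_def)
      also have "\<dots> = A r d"
        using d finD by simp
      also have "(\<Sum>c\<in>S. k c * A r c) = - (\<Sum>s\<in>S. l s * A r s)"
        by (simp add: k_def sum_negf)
      finally show ?thesis
        using l[OF r] by simp
    qed
    then show ?thesis
      using CD(2) by (intro exI[of _ k]) (auto simp: k_def)
  qed
  have ker_zero: "z c = 0" if z: "\<And>r. r \<in> R \<Longrightarrow> (\<Sum>c\<in>C. z c * A r c) = 0"
    and z0: "\<And>x. x \<in> D \<Longrightarrow> z x = 0" and c: "c \<in> C" for z c
  proof -
    have "(\<Sum>c\<in>S. z c * A r c) = 0" if "r \<in> R" for r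
    proof -
      have "(\<Sum>c\<in>C. z c * A r c) = (\<Sum>c\<in>S. z c * A r c)"
        using z0 finC S(1) by (intro sum.mono_neutral_right) (auto simp: D_def)
      then show ?thesis
        using z[OF that] by simp
    qed
    then have "\<forall>s\<in>S. z s = 0"
      using S(2) unfolding lin_indep_cols_def by blast
    then show ?thesis
      using z0 c by (auto simp: D_def)
  qed
  have to_S': "\<exists>b'. \<forall>c\<in>C. (\<Sum>d\<in>C'. b d * A' c d) = (\<Sum>s\<in>S'. b' s * A' c s)" for b
  proof -
    obtain l where l: "\<And>d c. d \<in> C' \<Longrightarrow> c \<in> C \<Longrightarrow> A' c d = (\<Sum>s\<in>S'. l d s * A' c s)"
      using S'(4) by metis
    have "(\<Sum>d\<in>C'. b d * A' c d) = (\<Sum>s\<in>S'. (\<Sum>d\<in>C'. b d * l d s) * A' c s)" if "c \<in> C" for c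
    proof -
      have "(\<Sum>d\<in>C'. b d * A' c d) = (\<Sum>d\<in>C'. \<Sum>s\<in>S'. b d * l d s * A' c s)"
        using l that by (intro sum.cong) (auto simp: sum_distrib_left mult.assoc)
      also have "\<dots> = (\<Sum>s\<in>S'. \<Sum>d\<in>C'. b d * l d s * A' c s)"
        by (rule sum.swap)
      finally show ?thesis
        by (simp add: sum_distrib_right)
    qed
    then show ?thesis
      by (intro exI[of _ "\<lambda>s. \<Sum>d\<in>C'. b d * l d s"]) simp
  qed
  have from_S': "(\<Sum>s\<in>S'. b s * A' c s) = (\<Sum>d\<in>C'. (if d \<in> S' then b d else 0) * A' c d)" for b c
    using S'(1) finC' by (intro sum.mono_neutral_cong_left) auto
  have comp': "(\<Sum>c\<in>C. (\<Sum>s\<in>S'. b s * A' c s) * A r c) = 0" if "r \<in> R" for b r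
    unfolding from_S' using comp[OF that] .
  have indep: "lin_indep_cols D S' A'"
    unfolding lin_indep_cols_def
  proof (intro allI impI)
    fix c assume c: "\<forall>r\<in>D. (\<Sum>s\<in>S'. c s * A' r s) = 0"
    have "(\<Sum>s\<in>S'. c s * A' x s) = 0" if "x \<in> C" for x
      by (rule ker_zero[where z = "\<lambda>x. \<Sum>s\<in>S'. c s * A' x s"]) (use comp' c that in auto)
    then show "\<forall>s\<in>S'. c s = 0"
      using S'(2) unfolding lin_indep_cols_def by blast
  qed
  have le: "card S' \<le> card D"
    by (rule lin_indep_cols_card_le[OF finD finS' indep])
  show ?thesis
  proof
    assume eq: "card C = mat_rank R C A + mat_rank C C' A'"
    show ?exact
    proof (rule ccontr)
      assume "\<not> ?exact"
      then obtain z where z: "\<And>r. r \<in> R \<Longrightarrow> (\<Sum>c\<in>C. z c * A r c) = 0"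
        and nz: "\<And>b. \<exists>c\<in>C. z c \<noteq> (\<Sum>d\<in>C'. b d * A' c d)"
        by blast
      \<comment> \<open>A cycle \<open>z\<close> that is no boundary gives one more independent
        vector on \<open>D\<close> besides \<open>S'\<close>; the key \<open>None\<close> stands for
        \<open>z\<close>.\<close>
      define V where "V x o' = (case o' of None \<Rightarrow> z x | Some s \<Rightarrow> A' x s)" for x o'
      have sumV: "(\<Sum>o'\<in>insert None (Some ` S'). c o' * V x o') =
          c None * z x + (\<Sum>s\<in>S'. c (Some s) * A' x s)" for c x
        using finS' by (simp add: V_def sum.reindex)
      have "lin_indep_cols D (insert None (Some ` S')) V"
        unfolding lin_indep_cols_def sumV
      proof (intro allI impI)
        fix c assume c: "\<forall>x\<in>D. c None * z x + (\<Sum>s\<in>S'. c (Some s) * A' x s) = 0"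
        have y0: "c None * z x + (\<Sum>s\<in>S'. c (Some s) * A' x s) = 0" if "x \<in> C" for x
        proof (rule ker_zero[where z = "\<lambda>x. c None * z x + (\<Sum>s\<in>S'. c (Some s) * A' x s)"])
          fix r assume r: "r \<in> R"
          have "(\<Sum>x\<in>C. (c None * z x + (\<Sum>s\<in>S'. c (Some s) * A' x s)) * A r x) =
              c None * (\<Sum>x\<in>C. z x * A r x) + (\<Sum>x\<in>C. (\<Sum>s\<in>S'. c (Some s) * A' x s) * A r x)"
            by (simp add: distrib_right sum.distrib sum_distrib_left mult.assoc)
          then show "(\<Sum>x\<in>C. (c None * z x + (\<Sum>s\<in>S'. c (Some s) * A' x s)) * A r x) = 0"
            using z[OF r] comp'[OF r] by simp
        qed (use c that in auto)
        have "c None = 0"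
        proof (rule ccontr)
          assume n0: "c None \<noteq> 0"
          have "z x = (\<Sum>s\<in>S'. (- c (Some s) / c None) * A' x s)" if "x \<in> C" for x
          proof -
            have "(\<Sum>s\<in>S'. (- c (Some s) / c None) * A' x s) = - (\<Sum>s\<in>S'. c (Some s) * A' x s) / c None"
              by (simp add: sum_negf sum_divide_distrib)
            then show ?thesis
              using y0[OF that] n0 by (simp add: add_eq_0_iff)
          qed
          then show False
            using nz[of "\<lambda>d. if d \<in> S' then - c (Some d) / c None else 0"] from_S' by metis
        qed
        then show "\<forall>s\<in>insert None (Some ` S'). c s = 0"
          using y0 S'(2)[unfolded lin_indep_cols_def, rule_format, of "\<lambda>s. c (Some s)"] by auto
      qed
      then have "card (insert None (Some ` S')) \<le> card D"
        using finD finS' by (intro lin_indep_cols_card_le) auto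
      moreover have "card (insert None (Some ` S')) = Suc (card S')"
        using finS' by (subst card_insert_disjoint) (auto simp: card_image)
      ultimately show False
        using eq cardC S'(3) by simp
    qed
  next
    assume ex: ?exact
    \<comment> \<open>By exactness the kernel vectors extending the unit vectors of \<open>D\<close>
      are combinations of \<open>S'\<close>. The coefficient vectors of these combinations are
      independent, which bounds \<open>card D\<close> by \<open>card S'\<close>.\<close>
    have "\<exists>b. \<forall>x\<in>D. (\<Sum>s\<in>S'. b s * A' x s) = (if x = d then 1 else 0)" if d: "d \<in> D" for d
    proof -
      obtain k where k: "\<And>x. x \<in> D \<Longrightarrow> k x = (if x = d then 1 else 0)"
        "\<And>r. r \<in> R \<Longrightarrow> (\<Sum>c\<in>C. k c * A r c) = 0"
        using ker_vec[OF d] by blast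
      then obtain b where "\<And>c. c \<in> C \<Longrightarrow> k c = (\<Sum>d\<in>C'. b d * A' c d)"
        using ex by blast
      then show ?thesis
        using k(1) to_S'[of b] CD(1) by (metis Un_iff)
    qed
    then obtain B where B: "\<And>d x. d \<in> D \<Longrightarrow> x \<in> D \<Longrightarrow> (\<Sum>s\<in>S'. B d s * A' x s) = (if x = d then 1 else 0)"
      by metis
    have "lin_indep_cols S' D (\<lambda>s d. B d s)"
      unfolding lin_indep_cols_def
    proof (intro allI impI ballI)
      fix a x assume a: "\<forall>s\<in>S'. (\<Sum>d\<in>D. a d * B d s) = 0" and x: "x \<in> D"
      have "a x = (\<Sum>d\<in>D. a d * (\<Sum>s\<in>S'. B d s * A' x s))"
        using B x finD by (simp add: if_distrib[of "\<lambda>y. _ * y"] cong: if_cong)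
      also have "\<dots> = (\<Sum>d\<in>D. \<Sum>s\<in>S'. a d * B d s * A' x s)"
        by (simp add: sum_distrib_left mult.assoc)
      also have "\<dots> = (\<Sum>s\<in>S'. \<Sum>d\<in>D. a d * B d s * A' x s)"
        by (rule sum.swap)
      also have "\<dots> = 0"
        using a by (simp flip: sum_distrib_right)
      finally show "a x = 0" .
    qed
    then have "card D \<le> card S'"
      using finD finS' by (intro lin_indep_cols_card_le)
    then show "card C = mat_rank R C A + mat_rank C C' A'"
      using le cardC S'(3) by simp
  qed
qed

section \<open>Betti numbers\<close>

text \<open>This lets the convention of rank 0 in homological degree 0 be treated as a matrix
  without rows.\<close>

lemma mat_rank_no_rows:
  fixes A :: "'r \<Rightarrow> 'c \<Rightarrow> 'k::field"
  assumes "finite C"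
  shows "mat_rank {} C A = 0"
proof -
  obtain S where "lin_indep_cols {} S A" "card S = mat_rank {} C A"
    using mat_rank_witness[OF assms] by metis
  then have "S = {}"
    unfolding lin_indep_cols_def by (auto dest: spec[of _ "\<lambda>_. 1"])
  with \<open>card S = _\<close> show ?thesis by simp
qed

context edge_koszul
begin

definition edge_ring :: "nat set \<Rightarrow> 'v multiset set" where
  "edge_ring Ed = (\<Union>k. edge_monos Ed ends k)"

lemma sum_mset_size_ends: "sum_mset (image_mset size (image_mset ends M)) = 2 * size M"
  by (induction M) (auto simp: size_ends)

lemma edge_monos_eq: "edge_monos Ed ends k = {m \<in> edge_ring Ed. size m = 2 * k}"
  by (auto simp: edge_ring_def edge_monos_def sum_mset_size_ends simp del: image_mset.compositionality)

lemma edge_ring_eq: "edge_ring Ed = {sum_mset (image_mset ends M) | M. set_mset M \<subseteq> Ed}"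
  by (auto simp: edge_ring_def edge_monos_def)

lemma edge_ring_zero: "{#} \<in> edge_ring Ed"
  unfolding edge_ring_eq by (rule CollectI, rule exI[of _ "{#}"]) simp

lemma edge_ring_add:
  assumes "m \<in> edge_ring Ed" "e \<in> Ed"
  shows "m + ends e \<in> edge_ring Ed"
proof -
  from assms obtain M where "m = sum_mset (image_mset ends M)" "set_mset M \<subseteq> Ed"
    by (auto simp: edge_ring_eq)
  then show ?thesis
    unfolding edge_ring_eq using assms
    by (intro CollectI exI[of _ "add_mset e M"]) (auto simp: add.commute)
qed

lemma convex_mod_closed:
  assumes "\<And>m e. m \<in> P \<Longrightarrow> e \<in> T \<Longrightarrow> m + ends e \<in> P"
  shows "convex_mod T P"
  using assms unfolding convex_mod_def by blast

lemma convex_edge_ring: "convex_mod Ed (edge_ring Ed)"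
  by (intro convex_mod_closed edge_ring_add)

lemma kos_basis_iff:
  assumes "finite Ed"
  shows "(F, m) \<in> kos_basis Ed ends i j \<longleftrightarrow>
    F \<subseteq> Ed \<and> card F = i \<and> m \<in> edge_ring Ed \<and> size m + 2 * i = 2 * j"
  using finite_subset[OF _ assms] by (auto simp: kos_basis_def edge_monos_eq)

lemma finite_kos_basis:
  assumes "finite Ed"
  shows "finite (kos_basis Ed ends i j)"
proof -
  have "finite (edge_monos Ed ends k)" for k
  proof -
    have "edge_monos Ed ends k \<subseteq> (\<lambda>M. sum_mset (image_mset ends M)) ` multisets_of_size Ed k"
      by (auto simp: edge_monos_def multisets_of_size_def)
    then show ?thesis
      using finite_multisets_of_size[OF assms] by (meson finite_imageI finite_subset)
  qed
  moreover have "kos_basis Ed ends i j \<subseteq> Pow Ed \<times> edge_monos Ed ends (j - i)"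
    by (auto simp: kos_basis_def)
  ultimately show ?thesis
    using assms by (meson finite_Pow_iff finite_SigmaI finite_subset)
qed

text \<open>The Koszul matrix respects the multidegree: a row only meets columns of its own
  multidegree, where a column is determined by its set of edges. The row thus computes
  \<open>bd\<close> on a single strand.\<close>

lemma koszul_differential:
  fixes z :: "nat set \<times> 'v multiset \<Rightarrow> 'k"
  assumes fin: "finite Ed" and r: "(G, n) \<in> kos_basis Ed ends i j"
    and \<mu>: "\<mu> = n + (\<Sum>f\<in>G. ends f)"
  shows "(\<Sum>c\<in>kos_basis Ed ends (Suc i) j. z c * kos_entry ends (G, n) c) =
    bd (strand Ed (edge_ring Ed) \<mu>) (\<lambda>F. z (F, \<mu> - (\<Sum>f\<in>F. ends f))) G"
proof -
  let ?C = "kos_basis Ed ends (Suc i) j"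
  define I where "I = {f. f \<notin> G \<and> insert f G \<in> strand Ed (edge_ring Ed) \<mu>}"
  define g where "g f = (insert f G, n - ends f)" for f
  have G: "G \<subseteq> Ed" "card G = i" "n \<in> edge_ring Ed" "size n + 2 * i = 2 * j"
    using r by (auto simp: kos_basis_iff[OF fin])
  have finG: "finite G"
    using G fin by (auto intro: finite_subset)
  have I: "f \<in> I \<longleftrightarrow> f \<notin> G \<and> f \<in> Ed \<and> (\<exists>m\<in>edge_ring Ed. m + ends f = n)" for f
    using strand_insert_iff[OF fin, of f G] G by (auto simp: I_def \<mu>)
  have finI: "finite I"
    using finite_subset[OF _ fin] I by (metis subsetI)
  have inj: "inj_on g I"
    using I by (auto simp: inj_on_def g_def) 
  have entry: "kos_entry ends (G, n) (insert f G, m) =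
      (if m + ends f = n then pos_sign f G else (0::'k))" if f: "f \<notin> G" for f m
  proof -
    have "kos_entry ends (G, n) (insert f G, m) = (\<Sum>f'\<in>insert f G. if f' = f then
        (if m + ends f = n then pos_sign f G else (0::'k)) else 0)"
      unfolding kos_entry_def fst_conv snd_conv
    proof (rule sum.cong[OF refl])
      fix f' assume "f' \<in> insert f G"
      moreover have "{g \<in> insert f G. g < f} = {g \<in> G. g < f}"
        by auto
      ultimately show "(if G = insert f G - {f'} \<and> n = m + ends f' then (- 1) ^ card {g \<in> insert f G. g < f'} else 0) =
        (if f' = f then if m + ends f = n then pos_sign f G else (0::'k) else 0)"
        using f by (auto simp: pos_sign_def)
    qed
    then show ?thesis
      using finG by simp
  qed
  have gC: "g f \<in> ?C" if "f \<in> I" for f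
  proof -
    obtain m where m: "m \<in> edge_ring Ed" "m + ends f = n" and f: "f \<notin> G" "f \<in> Ed"
      using \<open>f \<in> I\<close> I[of f] by blast
    then have "size n = size m + 2"
      using size_ends[of f] by (metis size_union)
    then show ?thesis
      using G m f finG by (auto simp: g_def kos_basis_iff[OF fin])
  qed
  \<comment> \<open>A column with a non-zero entry in this row must be \<open>insert f G\<close>
    with coefficient monomial \<open>n\<close> divided by \<open>f\<close>.\<close>
  have zero: "kos_entry ends (G, n) c = (0::'k)" if c: "c \<in> ?C" "c \<notin> g ` I" for c
  proof -
    obtain F m where Fm: "c = (F, m)"
      by (cases c)
    have F: "F \<subseteq> Ed" "m \<in> edge_ring Ed"
      using c by (auto simp: Fm kos_basis_iff[OF fin])
    have "\<not> (G = F - {f} \<and> n = m + ends f)" if "f \<in> F" for f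
    proof
      assume *: "G = F - {f} \<and> n = m + ends f"
      then have "f \<in> I" "c = g f"
        using that F by (auto simp: I Fm g_def insert_absorb)
      then show False
        using c by blast
    qed
    then show ?thesis
      by (auto simp: kos_entry_def Fm intro!: sum.neutral)
  qed
  have "(\<Sum>c\<in>?C. z c * kos_entry ends (G, n) c) = (\<Sum>c\<in>g ` I. z c * kos_entry ends (G, n) c)"
    using gC zero finite_kos_basis[OF fin] by (intro sum.mono_neutral_right) auto
  also have "\<dots> = (\<Sum>f\<in>I. z (g f) * kos_entry ends (G, n) (g f))"
    by (simp add: sum.reindex[OF inj])
  also have "\<dots> = (\<Sum>f\<in>I. pos_sign f G * z (insert f G, \<mu> - (\<Sum>f\<in>insert f G. ends f)))"
  proof (rule sum.cong[OF refl])
    fix f assume "f \<in> I"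
    then obtain m where m: "m + ends f = n" and f: "f \<notin> G"
      using I by auto
    have "\<mu> - (\<Sum>f\<in>insert f G. ends f) = m"
      using m f finG by (auto simp: \<mu>)
    moreover have "n - ends f = m"
      using m by auto
    ultimately show "z (g f) * kos_entry ends (G, n) (g f) =
        pos_sign f G * z (insert f G, \<mu> - (\<Sum>f\<in>insert f G. ends f))"
      using entry[OF f] m by (simp add: g_def)
  qed
  finally show ?thesis
    by (simp add: bd_def I_def)
qed

text \<open>By the rank criterion a zero Betti number means exactness of the Koszul complex in
  internal degree \<open>j\<close>, and this complex is the direct sum of its strands. The factor 2
  converts edge degree into vertex degree.\<close>

lemma betti_eq_zero_iff:
  assumes fin: "finite Ed"
  shows "betti K Ed ends i j = 0 \<longleftrightarrow> tor_zero Ed (edge_ring Ed) i (2 * j)"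
proof -
  let ?S = "strand Ed (edge_ring Ed)"
  \<comment> \<open>In degree 0 the empty row set makes every vector a cycle, as in
    \<open>exact_at\<close>.\<close>
  define R where "R = (if i = 0 then {} else kos_basis Ed ends (i - 1) j)"
  define C where "C = kos_basis Ed ends i j"
  define C' where "C' = kos_basis Ed ends (Suc i) j"
  define A :: "nat set \<times> 'v multiset \<Rightarrow> nat set \<times> 'v multiset \<Rightarrow> 'k" where "A = kos_entry ends"
  have finC: "finite C" "finite C'"
    using finite_kos_basis[OF fin] by (auto simp: C_def C'_def)
  have dR: "(\<Sum>c\<in>C. z c * A (G, n) c) =
      bd (?S (n + (\<Sum>f\<in>G. ends f))) (\<lambda>F. z (F, n + (\<Sum>f\<in>G. ends f) - (\<Sum>f\<in>F. ends f))) G"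
    if "(G, n) \<in> R" for z G n
    using koszul_differential[OF fin, of G n "i - 1" j _ z] that
    by (auto simp: R_def C_def A_def split: if_splits)
  have dC: "(\<Sum>c\<in>C'. z c * A (G, n) c) =
      bd (?S (n + (\<Sum>f\<in>G. ends f))) (\<lambda>F. z (F, n + (\<Sum>f\<in>G. ends f) - (\<Sum>f\<in>F. ends f))) G"
    if "(G, n) \<in> C" for z G n
    using koszul_differential[OF fin, of G n i j _ z] that
    by (auto simp: C'_def C_def A_def)
  have R_face: "G \<in> ?S (n + (\<Sum>f\<in>G. ends f)) \<and> Suc (card G) = i \<and> size (n + (\<Sum>f\<in>G. ends f)) = 2 * j"
    if "(G, n) \<in> R" for G n
    using that by (auto simp: R_def kos_basis_iff[OF fin] strand_def size_ends split: if_splits)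
  have C_face: "G \<in> ?S (n + (\<Sum>f\<in>G. ends f)) \<and> card G = i \<and> size (n + (\<Sum>f\<in>G. ends f)) = 2 * j"
    if "(G, n) \<in> C" for G n
    using that by (auto simp: C_def kos_basis_iff[OF fin] strand_def size_ends)
  have face_C: "(F, \<mu> - (\<Sum>f\<in>F. ends f)) \<in> C" if "F \<in> ?S \<mu>" "size \<mu> = 2 * j" "card F = i" for F \<mu>
    using that by (auto simp: C_def kos_basis_iff[OF fin] strand_def size_ends)
  have face_R: "(F, \<mu> - (\<Sum>f\<in>F. ends f)) \<in> R" if "F \<in> ?S \<mu>" "size \<mu> = 2 * j" "Suc (card F) = i" for F \<mu>
    using that by (auto simp: R_def kos_basis_iff[OF fin] strand_def size_ends)
  have split: "\<mu> - (\<Sum>f\<in>F. ends f) + (\<Sum>f\<in>F. ends f) = \<mu>" if "F \<in> ?S \<mu>" for F \<mu>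
    using that by (auto simp: strand_def)
  have comp: "(\<Sum>c\<in>C. (\<Sum>d\<in>C'. b d * A c d) * A r c) = 0" if "r \<in> R" for b r
  proof -
    obtain G n where r: "r = (G, n)"
      by (cases r)
    let ?\<mu> = "n + (\<Sum>f\<in>G. ends f)"
    have G: "G \<in> ?S ?\<mu>" "Suc (card G) = i" "size ?\<mu> = 2 * j"
      using R_face that r by auto
    have finG: "finite G"
      using finite_face[OF finite_strand[OF fin] G(1)] .
    have "(\<Sum>c\<in>C. (\<Sum>d\<in>C'. b d * A c d) * A r c) =
        bd (?S ?\<mu>) (\<lambda>F. \<Sum>d\<in>C'. b d * A (F, ?\<mu> - (\<Sum>f\<in>F. ends f)) d) G"
      using that unfolding r by (rule dR)
    also have "\<dots> = bd (?S ?\<mu>) (bd (?S ?\<mu>) (\<lambda>F. b (F, ?\<mu> - (\<Sum>f\<in>F. ends f)))) G"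
    proof (rule bd_cong)
      fix f assume f: "f \<notin> G" "insert f G \<in> ?S ?\<mu>"
      then have "(insert f G, ?\<mu> - (\<Sum>f\<in>insert f G. ends f)) \<in> C"
        using G finG by (intro face_C) auto
      from dC[OF this, of b] show "(\<Sum>d\<in>C'. b d * A (insert f G, ?\<mu> - (\<Sum>f\<in>insert f G. ends f)) d) =
          bd (?S ?\<mu>) (\<lambda>F. b (F, ?\<mu> - (\<Sum>f\<in>F. ends f))) (insert f G)"
        unfolding split[OF f(2)] .
    qed
    also have "\<dots> = 0"
      by (rule bd_bd[OF finite_strand[OF fin] skew_convex_strand[OF fin convex_edge_ring] G(1)])
    finally show ?thesis .
  qed
  have "kos_rank K Ed ends i j = mat_rank R C A"
    using mat_rank_no_rows[OF finC(1), of A] by (auto simp: kos_rank_def R_def C_def A_def)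
  moreover have "kos_rank K Ed ends (Suc i) j = mat_rank C C' A"
    by (simp add: kos_rank_def C_def C'_def A_def)
  ultimately have "betti K Ed ends i j = 0 \<longleftrightarrow> card C = mat_rank R C A + mat_rank C C' A"
    by (auto simp: betti_def C_def)
  also have "\<dots> \<longleftrightarrow> (\<forall>z. (\<forall>r\<in>R. (\<Sum>c\<in>C. z c * A r c) = 0) \<longrightarrow>
      (\<exists>b. \<forall>c\<in>C. z c = (\<Sum>d\<in>C'. b d * A c d)))" (is "_ \<longleftrightarrow> ?exact")
    by (rule rank_sum_iff_exact[OF finC comp])
  also have "\<dots> \<longleftrightarrow> tor_zero Ed (edge_ring Ed) i (2 * j)"
  proof
    assume ex: ?exact
    show "tor_zero Ed (edge_ring Ed) i (2 * j)"
      unfolding tor_zero_def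
    proof (intro allI impI exact_atI)
      fix \<mu> :: "'v multiset" and c :: "nat set \<Rightarrow> 'k"
      assume \<mu>: "size \<mu> = 2 * j" and c: "\<And>G. G \<in> ?S \<mu> \<Longrightarrow> Suc (card G) = i \<Longrightarrow> bd (?S \<mu>) c G = 0"
      \<comment> \<open>The chain on one strand is extended by zero to all other
        multidegrees.\<close>
      define z where "z p = (if snd p + (\<Sum>f\<in>fst p. ends f) = \<mu> then c (fst p) else 0)" for p
      have "(\<Sum>c\<in>C. z c * A r c) = 0" if "r \<in> R" for r
      proof -
        obtain G n where r: "r = (G, n)"
          by (cases r)
        let ?\<nu> = "n + (\<Sum>f\<in>G. ends f)"
        have "(\<Sum>c\<in>C. z c * A r c) = bd (?S ?\<nu>) (\<lambda>F. z (F, ?\<nu> - (\<Sum>f\<in>F. ends f))) G"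
          using dR that unfolding r by blast
        also have "\<dots> = bd (?S ?\<nu>) (\<lambda>F. if ?\<nu> = \<mu> then c F else 0) G"
        proof (rule bd_cong)
          fix f assume "f \<notin> G" and f: "insert f G \<in> ?S ?\<nu>"
          show "z (insert f G, ?\<nu> - (\<Sum>f\<in>insert f G. ends f)) = (if ?\<nu> = \<mu> then c (insert f G) else 0)"
            unfolding z_def fst_conv snd_conv split[OF f] ..
        qed
        also have "\<dots> = 0"
        proof (cases "?\<nu> = \<mu>")
          case True
          then show ?thesis
            using c[of G] R_face[of G n] that by (simp add: r)
        next
          case False
          then show ?thesis
            by (simp add: bd_def)
        qed
        finally show ?thesis .
      qed
      then obtain b where b: "\<And>c. c \<in> C \<Longrightarrow> z c = (\<Sum>d\<in>C'. b d * A c d)"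
        using ex by blast
      have "c F = bd (?S \<mu>) (\<lambda>F. b (F, \<mu> - (\<Sum>f\<in>F. ends f))) F" if F: "F \<in> ?S \<mu>" "card F = i" for F
      proof -
        have FC: "(F, \<mu> - (\<Sum>f\<in>F. ends f)) \<in> C"
          using face_C F \<mu> by blast
        have "c F = z (F, \<mu> - (\<Sum>f\<in>F. ends f))"
          unfolding z_def fst_conv snd_conv split[OF F(1)] by simp
        then show ?thesis
          using b[OF FC] dC[OF FC, of b] unfolding split[OF F(1)] by simp
      qed
      then show "\<exists>b. \<forall>F\<in>?S \<mu>. card F = i \<longrightarrow> c F = bd (?S \<mu>) b F"
        by blast
    qed
  next
    assume tor: "tor_zero Ed (edge_ring Ed) i (2 * j)"
    show ?exact
    proof (intro allI impI)
      fix z assume z: "\<forall>r\<in>R. (\<Sum>c\<in>C. z c * A r c) = 0"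
      have "\<exists>b. \<forall>F\<in>?S \<mu>. card F = i \<longrightarrow> z (F, \<mu> - (\<Sum>f\<in>F. ends f)) = bd (?S \<mu>) b F"
        if \<mu>: "size \<mu> = 2 * j" for \<mu>
      proof -
        have ex: "exact_at K (?S \<mu>) i"
          using tor \<mu> by (simp add: tor_zero_def)
        define c where "c F = z (F, \<mu> - (\<Sum>f\<in>F. ends f))" for F
        have "bd (?S \<mu>) c G = 0" if G: "G \<in> ?S \<mu>" "Suc (card G) = i" for G
        proof -
          have GR: "(G, \<mu> - (\<Sum>f\<in>G. ends f)) \<in> R"
            using face_R G \<mu> by blast
          then show ?thesis
            using z dR[OF GR, of z] unfolding split[OF G(1)] c_def by simp
        qed
        from exact_atE[OF ex this] obtain b where
          "\<And>F. F \<in> ?S \<mu> \<Longrightarrow> card F = i \<Longrightarrow> c F = bd (?S \<mu>) b F"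
          by blast
        then show ?thesis
          unfolding c_def by blast
      qed
      then obtain b where b: "\<And>\<mu> F. size \<mu> = 2 * j \<Longrightarrow> F \<in> ?S \<mu> \<Longrightarrow> card F = i \<Longrightarrow>
          z (F, \<mu> - (\<Sum>f\<in>F. ends f)) = bd (?S \<mu>) (b \<mu>) F"
        by metis
      \<comment> \<open>The strandwise solutions are glued: each basis element uses the solution of
        its own multidegree.\<close>
      define b' where "b' p = b (snd p + (\<Sum>f\<in>fst p. ends f)) (fst p)" for p
      have "z c = (\<Sum>d\<in>C'. b' d * A c d)" if "c \<in> C" for c
      proof -
        obtain F m where c: "c = (F, m)"
          by (cases c)
        let ?\<mu> = "m + (\<Sum>f\<in>F. ends f)"
        have F: "F \<in> ?S ?\<mu>" "card F = i" "size ?\<mu> = 2 * j"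
          using C_face that c by auto
        have "(\<Sum>d\<in>C'. b' d * A c d) = bd (?S ?\<mu>) (\<lambda>F. b' (F, ?\<mu> - (\<Sum>f\<in>F. ends f))) F"
          using dC that unfolding c by blast
        also have "\<dots> = bd (?S ?\<mu>) (b ?\<mu>) F"
        proof (rule bd_cong)
          fix f assume "f \<notin> F" and f: "insert f F \<in> ?S ?\<mu>"
          show "b' (insert f F, ?\<mu> - (\<Sum>f\<in>insert f F. ends f)) = b ?\<mu> (insert f F)"
            unfolding b'_def fst_conv snd_conv split[OF f] ..
        qed
        also have "\<dots> = z c"
          using b[OF F(3,1,2)] by (simp add: c)
        finally show ?thesis by simp
      qed
      then show "\<exists>b. \<forall>c\<in>C. z c = (\<Sum>d\<in>C'. b d * A c d)"
        by blast
    qed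
  qed
  finally show ?thesis .
qed

end

section \<open>Hilbert series\<close>

definition finite_sizes :: "'v multiset set \<Rightarrow> bool" where
  "finite_sizes P \<longleftrightarrow> (\<forall>n. finite {m\<in>P. size m = n})"

lemma finite_sizesI:
  assumes "finite V" "\<And>m. m \<in> P \<Longrightarrow> set_mset m \<subseteq> V"
  shows "finite_sizes P"
  unfolding finite_sizes_def
proof
  fix n
  have "{m\<in>P. size m = n} \<subseteq> multisets_of_size V n"
    using assms(2) by (auto simp: multisets_of_size_def)
  then show "finite {m\<in>P. size m = n}"
    using finite_multisets_of_size[OF assms(1)] by (rule finite_subset)
qed

lemma finite_sizes_subset:
  assumes "finite_sizes P" "A \<subseteq> P"
  shows "finite_sizes A"
  unfolding finite_sizes_def
proof
  fix n
  have "{m\<in>A. size m = n} \<subseteq> {m\<in>P. size m = n}"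
    using assms(2) by auto
  then show "finite {m\<in>A. size m = n}"
    using assms(1) by (auto simp: finite_sizes_def intro: finite_subset)
qed

text \<open>The offset \<open>p\<close> makes room for modules shifted by a monomial of odd size.\<close>

definition hilbert_series :: "nat \<Rightarrow> 'v multiset set \<Rightarrow> int fps" where
  "hilbert_series p P = Abs_fps (\<lambda>k. int (card {m\<in>P. size m = 2 * k + p}))"

lemma hilbert_series_diff:
  assumes "finite_sizes P" "A \<subseteq> P"
  shows "hilbert_series p (P - A) = hilbert_series p P - hilbert_series p A"
proof (rule fps_ext)
  fix k
  let ?N = "\<lambda>Q. {m\<in>Q. size m = 2 * k + p}"
  have "?N (P - A) = ?N P - ?N A"
    by auto
  moreover have fin: "finite (?N P)"
    using assms(1) by (simp add: finite_sizes_def)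
  moreover have "?N A \<subseteq> ?N P"
    using assms(2) by auto
  ultimately show "fps_nth (hilbert_series p (P - A)) k = fps_nth (hilbert_series p P - hilbert_series p A) k"
    by (simp add: hilbert_series_def card_Diff_subset finite_subset card_mono)
qed

lemma hilbert_series_shift:
  assumes "size s + p = 2 * k + q" "p < 2"
  shows "hilbert_series q ((+) s ` P) = fps_X ^ k * hilbert_series p P"
proof (rule fps_ext)
  fix n
  have "{m\<in>(+) s ` P. size m = 2 * n + q} = (+) s ` {m\<in>P. size s + size m = 2 * n + q}"
    by auto
  then have "card {m\<in>(+) s ` P. size m = 2 * n + q} = card {m\<in>P. size s + size m = 2 * n + q}"
    by (simp add: card_image)
  \<comment> \<open>For \<open>n < k\<close> the size of \<open>m\<close> would be at most
    \<open>p - 2\<close>, which \<open>p < 2\<close> excludes.\<close>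
  moreover have "{m\<in>P. size s + size m = 2 * n + q} =
      (if n < k then {} else {m\<in>P. size m = 2 * (n - k) + p})"
    using assms by auto
  ultimately show "fps_nth (hilbert_series q ((+) s ` P)) n = fps_nth (fps_X ^ k * hilbert_series p P) n"
    by (simp add: hilbert_series_def fps_X_power_mult_nth)
qed

context edge_koszul
begin

lemma hilbert_series_regular:
  assumes fin: "finite_sizes P" and reg: "\<And>m. m \<in> P \<Longrightarrow> m + ends e \<in> P"
  shows "hilbert_series 0 (mod_quot e P) = (1 - fps_X) * hilbert_series 0 P"
proof -
  have "(\<lambda>m. m + ends e) ` P = (+) (ends e) ` P"
    by (auto simp: add.commute)
  then have "hilbert_series 0 (mod_quot e P) = hilbert_series 0 P - hilbert_series 0 ((+) (ends e) ` P)"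
    unfolding mod_quot_def using reg by (subst hilbert_series_diff[OF fin]) (auto simp: add.commute)
  also have "hilbert_series 0 ((+) (ends e) ` P) = fps_X ^ 1 * hilbert_series 0 P"
    by (rule hilbert_series_shift) (auto simp: size_ends)
  finally show ?thesis
    by (simp add: algebra_simps)
qed

end

section \<open>The Segre ring of the edges a and b\<close>

text \<open>The monomial with exponents \<open>c, d, z1, z2, w1, w2\<close> at the vertices x1, x2, z1, z2, w1, w2;
the multiset \<open>L\<close> lists the y-vertices with indices shifted down by one, so that \<open>k \<in># L\<close> matches
the edge number \<open>k\<close> of a.\<close>

definition vmon :: "nat \<Rightarrow> nat \<Rightarrow> nat multiset \<Rightarrow> nat \<Rightarrow> nat \<Rightarrow> nat \<Rightarrow> nat \<Rightarrow> gvert multiset" where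
  "vmon c d L z1 z2 w1 w2 = replicate_mset c (X 1) + replicate_mset d (X 2) +
     image_mset (\<lambda>k. Y (k + 1)) L + replicate_mset z1 (Z 1) + replicate_mset z2 (Z 2) +
     replicate_mset w1 (W 1) + replicate_mset w2 (W 2)"

lemma count_vmon:
  "count (vmon c d L z1 z2 w1 w2) (X 1) = c"
  "count (vmon c d L z1 z2 w1 w2) (X 2) = d"
  "count (vmon c d L z1 z2 w1 w2) (Y (k + 1)) = count L k"
  "count (vmon c d L z1 z2 w1 w2) (Z 1) = z1"
  "count (vmon c d L z1 z2 w1 w2) (Z 2) = z2"
  "count (vmon c d L z1 z2 w1 w2) (W 1) = w1"
  "count (vmon c d L z1 z2 w1 w2) (W 2) = w2"
proof -
  have 1: "count (image_mset (\<lambda>k. Y (k + 1)) L) v = 0" if "v \<notin> range Y" for v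
    using that by (auto simp: count_eq_zero_iff)
  have 2: "count (image_mset (\<lambda>k. Y (k + 1)) L) (Y (k + 1)) = count L k"
    by (induction L) auto
  show "count (vmon c d L z1 z2 w1 w2) (X 1) = c"
    "count (vmon c d L z1 z2 w1 w2) (X 2) = d"
    "count (vmon c d L z1 z2 w1 w2) (Z 1) = z1"
    "count (vmon c d L z1 z2 w1 w2) (Z 2) = z2"
    "count (vmon c d L z1 z2 w1 w2) (W 1) = w1"
    "count (vmon c d L z1 z2 w1 w2) (W 2) = w2"
    unfolding vmon_def count_union by (subst 1; auto)+
  show "count (vmon c d L z1 z2 w1 w2) (Y (k + 1)) = count L k"
    unfolding vmon_def count_union 2 by simp
qed

lemmas count_vmon_simps [simp] = count_vmon[unfolded One_nat_def add_Suc_right add_0_right]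

lemma vmon_eq_iff [simp]:
  "vmon c d L z1 z2 w1 w2 = vmon c' d' L' z1' z2' w1' w2' \<longleftrightarrow>
     c = c' \<and> d = d' \<and> L = L' \<and> z1 = z1' \<and> z2 = z2' \<and> w1 = w1' \<and> w2 = w2'"
  by (metis count_vmon multiset_eqI)

lemma size_vmon [simp]: "size (vmon c d L z1 z2 w1 w2) = c + d + size L + z1 + z2 + w1 + w2"
  by (simp add: vmon_def)

lemma vmon_add [simp]:
  "vmon c d L z1 z2 w1 w2 + vmon c' d' L' z1' z2' w1' w2' =
     vmon (c + c') (d + d') (L + L') (z1 + z1') (z2 + z2') (w1 + w1') (w2 + w2')"
  by (simp add: vmon_def multiset_eq_iff)

lemma vmon_zero: "vmon 0 0 {#} 0 0 0 0 = {#}"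
  by (simp add: vmon_def)

lemma Gt_ends_vmon:
  "k < t \<Longrightarrow> Gt_ends t k = vmon 1 0 {#k#} 0 0 0 0"
  "Gt_ends t t = vmon 0 1 {#} 0 0 1 0"
  "Gt_ends t (t + 1) = vmon 0 0 {#} 0 0 1 1"
  "Gt_ends t (t + 2) = vmon 0 1 {#} 0 0 0 1"
  "Gt_ends t (t + 3) = vmon 1 0 {#} 1 0 0 0"
  "Gt_ends t (t + 4) = vmon 0 0 {#} 1 1 0 0"
  "Gt_ends t (t + 5) = vmon 1 0 {#} 0 1 0 0"
  "Gt_ends t (t + 6 + k) = vmon 0 1 {#k#} 0 0 0 0"
  by (simp_all add: Gt_ends_def vmon_def add_mset_commute)

text \<open>The index is zero-based: \<open>b_edge t k\<close> is the edge b_(k+1), and shares its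
  y-vertex with the a-edge numbered \<open>k\<close>.\<close>

definition b_edge :: "nat \<Rightarrow> nat \<Rightarrow> nat" where
  "b_edge t k = t + 6 + k"

lemma b_edge_inj [simp]: "b_edge t k = b_edge t l \<longleftrightarrow> k = l"
  by (simp add: b_edge_def)

lemma vmon_add_edge [simp]:
  "k < t \<Longrightarrow> vmon c d L z1 z2 w1 w2 + Gt_ends t k = vmon (Suc c) d (add_mset k L) z1 z2 w1 w2"
  "vmon c d L z1 z2 w1 w2 + Gt_ends t t = vmon c (Suc d) L z1 z2 (Suc w1) w2"
  "vmon c d L z1 z2 w1 w2 + Gt_ends t (t + 1) = vmon c d L z1 z2 (Suc w1) (Suc w2)"
  "vmon c d L z1 z2 w1 w2 + Gt_ends t (Suc t) = vmon c d L z1 z2 (Suc w1) (Suc w2)"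
  "vmon c d L z1 z2 w1 w2 + Gt_ends t (t + 2) = vmon c (Suc d) L z1 z2 w1 (Suc w2)"
  "vmon c d L z1 z2 w1 w2 + Gt_ends t (Suc (Suc t)) = vmon c (Suc d) L z1 z2 w1 (Suc w2)"
  "vmon c d L z1 z2 w1 w2 + Gt_ends t (t + 3) = vmon (Suc c) d L (Suc z1) z2 w1 w2"
  "vmon c d L z1 z2 w1 w2 + Gt_ends t (t + 4) = vmon c d L (Suc z1) (Suc z2) w1 w2"
  "vmon c d L z1 z2 w1 w2 + Gt_ends t (t + 5) = vmon (Suc c) d L z1 (Suc z2) w1 w2"
  "vmon c d L z1 z2 w1 w2 + Gt_ends t (b_edge t k) = vmon c (Suc d) (add_mset k L) z1 z2 w1 w2"
  using Gt_ends_vmon(3,4)[of t] by (simp_all add: Gt_ends_vmon b_edge_def)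

locale Gt_koszul =
  fixes K :: "'k::field_char_0 itself" and t :: nat
begin

sublocale edge_koszul K "Gt_ends t"
  by standard (simp add: Gt_ends_def)

text \<open>Multiplication never lowers the exponent of x1, so a bound on it cuts out a quotient.
  The bound \<open>c <= 1\<close> gives the quotient by (a)^2.\<close>

lemma convex_mod_X1_bounded:
  assumes "\<And>m e. m \<in> P \<Longrightarrow> e \<in> T \<Longrightarrow> m + Gt_ends t e \<in> P" "\<And>c. C (Suc c) \<Longrightarrow> C c"
  shows "convex_mod T {m\<in>P. C (count m (X 1))}"
proof -
  have "C (c + n) \<Longrightarrow> C c" for c n
    by (induction n) (auto dest: assms(2))
  then show ?thesis
    unfolding convex_mod_def using assms(1) by auto
qed

text \<open>Every a raises the exponent of x1, hence leaves \<open>P\<close> and acts by zero; such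
  variables impose no condition.\<close>

lemma convex_mod_X1_const:
  assumes "convex_mod T P" "\<And>m. m \<in> P \<Longrightarrow> count m (X 1) = c" "\<And>e. e \<in> A \<Longrightarrow> e < t"
  shows "convex_mod (A \<union> T) P"
  unfolding convex_mod_def
proof (intro ballI impI)
  fix m e f assume m: "m \<in> P" and ef: "e \<in> A \<union> T" "f \<in> A \<union> T" and h: "m + Gt_ends t e + Gt_ends t f \<in> P"
  have "count (Gt_ends t a) (X 1) = 1" if "a \<in> A" for a
    using assms(3)[OF that] by (simp add: Gt_ends_def)
  then have "e \<in> T" "f \<in> T"
    using assms(2)[OF m] assms(2)[OF h] ef by auto
  then show "m + Gt_ends t e \<in> P"
    using assms(1) m h by (auto intro: convex_modD)
qed

section \<open>The polynomial rings on sets of variables b\<close>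

definition b_mons :: "nat set \<Rightarrow> gvert multiset set" where
  "b_mons I = {vmon 0 (size L) L 0 0 0 0 | L. set_mset L \<subseteq> I}"

lemma b_mons_add: "m \<in> b_mons I \<Longrightarrow> k \<in> I \<Longrightarrow> m + Gt_ends t (b_edge t k) \<in> b_mons I"
  by (force simp: b_mons_def)

lemma b_mons_quot:
  assumes "k \<notin> I"
  shows "mod_quot (b_edge t k) (b_mons (insert k I)) = b_mons I"
proof (intro set_eqI iffI)
  fix m assume m: "m \<in> mod_quot (b_edge t k) (b_mons (insert k I))"
  then obtain L where L: "m = vmon 0 (size L) L 0 0 0 0" "set_mset L \<subseteq> insert k I"
    by (auto simp: mod_quot_def b_mons_def)
  have "k \<notin># L"
  proof
    assume "k \<in># L"
    then obtain L' where L': "L = add_mset k L'"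
      by (metis insert_DiffM)
    then have "vmon 0 (size L') L' 0 0 0 0 \<in> b_mons (insert k I)"
      using L by (auto simp: b_mons_def)
    moreover have "m = vmon 0 (size L') L' 0 0 0 0 + Gt_ends t (b_edge t k)"
      by (simp add: L L')
    ultimately show False
      using m unfolding mod_quot_iff by blast
  qed
  then show "m \<in> b_mons I"
    using L by (auto simp: b_mons_def)
next
  fix m assume "m \<in> b_mons I"
  then show "m \<in> mod_quot (b_edge t k) (b_mons (insert k I))"
    using assms by (auto simp: mod_quot_def b_mons_def)
qed

lemma convex_b_mons: "convex_mod (b_edge t ` I) ((+) s ` b_mons I)"
  by (rule convex_mod_closed) (auto simp: add.assoc b_mons_add)

text \<open>The variables form a regular sequence, and dividing by all of them leaves the residue
  field.\<close>

lemma b_mons_reg_aux: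
  assumes "finite I"
  shows "reg_pd_le (b_edge t ` I) (b_mons I) 0 0"
  using assms
proof (induction I)
  case empty
  show ?case
    by (auto intro!: reg_pd_le_no_variables simp: b_mons_def vmon_zero)
next
  case (insert k I)
  have "convex_mod (insert (b_edge t k) (b_edge t ` I)) (b_mons (insert k I))"
    by (rule convex_mod_closed) (auto intro: b_mons_add)
  then have "reg_pd_le (insert (b_edge t k) (b_edge t ` I)) (b_mons (insert k I)) 0 0"
    using insert b_mons_quot[of k I] by (intro reg_pd_le_regular) (auto intro: b_mons_add)
  then show ?case
    by simp
qed

lemma b_mons_reg:
  assumes "finite I"
  shows "reg_pd_le (b_edge t ` I) ((+) s ` b_mons I) (size s) 0"
  using reg_pd_le_shift[OF b_mons_reg_aux[OF assms], of s] by simp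

definition verts :: "gvert set" where
  "verts = {X 1, X 2, Z 1, Z 2, W 1, W 2} \<union> Y ` {1..t}"

lemma finite_verts: "finite verts"
  by (simp add: verts_def)

lemma set_vmon: "set_mset L \<subseteq> {..<t} \<Longrightarrow> set_mset (vmon c d L z1 z2 w1 w2) \<subseteq> verts"
  by (auto simp: vmon_def verts_def split: if_splits)

lemma finite_sizes_vmon:
  assumes "\<And>m. m \<in> P \<Longrightarrow> \<exists>c d L z1 z2 w1 w2. m = vmon c d L z1 z2 w1 w2 \<and> set_mset L \<subseteq> {..<t}"
  shows "finite_sizes P"
  by (rule finite_sizesI[OF finite_verts]) (metis assms set_vmon)

lemma b_mons_hilbert:
  assumes "finite I" "I \<subseteq> {..<t}"
  shows "(1 - fps_X) ^ card I * hilbert_series 0 (b_mons I) = 1"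
  using assms
proof (induction I)
  case empty
  have "b_mons {} = {{#}}"
    by (auto simp: b_mons_def vmon_zero)
  then show ?case
    by (intro fps_ext) (auto simp: hilbert_series_def)
next
  case (insert k I)
  have "finite_sizes (b_mons (insert k I))"
    using insert.prems by (intro finite_sizes_vmon) (fastforce simp: b_mons_def)
  then have "hilbert_series 0 (b_mons I) = (1 - fps_X) * hilbert_series 0 (b_mons (insert k I))"
    using hilbert_series_regular[of "b_mons (insert k I)" "b_edge t k"] insert.hyps b_mons_quot
    by (simp add: b_mons_add)
  then show ?case
    using insert by (simp add: ac_simps)
qed

section \<open>The Segre ring, one column at a time\<close>

definition ab_edges :: "nat \<Rightarrow> nat set" where
  "ab_edges k = {..<k} \<union> b_edge t ` {..<k}"

text \<open>Modulo the 2-minors, a product of edges a and b remembers only its bidegree in x1, x2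
  and its y-part. The monomials are those of equal total degree in x and in y.\<close>

definition segre :: "nat \<Rightarrow> gvert multiset set" where
  "segre k = {vmon c d L 0 0 0 0 | c d L. c + d = size L \<and> set_mset L \<subseteq> {..<k}}"

lemma finite_ab_edges [simp]: "finite (ab_edges k)"
  by (simp add: ab_edges_def)

lemma segre_add:
  assumes "k \<le> t" "m \<in> segre k" "e \<in> ab_edges k"
  shows "m + Gt_ends t e \<in> segre k"
  using assms by (force simp: segre_def ab_edges_def)

text \<open>Once x1 and the y-vertex of column \<open>k\<close> both divide a monomial, the cofactor
  again has equal degrees in x and y, so divisibility by the edge a of that column can be tested at
  its two vertices.\<close>

lemma segre_quot:
  assumes "k < t"
  shows "mod_quot k (segre (Suc k)) =
    {vmon c d L 0 0 0 0 | c d L. c + d = size L \<and> set_mset L \<subseteq> {..<Suc k} \<and> (c = 0 \<or> k \<notin># L)}"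
proof (intro set_eqI iffI)
  fix m assume m: "m \<in> mod_quot k (segre (Suc k))"
  then obtain c d L where L: "m = vmon c d L 0 0 0 0" "c + d = size L" "set_mset L \<subseteq> {..<Suc k}"
    by (auto simp: mod_quot_def segre_def)
  have "c = 0 \<or> k \<notin># L"
  proof (rule ccontr)
    assume "\<not> (c = 0 \<or> k \<notin># L)"
    then obtain L' c' where L': "L = add_mset k L'" "c = Suc c'"
      by (metis insert_DiffM not0_implies_Suc)
    then have "vmon c' d L' 0 0 0 0 \<in> segre (Suc k)"
      using L by (auto simp: segre_def)
    moreover have "m = vmon c' d L' 0 0 0 0 + Gt_ends t k"
      using assms by (simp add: L L')
    ultimately show False
      using m unfolding mod_quot_iff by blast
  qed
  then show "m \<in> {vmon c d L 0 0 0 0 | c d L. c + d = size L \<and> set_mset L \<subseteq> {..<Suc k} \<and> (c = 0 \<or> k \<notin># L)}"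
    using L by blast
next
  fix m assume "m \<in> {vmon c d L 0 0 0 0 | c d L. c + d = size L \<and> set_mset L \<subseteq> {..<Suc k} \<and> (c = 0 \<or> k \<notin># L)}"
  then show "m \<in> mod_quot k (segre (Suc k))"
    using assms by (auto simp: mod_quot_def segre_def)
qed

lemma b_multiples: "(+) (vmon 0 1 {#k#} 0 0 0 0) ` b_mons {..<Suc k} =
    {vmon 0 (size L) L 0 0 0 0 | L. set_mset L \<subseteq> {..<Suc k} \<and> k \<in># L}"
proof (intro set_eqI iffI)
  fix m assume "m \<in> {vmon 0 (size L) L 0 0 0 0 | L. set_mset L \<subseteq> {..<Suc k} \<and> k \<in># L}"
  then obtain L where L: "m = vmon 0 (size L) L 0 0 0 0" "set_mset L \<subseteq> {..<Suc k}" "k \<in># L"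
    by auto
  then obtain L' where L': "L = add_mset k L'"
    by (metis insert_DiffM)
  have "m = vmon 0 1 {#k#} 0 0 0 0 + vmon 0 (size L') L' 0 0 0 0"
    by (simp add: L L')
  then show "m \<in> (+) (vmon 0 1 {#k#} 0 0 0 0) ` b_mons {..<Suc k}"
    using L L' by (intro image_eqI) (auto simp: b_mons_def)
qed (force simp: b_mons_def)

lemma segre_quot_diff:
  assumes "k < t"
  shows "mod_quot k (segre (Suc k)) - (+) (vmon 0 1 {#k#} 0 0 0 0) ` b_mons {..<Suc k} = segre k"
    and "(+) (vmon 0 1 {#k#} 0 0 0 0) ` b_mons {..<Suc k} \<subseteq> mod_quot k (segre (Suc k))"
proof -
  have less_k: "set_mset L \<subseteq> {..<Suc k} \<and> k \<notin># L \<longleftrightarrow> set_mset L \<subseteq> {..<k}" for L :: "nat multiset"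
    by (auto simp: less_Suc_eq)
  show "mod_quot k (segre (Suc k)) - (+) (vmon 0 1 {#k#} 0 0 0 0) ` b_mons {..<Suc k} = segre k"
    unfolding b_multiples segre_quot[OF assms]
  proof (intro set_eqI iffI)
    fix m
    assume "m \<in> {vmon c d L 0 0 0 0 | c d L. c + d = size L \<and> set_mset L \<subseteq> {..<Suc k} \<and> (c = 0 \<or> k \<notin># L)} -
      {vmon 0 (size L) L 0 0 0 0 | L. set_mset L \<subseteq> {..<Suc k} \<and> k \<in># L}"
    then obtain c d L where "m = vmon c d L 0 0 0 0" "c + d = size L" "set_mset L \<subseteq> {..<Suc k}" "k \<notin># L"
      by auto
    then show "m \<in> segre k"
      using less_k[of L] by (auto simp: segre_def)
  next
    fix m assume "m \<in> segre k"
    then obtain c d L where "m = vmon c d L 0 0 0 0" "c + d = size L" "set_mset L \<subseteq> {..<Suc k}" "k \<notin># L"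
      unfolding segre_def less_k[symmetric] by blast
    then show "m \<in> {vmon c d L 0 0 0 0 | c d L. c + d = size L \<and> set_mset L \<subseteq> {..<Suc k} \<and> (c = 0 \<or> k \<notin># L)} -
      {vmon 0 (size L) L 0 0 0 0 | L. set_mset L \<subseteq> {..<Suc k} \<and> k \<in># L}"
      by auto
  qed
  show "(+) (vmon 0 1 {#k#} 0 0 0 0) ` b_mons {..<Suc k} \<subseteq> mod_quot k (segre (Suc k))"
    unfolding b_multiples segre_quot[OF assms] by auto
qed

text \<open>Modulo the last a, the ring is an extension of the Segre ring with one column less by the
free K[b]-module generated by the last b.\<close>

lemma segre_reg: "k \<le> t \<Longrightarrow> reg_pd_le (ab_edges k) (segre k) 2 k"
proof (induction k)
  case 0
  show ?case
    using reg_pd_le_no_variables[of "segre 0" 2] by (auto simp: segre_def ab_edges_def)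
next
  case (Suc k)
  then have k: "k < t" by simp
  let ?T = "insert (b_edge t k) (ab_edges k)"
  let ?A = "(+) (vmon 0 1 {#k#} 0 0 0 0) ` b_mons {..<Suc k}"
  have T: "ab_edges (Suc k) = insert k ?T"
    by (auto simp: ab_edges_def lessThan_Suc)
  have T': "?T = {..<k} \<union> b_edge t ` {..<Suc k}"
    by (auto simp: ab_edges_def lessThan_Suc)
  have kT: "k \<notin> ?T" and bT: "b_edge t k \<notin> ab_edges k"
    using k by (auto simp: ab_edges_def b_edge_def)
  have cv: "convex_mod (insert k ?T) (segre (Suc k))"
    using segre_add[OF Suc.prems] unfolding T by (rule convex_mod_closed)
  have cvA: "convex_mod ?T ?A"
    unfolding T' using k convex_b_mons
    by (intro convex_mod_X1_const[where c = 0]) (auto simp: b_mons_def)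
  \<comment> \<open>The module is free over the polynomial ring on the b with a generator of edge
    degree one, and the \<open>k\<close> remaining a act on it by zero.\<close>
  have regA: "reg_pd_le ?T ?A 2 (Suc k)"
    using reg_pd_le_add_variables[OF _ _ _ _ b_mons_reg, of "{..<k}" "{..<Suc k}" "vmon 0 1 {#k#} 0 0 0 0"]
      cvA k unfolding T' by (force simp: b_edge_def elim: reg_pd_le_mono)
  \<comment> \<open>The last b acts by zero on the smaller Segre ring, whose monomials avoid its
    y-vertex.\<close>
  have cvR: "convex_mod ?T (segre k)"
    unfolding convex_mod_def
  proof (intro ballI impI)
    fix m e f assume m: "m \<in> segre k" "e \<in> ?T" "f \<in> ?T" and h: "m + Gt_ends t e + Gt_ends t f \<in> segre k"
    have "count m' (Y (k + 1)) = 0" if "m' \<in> segre k" for m'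
    proof -
      obtain c d L where m': "m' = vmon c d L 0 0 0 0" and "set_mset L \<subseteq> {..<k}"
        using \<open>m' \<in> segre k\<close> by (auto simp: segre_def)
      then have "k \<notin># L"
        by auto
      then show ?thesis
        by (simp add: m' not_in_iff)
    qed
    then have "e \<noteq> b_edge t k"
      using h by (fastforce simp: Gt_ends_vmon b_edge_def)
    then show "m + Gt_ends t e \<in> segre k"
      using m segre_add k by auto
  qed
  have regR: "reg_pd_le ?T (segre k) 2 (Suc k)"
    using Suc cvR bT by (intro reg_pd_le_add_variable) auto
  have sub: "submod ?T ?A (mod_quot k (segre (Suc k)))"
    unfolding submod_def
  proof (intro conjI ballI impI)
    show "?A \<subseteq> mod_quot k (segre (Suc k))"
      by (rule segre_quot_diff(2)[OF k])
    fix m e assume "m \<in> ?A" "e \<in> ?T" "m + Gt_ends t e \<in> mod_quot k (segre (Suc k))"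
    then show "m + Gt_ends t e \<in> ?A"
      using k unfolding b_multiples segre_quot[OF k] ab_edges_def by auto
  qed
  have "reg_pd_le ?T (mod_quot k (segre (Suc k))) 2 (Suc k)"
    using regR unfolding segre_quot_diff(1)[OF k, symmetric]
    by (intro reg_pd_le_extension[OF _ convex_mod_quot[OF cv] sub regA]) simp_all
  then show ?case
    unfolding T by (intro reg_pd_le_regular[OF _ kT cv] segre_add[OF Suc.prems, unfolded T]) simp_all
qed

text \<open>Dimension k + 1 and h-polynomial 1 + (k - 1) x, arranged so that no natural-number
  subtraction occurs and \<open>k = 0\<close> is covered.\<close>

lemma segre_hilbert:
  "k \<le> t \<Longrightarrow> (1 - fps_X) ^ Suc k * hilbert_series 0 (segre k) = 1 - fps_X + of_nat k * fps_X"
proof (induction k)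
  case 0
  have "segre 0 = {{#}}"
    by (auto simp: segre_def vmon_zero)
  then have "hilbert_series 0 (segre 0) = 1"
    by (intro fps_ext) (auto simp: hilbert_series_def)
  then show ?case
    by simp
next
  case (Suc k)
  then have k: "k < t" by simp
  let ?A = "(+) (vmon 0 1 {#k#} 0 0 0 0) ` b_mons {..<Suc k}"
  have fin: "finite_sizes (segre (Suc k))"
    using k by (intro finite_sizes_vmon) (fastforce simp: segre_def)
  have fin': "finite_sizes (mod_quot k (segre (Suc k)))"
    by (rule finite_sizes_subset[OF fin]) (auto simp: mod_quot_def)
  have "(1 - fps_X) * hilbert_series 0 (segre (Suc k)) = hilbert_series 0 (mod_quot k (segre (Suc k)))"
    using segre_add[OF Suc.prems] fin by (subst hilbert_series_regular) (auto simp: ab_edges_def)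
  also have "\<dots> = hilbert_series 0 (segre k) + hilbert_series 0 ?A"
    using hilbert_series_diff[OF fin' segre_quot_diff(2)[OF k], of 0] segre_quot_diff(1)[OF k] by simp
  also have "hilbert_series 0 ?A = fps_X ^ 1 * hilbert_series 0 (b_mons {..<Suc k})"
    by (rule hilbert_series_shift) auto
  finally have 1: "(1 - fps_X) * hilbert_series 0 (segre (Suc k)) =
    hilbert_series 0 (segre k) + fps_X * hilbert_series 0 (b_mons {..<Suc k})"
    by simp
  have 2: "(1 - fps_X) ^ Suc k * hilbert_series 0 (b_mons {..<Suc k}) = 1"
    using b_mons_hilbert[of "{..<Suc k}"] k by simp
  have "(1 - fps_X) ^ Suc (Suc k) * hilbert_series 0 (segre (Suc k)) =
      (1 - fps_X) ^ Suc k * ((1 - fps_X) * hilbert_series 0 (segre (Suc k)))"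
    by (simp only: power_Suc2 mult.assoc)
  also have "\<dots> = (1 - fps_X) ^ Suc k * hilbert_series 0 (segre k) +
      fps_X * ((1 - fps_X) ^ Suc k * hilbert_series 0 (b_mons {..<Suc k}))"
    unfolding 1 by (simp only: distrib_left mult.left_commute)
  also have "\<dots> = 1 - fps_X + of_nat k * fps_X + fps_X"
    using Suc 2 by simp
  finally show ?case
    by (simp add: algebra_simps)
qed

end

section \<open>Adjoining e2, f1 and f3\<close>

context edge_koszul
begin

lemma tor_zero_small: "n < 2 * i \<Longrightarrow> tor_zero T P i n"
  unfolding tor_zero_def
  by (auto simp: strand_def size_ends intro!: exact_at_no_faces)

end

context Gt_koszul
begin

lemma vmon_in_segre [simp]:
  "vmon c d L z1 z2 w1 w2 \<in> segre k \<longleftrightarrow>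
     z1 = 0 \<and> z2 = 0 \<and> w1 = 0 \<and> w2 = 0 \<and> c + d = size L \<and> set_mset L \<subseteq> {..<k}"
  by (auto simp: segre_def)

lemma vmon_in_b_mons [simp]:
  "vmon c d L z1 z2 w1 w2 \<in> b_mons I \<longleftrightarrow>
     c = 0 \<and> d = size L \<and> z1 = 0 \<and> z2 = 0 \<and> w1 = 0 \<and> w2 = 0 \<and> set_mset L \<subseteq> I"
  by (auto simp: b_mons_def)

lemma segreE:
  assumes "m \<in> segre k"
  obtains c d L where "m = vmon c d L 0 0 0 0" "c + d = size L" "set_mset L \<subseteq> {..<k}"
  using assms by (auto simp: segre_def)

text \<open>Parts of R[e2, f1, f3], with \<open>z\<close>, \<open>p\<close>, \<open>q\<close> the
  exponents of these variables. In the absence of e1, e3 and f2 they are the exponents at the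
  vertices z, w1 and w2; f1 and f3 together use \<open>p + q\<close> of the exponent
  \<open>n\<close> of x2. The index set {0} describes division by a variable, the positive numbers
  its multiples.\<close>

definition tri_part :: "nat set \<Rightarrow> nat set \<Rightarrow> nat set \<Rightarrow> gvert multiset set" where
  "tri_part Zs Ps Qs = {vmon c n L z z p q | c n L z p q.
     z \<in> Zs \<and> p \<in> Ps \<and> q \<in> Qs \<and> p + q \<le> n \<and> c + n = size L + p + q \<and> set_mset L \<subseteq> {..<t}}"

abbreviation tri :: "gvert multiset set" where
  "tri \<equiv> tri_part UNIV UNIV UNIV"

definition tri_edges :: "nat set" where
  "tri_edges = insert (t + 4) (insert t (insert (t + 2) (ab_edges t)))"

lemma vmon_in_tri_part [simp]:
  "vmon c n L z1 z2 p q \<in> tri_part Zs Ps Qs \<longleftrightarrow> z1 = z2 \<and>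
     z1 \<in> Zs \<and> p \<in> Ps \<and> q \<in> Qs \<and> p + q \<le> n \<and> c + n = size L + p + q \<and> set_mset L \<subseteq> {..<t}"
  by (auto simp: tri_part_def)

lemma tri_partE:
  assumes "m \<in> tri_part Zs Ps Qs"
  obtains c n L z p q where "m = vmon c n L z z p q" "z \<in> Zs" "p \<in> Ps" "q \<in> Qs"
    "p + q \<le> n" "c + n = size L + p + q" "set_mset L \<subseteq> {..<t}"
  using assms by (auto simp: tri_part_def)

lemma tri_add:
  assumes "m \<in> tri" "e \<in> tri_edges"
  shows "m + Gt_ends t e \<in> tri"
  using assms by (elim tri_partE) (auto simp: tri_edges_def ab_edges_def)

lemma tri_part_quot:
  "mod_quot (t + 4) (tri_part UNIV Ps Qs) = tri_part {0} Ps Qs"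
  "mod_quot t (tri_part Zs UNIV Qs) = tri_part Zs {0} Qs"
  "mod_quot (t + 2) (tri_part Zs Ps UNIV) = tri_part Zs Ps {0}"
proof -
  show "mod_quot (t + 4) (tri_part UNIV Ps Qs) = tri_part {0} Ps Qs"
  proof (intro set_eqI iffI)
    fix m assume m: "m \<in> mod_quot (t + 4) (tri_part UNIV Ps Qs)"
    then obtain c n L z p q where v: "m = vmon c n L z z p q" "p \<in> Ps" "q \<in> Qs"
      "p + q \<le> n" "c + n = size L + p + q" "set_mset L \<subseteq> {..<t}"
      unfolding mod_quot_iff by (elim conjE tri_partE)
    have "z = 0"
    proof (rule ccontr)
      assume "z \<noteq> 0"
      then have "m = vmon c n L (z - 1) (z - 1) p q + Gt_ends t (t + 4)"
        by (simp add: v)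
      moreover have "vmon c n L (z - 1) (z - 1) p q \<in> tri_part UNIV Ps Qs"
        using v by auto
      ultimately show False
        using m unfolding mod_quot_iff by blast
    qed
    then show "m \<in> tri_part {0} Ps Qs"
      using v by simp
  next
    fix m assume "m \<in> tri_part {0} Ps Qs"
    then show "m \<in> mod_quot (t + 4) (tri_part UNIV Ps Qs)"
      unfolding mod_quot_iff by (auto elim!: tri_partE)
  qed
  show "mod_quot t (tri_part Zs UNIV Qs) = tri_part Zs {0} Qs"
  proof (intro set_eqI iffI)
    fix m assume m: "m \<in> mod_quot t (tri_part Zs UNIV Qs)"
    then obtain c n L z p q where v: "m = vmon c n L z z p q" "z \<in> Zs" "q \<in> Qs"
      "p + q \<le> n" "c + n = size L + p + q" "set_mset L \<subseteq> {..<t}"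
      unfolding mod_quot_iff by (elim conjE tri_partE)
    have "p = 0"
    proof (rule ccontr)
      assume p: "p \<noteq> 0"
      then have "m = vmon c (n - 1) L z z (p - 1) q + Gt_ends t t"
        using v by simp
      moreover have "vmon c (n - 1) L z z (p - 1) q \<in> tri_part Zs UNIV Qs"
        using v p by auto
      ultimately show False
        using m unfolding mod_quot_iff by blast
    qed
    then show "m \<in> tri_part Zs {0} Qs"
      using v by simp
  next
    fix m assume "m \<in> tri_part Zs {0} Qs"
    then show "m \<in> mod_quot t (tri_part Zs UNIV Qs)"
      unfolding mod_quot_iff by (auto elim!: tri_partE)
  qed
  show "mod_quot (t + 2) (tri_part Zs Ps UNIV) = tri_part Zs Ps {0}"
  proof (intro set_eqI iffI)
    fix m assume m: "m \<in> mod_quot (t + 2) (tri_part Zs Ps UNIV)"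
    then obtain c n L z p q where v: "m = vmon c n L z z p q" "z \<in> Zs" "p \<in> Ps"
      "p + q \<le> n" "c + n = size L + p + q" "set_mset L \<subseteq> {..<t}"
      unfolding mod_quot_iff by (elim conjE tri_partE)
    have "q = 0"
    proof (rule ccontr)
      assume q: "q \<noteq> 0"
      then have "m = vmon c (n - 1) L z z p (q - 1) + Gt_ends t (t + 2)"
        using v by simp
      moreover have "vmon c (n - 1) L z z p (q - 1) \<in> tri_part Zs Ps UNIV"
        using v q by auto
      ultimately show False
        using m unfolding mod_quot_iff by blast
    qed
    then show "m \<in> tri_part Zs Ps {0}"
      using v by simp
  next
    fix m assume "m \<in> tri_part Zs Ps {0}"
    then show "m \<in> mod_quot (t + 2) (tri_part Zs Ps UNIV)"
      unfolding mod_quot_iff by (auto elim!: tri_partE)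
  qed
qed

lemma tri_part_zero: "tri_part {0} {0} {0} = segre t"
  by (auto elim!: tri_partE segreE)

text \<open>A variable without x1 preserves the exponent of x1, so dividing by it commutes with
  restricting that exponent.\<close>

lemma mod_quot_restrict:
  assumes "count (Gt_ends t e) (X 1) = 0"
  shows "mod_quot e {m\<in>P. C (count m (X 1))} = {m\<in>mod_quot e P. C (count m (X 1))}"
  using assms unfolding set_eq_iff mod_quot_iff by auto

context
  fixes C :: "nat \<Rightarrow> bool"
  assumes C: "\<And>c. C (Suc c) \<Longrightarrow> C c"
begin

text \<open>One argument serves both R, with \<open>C\<close> always true, and R / (a)^2, with
  \<open>C c\<close> being \<open>c <= 1\<close>.\<close>

abbreviation restr :: "gvert multiset set \<Rightarrow> gvert multiset set" where
  "restr P \<equiv> {m\<in>P. C (count m (X 1))}"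

lemma count_tri_edges:
  "count (Gt_ends t (t + 4)) (X 1) = 0" "count (Gt_ends t t) (X 1) = 0"
  "count (Gt_ends t (t + 2)) (X 1) = 0"
  by (simp_all add: Gt_ends_def)

lemma restr_quots:
  "mod_quot (t + 4) (restr tri) = restr (tri_part {0} UNIV UNIV)"
  "mod_quot t (restr (tri_part {0} UNIV UNIV)) = restr (tri_part {0} {0} UNIV)"
  "mod_quot (t + 2) (restr (tri_part {0} {0} UNIV)) = restr (segre t)"
  using mod_quot_restrict[OF count_tri_edges(1)] mod_quot_restrict[OF count_tri_edges(2)]
    mod_quot_restrict[OF count_tri_edges(3)] tri_part_zero
  by (simp_all only: tri_part_quot)

lemma restr_add:
  "m \<in> restr (tri_part UNIV Ps Qs) \<Longrightarrow> m + Gt_ends t (t + 4) \<in> restr (tri_part UNIV Ps Qs)"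
  "m \<in> restr (tri_part Zs UNIV Qs) \<Longrightarrow> m + Gt_ends t t \<in> restr (tri_part Zs UNIV Qs)"
  "m \<in> restr (tri_part Zs Ps UNIV) \<Longrightarrow> m + Gt_ends t (t + 2) \<in> restr (tri_part Zs Ps UNIV)"
  by (elim CollectE conjE tri_partE, simp)+

lemma convex_restr_tri: "convex_mod tri_edges (restr tri)"
  by (rule convex_mod_X1_bounded) (use tri_add C in auto)

lemma convex_restr_segre: "convex_mod (ab_edges t) (restr (segre t))"
  by (rule convex_mod_X1_bounded) (use segre_add C in auto)

text \<open>The variables e2, f1, f3 are polynomial variables over the Segre part; dividing by them
  one at a time leaves Tor unchanged.\<close>

lemma tor_zero_restr_tri:
  "tor_zero tri_edges (restr tri) i n \<longleftrightarrow> tor_zero (ab_edges t) (restr (segre t)) i n"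
proof -
  let ?T1 = "insert (t + 2) (ab_edges t)"
  let ?T2 = "insert t ?T1"
  have notin: "t + 4 \<notin> ?T2" "t \<notin> ?T1" "t + 2 \<notin> ab_edges t"
    by (auto simp: ab_edges_def b_edge_def)
  have cv0: "convex_mod (insert (t + 4) ?T2) (restr tri)"
    using convex_restr_tri by (simp only: tri_edges_def)
  have cv1: "convex_mod ?T2 (restr (tri_part {0} UNIV UNIV))"
    using convex_mod_quot[OF cv0] unfolding restr_quots .
  have cv2: "convex_mod ?T1 (restr (tri_part {0} {0} UNIV))"
    using convex_mod_quot[OF cv1] unfolding restr_quots .
  have "tor_zero tri_edges (restr tri) i n \<longleftrightarrow> tor_zero ?T2 (restr (tri_part {0} UNIV UNIV)) i n"
    unfolding tri_edges_def restr_quots(1)[symmetric]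
    by (rule tor_zero_regular[OF _ notin(1) cv0]) (simp, rule restr_add(1))
  also have "\<dots> \<longleftrightarrow> tor_zero ?T1 (restr (tri_part {0} {0} UNIV)) i n"
    unfolding restr_quots(2)[symmetric]
    by (rule tor_zero_regular[OF _ notin(2) cv1]) (simp, rule restr_add(2))
  also have "\<dots> \<longleftrightarrow> tor_zero (ab_edges t) (restr (segre t)) i n"
    unfolding restr_quots(3)[symmetric]
    by (rule tor_zero_regular[OF _ notin(3) cv2]) (simp, rule restr_add(3))
  finally show ?thesis .
qed

lemma finite_sizes_restr: "finite_sizes (restr (tri_part Zs Ps Qs))"
  by (rule finite_sizes_vmon) (blast elim: tri_partE)

lemma hilbert_restr_tri:
  "hilbert_series 0 (restr (segre t)) = (1 - fps_X) ^ 3 * hilbert_series 0 (restr tri)"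
proof -
  have 1: "hilbert_series 0 (restr (tri_part {0} UNIV UNIV)) = (1 - fps_X) * hilbert_series 0 (restr tri)"
    unfolding restr_quots(1)[symmetric]
    by (rule hilbert_series_regular[OF finite_sizes_restr]) (rule restr_add(1))
  have 2: "hilbert_series 0 (restr (tri_part {0} {0} UNIV)) =
      (1 - fps_X) * hilbert_series 0 (restr (tri_part {0} UNIV UNIV))"
    unfolding restr_quots(2)[symmetric]
    by (rule hilbert_series_regular[OF finite_sizes_restr]) (rule restr_add(2))
  have 3: "hilbert_series 0 (restr (segre t)) =
      (1 - fps_X) * hilbert_series 0 (restr (tri_part {0} {0} UNIV))"
    unfolding restr_quots(3)[symmetric]
    by (rule hilbert_series_regular[OF finite_sizes_restr]) (rule restr_add(3))
  show ?thesis
    unfolding 3 2 1 by (simp add: power3_eq_cube mult.assoc)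
qed

end

end

section \<open>The two pieces of the quotient by e1, e3 and f2\<close>

context Gt_koszul
begin

lemma reg_pd_le_tri: "reg_pd_le tri_edges tri 2 t"
  using segre_reg[of t] tor_zero_restr_tri[of "\<lambda>_. True"] by (simp add: reg_pd_le_def)

lemma hilbert_tri: "(1 - fps_X) ^ 3 * hilbert_series 0 tri = hilbert_series 0 (segre t)"
  using hilbert_restr_tri[of "\<lambda>_. True"] by simp

section \<open>The quotients by (a)^2 and the module (a) / (a)^2\<close>

definition segre_lin :: "gvert multiset set" where
  "segre_lin = {m\<in>segre t. count m (X 1) \<le> 1}"

definition tri_lin :: "gvert multiset set" where
  "tri_lin = {m\<in>tri. count m (X 1) \<le> 1}"

text \<open>This is (a) / (a)^2: a monomial of the Segre ring lies in (a)^j exactly if its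
  x1-exponent is at least j.\<close>

definition segre_one :: "gvert multiset set" where
  "segre_one = {m\<in>segre t. count m (X 1) = 1}"

abbreviation x1 :: "gvert multiset" where
  "x1 \<equiv> vmon 1 0 {#} 0 0 0 0"

abbreviation x2 :: "gvert multiset" where
  "x2 \<equiv> vmon 0 1 {#} 0 0 0 0"

text \<open>The vertex monomial of B = e2 f1 f3, of size 6.\<close>

abbreviation B_mon :: "gvert multiset" where
  "B_mon \<equiv> vmon 0 2 {#} 1 1 1 1"

lemma segre_lin_diff: "segre_lin - segre_one = b_mons {..<t}"
  by (auto simp: segre_lin_def segre_one_def b_mons_def elim!: segreE)

text \<open>After multiplication by x2, the ideal (a) / (a)^2 becomes the part of positive degree of the free
K[b]-module generated by x1.\<close>

lemma segre_one_shift: "(+) x2 ` segre_one = (+) x1 ` b_mons {..<t} - {x1}"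
proof (intro set_eqI iffI)
  fix m assume "m \<in> (+) x2 ` segre_one"
  then obtain c d L where m: "m = x2 + vmon c d L 0 0 0 0" "c = 1" "c + d = size L" "set_mset L \<subseteq> {..<t}"
    by (auto simp: segre_one_def elim!: segreE)
  then have "m = x1 + vmon 0 (size L) L 0 0 0 0" "m \<noteq> x1"
    by auto
  then show "m \<in> (+) x1 ` b_mons {..<t} - {x1}"
    using m by (intro DiffI image_eqI[of _ _ "vmon 0 (size L) L 0 0 0 0"]) auto
next
  fix m assume "m \<in> (+) x1 ` b_mons {..<t} - {x1}"
  then obtain L where m: "m = vmon 1 (size L) L 0 0 0 0" "set_mset L \<subseteq> {..<t}" "size L \<noteq> 0"
    by (auto simp: b_mons_def)
  then obtain k where k: "size L = Suc k"
    by (metis not0_implies_Suc)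
  then have "m = x2 + vmon 1 k L 0 0 0 0"
    using m by simp
  moreover have "vmon 1 k L 0 0 0 0 \<in> segre_one"
    using m k by (simp add: segre_one_def)
  ultimately show "m \<in> (+) x2 ` segre_one"
    by blast
qed

lemma x1_in: "x1 \<in> (+) x1 ` b_mons {..<t}"
  by (rule image_eqI[of _ _ "vmon 0 0 {#} 0 0 0 0"]) auto

lemma segre_one_shift_diff: "(+) x1 ` b_mons {..<t} - (+) x2 ` segre_one = {x1}"
  using x1_in unfolding segre_one_shift by blast

text \<open>The removed generator \<open>x1\<close> has size 1, while every product with an edge has
  size at least 2 and so cannot hit it.\<close>

lemma submod_segre_one: "submod T ((+) x2 ` segre_one) ((+) x1 ` b_mons {..<t})"
  unfolding submod_def
proof (intro conjI ballI impI)
  show "(+) x2 ` segre_one \<subseteq> (+) x1 ` b_mons {..<t}"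
    unfolding segre_one_shift by blast
  fix m e assume "m + Gt_ends t e \<in> (+) x1 ` b_mons {..<t}"
  moreover have "size (m + Gt_ends t e) \<ge> 2" "size x1 = 1"
    by (simp_all add: size_ends)
  then have "m + Gt_ends t e \<noteq> x1"
    by (metis Suc_1 not_less_eq_eq order_refl)
  ultimately show "m + Gt_ends t e \<in> (+) x2 ` segre_one"
    unfolding segre_one_shift by blast
qed

lemma ab_edges_t: "ab_edges t = {..<t} \<union> b_edge t ` {..<t}"
  by (simp add: ab_edges_def)

lemma convex_mod_singleton: "convex_mod T {m}"
proof -
  have "size (m + Gt_ends t e + Gt_ends t f) \<noteq> size m" for e f
    by (simp add: size_ends)
  then have "m + Gt_ends t e + Gt_ends t f \<noteq> m" for e f
    by metis
  then show ?thesis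
    by (auto simp: convex_mod_def)
qed

lemma card_b_edges: "card (b_edge t ` {..<t}) = t"
  by (simp add: card_image inj_on_def)

lemma a_b_disjoint: "{..<t} \<inter> b_edge t ` {..<t} = {}"
  by (auto simp: b_edge_def)

lemma reg_x1: "reg_pd_le (b_edge t ` {..<t}) {x1} 1 t"
proof -
  have "reg_pd_le {} {x1} 1 0"
    by (rule reg_pd_le_no_variables) simp
  then show ?thesis
    using reg_pd_le_add_variables[of "b_edge t ` {..<t}" "{}" "{x1}" 1 0]
    by (simp add: convex_mod_singleton card_b_edges)
qed

text \<open>As the kernel of the map from K[b] to its residue field, the maximal ideal has
  projective dimension t - 1. The t variables a act by zero and bring this to 2t - 1.\<close>

lemma reg_segre_one:
  assumes "t > 0"
  shows "reg_pd_le (ab_edges t) segre_one 2 (2 * t - 1)"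
proof -
  \<comment> \<open>The 1 is the size of \<open>x1\<close>, the 2 the cost of passing to a kernel;
    undoing the shift by \<open>x2\<close> returns 1 of them.\<close>
  have "reg_pd_le (b_edge t ` {..<t}) ((+) x2 ` segre_one) (1 + 2) (t - 1)"
  proof (rule reg_pd_le_sub[OF _ convex_b_mons[of _ x1] submod_segre_one])
    show "reg_pd_le (b_edge t ` {..<t}) ((+) x1 ` b_mons {..<t}) 1 (t - 1)"
      using b_mons_reg[of "{..<t}" x1] by (auto elim: reg_pd_le_mono)
    show "reg_pd_le (b_edge t ` {..<t}) ((+) x1 ` b_mons {..<t} - (+) x2 ` segre_one) 1 (Suc (t - 1))"
      unfolding segre_one_shift_diff using reg_x1 assms by simp
  qed simp
  then have 1: "reg_pd_le (b_edge t ` {..<t}) segre_one 2 (t - 1)"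
    using reg_pd_le_unshift[of "b_edge t ` {..<t}" x2 segre_one 2 "t - 1"] by (simp add: eval_nat_numeral)
  have [simp]: "count (Gt_ends t (b_edge t k)) (X (Suc 0)) = 0" for k
    by (simp add: Gt_ends_def b_edge_def)
  have "convex_mod (b_edge t ` {..<t}) segre_one"
    by (rule convex_mod_closed) (auto simp: segre_one_def elim!: segreE)
  then have "convex_mod ({..<t} \<union> b_edge t ` {..<t}) segre_one"
    by (rule convex_mod_X1_const[where c = 1]) (auto simp: segre_one_def)
  from reg_pd_le_add_variables[OF _ _ a_b_disjoint this 1] show ?thesis
    using assms by (simp add: ab_edges_t mult_2)
qed

lemma reg_b_mons_ab: "reg_pd_le (ab_edges t) ((+) s ` b_mons {..<t}) (size s) t"
proof -
  have "convex_mod ({..<t} \<union> b_edge t ` {..<t}) ((+) s ` b_mons {..<t})"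
    by (rule convex_mod_X1_const[OF convex_b_mons, where c = "count s (X 1)"])
      (auto simp: b_mons_def)
  from reg_pd_le_add_variables[OF _ _ a_b_disjoint this b_mons_reg] show ?thesis
    by (simp add: ab_edges_t)
qed

lemma reg_b_mons_ab_0: "reg_pd_le (ab_edges t) (b_mons {..<t}) 0 t"
  using reg_b_mons_ab[of "{#}"] by simp

lemma convex_segre_lin: "convex_mod (ab_edges t) segre_lin"
  unfolding segre_lin_def by (rule convex_restr_segre) simp

lemma submod_segre_lin: "submod (ab_edges t) segre_one segre_lin"
  by (auto simp: submod_def segre_one_def segre_lin_def)

lemma reg_segre_lin:
  assumes "t > 0"
  shows "reg_pd_le (ab_edges t) segre_lin 2 (2 * t - 1)"
proof (rule reg_pd_le_extension[OF _ convex_segre_lin submod_segre_lin reg_segre_one[OF assms]])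
  show "reg_pd_le (ab_edges t) (segre_lin - segre_one) 2 (2 * t - 1)"
    unfolding segre_lin_diff by (rule reg_pd_le_mono[OF reg_b_mons_ab_0]) (use assms in auto)
qed simp

lemma tor_zero_tri_lin:
  "tor_zero tri_edges tri_lin i n \<longleftrightarrow> tor_zero (ab_edges t) segre_lin i n"
  unfolding tri_lin_def segre_lin_def by (rule tor_zero_restr_tri) simp

lemma hilbert_tri_lin:
  "(1 - fps_X) ^ 3 * hilbert_series 0 tri_lin = hilbert_series 0 segre_lin"
  unfolding tri_lin_def segre_lin_def by (rule hilbert_restr_tri[symmetric]) simp

lemma finite_tri_edges: "finite tri_edges"
  by (simp add: tri_edges_def)

text \<open>The exponents of e2, f1 and f3 are visible in the monomial, so divisibility by B means
  that all three are positive.\<close>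

lemma tri_B_multiples:
  "(+) B_mon ` {m\<in>tri. C (count m (X 1))} =
    {m\<in>tri_part {0<..} {0<..} {0<..}. C (count m (X 1))}"
proof (intro set_eqI iffI)
  fix m assume "m \<in> {m\<in>tri_part {0<..} {0<..} {0<..}. C (count m (X 1))}"
  then obtain c n L z p q where m: "m = vmon c n L z z p q" "z > 0" "p > 0" "q > 0"
    "p + q \<le> n" "c + n = size L + p + q" "set_mset L \<subseteq> {..<t}" "C c"
    by (auto elim!: tri_partE)
  then have "m = B_mon + vmon c (n - 2) L (z - 1) (z - 1) (p - 1) (q - 1)"
    by auto
  moreover have "vmon c (n - 2) L (z - 1) (z - 1) (p - 1) (q - 1) \<in> {m\<in>tri. C (count m (X 1))}"
    using m by auto
  ultimately show "m \<in> (+) B_mon ` {m\<in>tri. C (count m (X 1))}"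
    by blast
next
  fix m assume "m \<in> (+) B_mon ` {m\<in>tri. C (count m (X 1))}"
  then obtain c n L z p q where m: "m = B_mon + vmon c n L z z p q"
    "p + q \<le> n" "c + n = size L + p + q" "set_mset L \<subseteq> {..<t}" "C c"
    by (auto elim!: tri_partE)
  then show "m \<in> {m\<in>tri_part {0<..} {0<..} {0<..}. C (count m (X 1))}"
    by simp
qed

lemma tri_B: "(+) B_mon ` tri = tri_part {0<..} {0<..} {0<..}"
  using tri_B_multiples[of "\<lambda>_. True"] by simp

lemma tri_lin_B: "(+) B_mon ` tri_lin = {m\<in>tri_part {0<..} {0<..} {0<..}. count m (X 1) \<le> 1}"
  using tri_B_multiples[of "\<lambda>c. c \<le> 1"] by (simp add: tri_lin_def)

text \<open>Division by a non-zero-divisor of degree 3 adds 3 - 1 to the regularity 1 and one to the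
  projective dimension. In the doubled grading the bound is 2 + 6 - 2 = 6.\<close>

lemma reg_tri_mod_B: "reg_pd_le tri_edges (tri - (+) B_mon ` tri) 6 (Suc t)"
proof (rule reg_pd_le_quotient[OF finite_tri_edges])
  show "convex_mod tri_edges tri"
    by (rule convex_mod_closed) (rule tri_add)
  show "submod tri_edges ((+) B_mon ` tri) tri"
    unfolding submod_def
  proof (intro conjI ballI impI)
    show "(+) B_mon ` tri \<subseteq> tri"
      unfolding tri_B by (auto elim!: tri_partE)
    fix m e assume "m \<in> (+) B_mon ` tri" "e \<in> tri_edges"
    then show "m + Gt_ends t e \<in> (+) B_mon ` tri"
      by (auto simp: add.assoc intro: tri_add)
  qed
  show "reg_pd_le tri_edges tri 6 (Suc t)"
    by (rule reg_pd_le_mono[OF reg_pd_le_tri]) auto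
  show "reg_pd_le tri_edges ((+) B_mon ` tri) (6 + 2) t"
    using reg_pd_le_shift[OF reg_pd_le_tri, of B_mon] by (simp add: eval_nat_numeral)
qed

section \<open>The edge ring\<close>

text \<open>Of the edges a and b only their numbers \<open>c\<close>, \<open>d\<close> and the
  y-part \<open>L\<close> are recorded. This already divides by the 2-minors, so the sole remaining
  ambiguity is the relation between A and B.\<close>

definition gmon :: "nat \<Rightarrow> nat \<Rightarrow> nat \<Rightarrow> nat \<Rightarrow> nat \<Rightarrow> nat \<Rightarrow> nat \<Rightarrow> nat \<Rightarrow> nat multiset \<Rightarrow> gvert multiset" where
  "gmon e1 e2 e3 f1 f2 f3 c d L =
     vmon (c + e1 + e3) (d + f1 + f3) L (e1 + e2) (e2 + e3) (f1 + f2) (f2 + f3)"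

definition gring :: "gvert multiset set" where
  "gring = {gmon e1 e2 e3 f1 f2 f3 c d L | e1 e2 e3 f1 f2 f3 c d L.
     c + d = size L \<and> set_mset L \<subseteq> {..<t}}"

text \<open>Two representations of a monomial differ by a multiple of the relation
e1 e3 f2 b_i b_j = e2 f1 f3 a_i a_j, so a monomial written without e1 is a multiple of e1 exactly if
the right-hand side divides it.\<close>

definition gring_e1 :: "gvert multiset set" where
  "gring_e1 = {gmon 0 e2 e3 f1 f2 f3 c d L | e2 e3 f1 f2 f3 c d L.
     c + d = size L \<and> set_mset L \<subseteq> {..<t} \<and> (e2 = 0 \<or> f1 = 0 \<or> f3 = 0 \<or> c \<le> 1)}"

definition gring_e1_e3 :: "gvert multiset set" where
  "gring_e1_e3 = {gmon 0 e2 0 f1 f2 f3 c d L | e2 f1 f2 f3 c d L.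
     c + d = size L \<and> set_mset L \<subseteq> {..<t} \<and> (e2 = 0 \<or> f1 = 0 \<or> f3 = 0 \<or> c \<le> 1)}"

definition gring_e1_e3_f2 :: "gvert multiset set" where
  "gring_e1_e3_f2 = {gmon 0 e2 0 f1 0 f3 c d L | e2 f1 f3 c d L.
     c + d = size L \<and> set_mset L \<subseteq> {..<t} \<and> (e2 = 0 \<or> f1 = 0 \<or> f3 = 0 \<or> c \<le> 1)}"

lemma gringI: "c + d = size L \<Longrightarrow> set_mset L \<subseteq> {..<t} \<Longrightarrow> gmon e1 e2 e3 f1 f2 f3 c d L \<in> gring"
  unfolding gring_def by blast

lemma gring_e1I: "c + d = size L \<Longrightarrow> set_mset L \<subseteq> {..<t} \<Longrightarrow> e2 = 0 \<or> f1 = 0 \<or> f3 = 0 \<or> c \<le> 1 \<Longrightarrow>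
    gmon 0 e2 e3 f1 f2 f3 c d L \<in> gring_e1"
  unfolding gring_e1_def by blast

lemma gring_e1_e3I: "c + d = size L \<Longrightarrow> set_mset L \<subseteq> {..<t} \<Longrightarrow> e2 = 0 \<or> f1 = 0 \<or> f3 = 0 \<or> c \<le> 1 \<Longrightarrow>
    gmon 0 e2 0 f1 f2 f3 c d L \<in> gring_e1_e3"
  unfolding gring_e1_e3_def by blast

lemma gring_e1_e3_f2I: "c + d = size L \<Longrightarrow> set_mset L \<subseteq> {..<t} \<Longrightarrow> e2 = 0 \<or> f1 = 0 \<or> f3 = 0 \<or> c \<le> 1 \<Longrightarrow>
    gmon 0 e2 0 f1 0 f3 c d L \<in> gring_e1_e3_f2"
  unfolding gring_e1_e3_f2_def by blast

lemma gmon_add_edge: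
  "k < t \<Longrightarrow> gmon e1 e2 e3 f1 f2 f3 c d L + Gt_ends t k = gmon e1 e2 e3 f1 f2 f3 (Suc c) d (add_mset k L)"
  "gmon e1 e2 e3 f1 f2 f3 c d L + Gt_ends t t = gmon e1 e2 e3 (Suc f1) f2 f3 c d L"
  "gmon e1 e2 e3 f1 f2 f3 c d L + Gt_ends t (t + 1) = gmon e1 e2 e3 f1 (Suc f2) f3 c d L"
  "gmon e1 e2 e3 f1 f2 f3 c d L + Gt_ends t (t + 2) = gmon e1 e2 e3 f1 f2 (Suc f3) c d L"
  "gmon e1 e2 e3 f1 f2 f3 c d L + Gt_ends t (t + 3) = gmon (Suc e1) e2 e3 f1 f2 f3 c d L"
  "gmon e1 e2 e3 f1 f2 f3 c d L + Gt_ends t (t + 4) = gmon e1 (Suc e2) e3 f1 f2 f3 c d L"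
  "gmon e1 e2 e3 f1 f2 f3 c d L + Gt_ends t (t + 5) = gmon e1 e2 (Suc e3) f1 f2 f3 c d L"
  "gmon e1 e2 e3 f1 f2 f3 c d L + Gt_ends t (b_edge t k) = gmon e1 e2 e3 f1 f2 f3 c (Suc d) (add_mset k L)"
  by (simp_all add: gmon_def)

lemma Gt_edges_eq: "Gt_edges t = insert (t + 3) (insert (t + 5) (insert (t + 1) tri_edges))"
proof -
  have "e < 2 * t + 6 \<longleftrightarrow> e < t \<or> e \<in> b_edge t ` {..<t} \<or> (t \<le> e \<and> e \<le> t + 5)" for e
  proof -
    have "e \<in> b_edge t ` {..<t} \<longleftrightarrow> t + 6 \<le> e \<and> e < 2 * t + 6"
    proof
      assume "t + 6 \<le> e \<and> e < 2 * t + 6"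
      then have "e = b_edge t (e - (t + 6))" "e - (t + 6) < t"
        by (auto simp: b_edge_def)
      then show "e \<in> b_edge t ` {..<t}"
        by blast
    qed (auto simp: b_edge_def)
    then show ?thesis by linarith
  qed
  moreover have "t \<le> e \<and> e \<le> t + 5 \<longleftrightarrow> e \<in> {t, t + 1, t + 2, t + 3, t + 4, t + 5}" for e
    by auto
  ultimately show ?thesis
    unfolding Gt_edges_def tri_edges_def ab_edges_def by blast
qed

lemma gring_add:
  assumes m: "m \<in> gring" and "e \<in> Gt_edges t"
  shows "m + Gt_ends t e \<in> gring"
proof -
  obtain e1 e2 e3 f1 f2 f3 c d L where m: "m = gmon e1 e2 e3 f1 f2 f3 c d L"
    and L: "c + d = size L" "set_mset L \<subseteq> {..<t}"
    using assms unfolding gring_def by blast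
  consider k where "k < t" "e = k" | k where "k < t" "e = b_edge t k" | "e = t" | "e = t + 1" |
    "e = t + 2" | "e = t + 3" | "e = t + 4" | "e = t + 5"
    using assms(2) unfolding Gt_edges_eq tri_edges_def ab_edges_def by blast
  then show ?thesis
    using L by cases (simp_all only: m gmon_add_edge, auto intro!: gringI)
qed

lemma gring_eq: "edge_ring (Gt_edges t) = gring"
proof
  have "sum_mset (image_mset (Gt_ends t) M) \<in> gring" if "set_mset M \<subseteq> Gt_edges t" for M
    using that
  proof (induction M)
    case empty
    have "gmon 0 0 0 0 0 0 0 0 {#} \<in> gring"
      by (rule gringI) auto
    then show ?case
      by (simp add: gmon_def vmon_zero)
  next
    case (add e M)
    then show ?case
      using gring_add[of "sum_mset (image_mset (Gt_ends t) M)" e] by (simp add: add.commute)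
  qed
  then show "edge_ring (Gt_edges t) \<subseteq> gring"
    by (auto simp: edge_ring_eq)
next
  have edges: "t \<in> Gt_edges t" "t + 1 \<in> Gt_edges t" "t + 2 \<in> Gt_edges t" "t + 3 \<in> Gt_edges t"
    "t + 4 \<in> Gt_edges t" "t + 5 \<in> Gt_edges t" "k < t \<Longrightarrow> k \<in> Gt_edges t"
    "k < t \<Longrightarrow> b_edge t k \<in> Gt_edges t" for k
    by (auto simp: Gt_edges_def b_edge_def)
  note add = edge_ring_add[of _ "Gt_edges t"]
  \<comment> \<open>Any distribution of the y-vertices over a and b gives the same monomial; here a
    is used for as long as \<open>c\<close> is positive.\<close>
  have 0: "gmon 0 0 0 0 0 0 c d L \<in> edge_ring (Gt_edges t)"
    if "c + d = size L" "set_mset L \<subseteq> {..<t}" for c d L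
    using that
  proof (induction L arbitrary: c d)
    case empty
    then show ?case
      using edge_ring_zero by (simp add: gmon_def vmon_zero)
  next
    case (add k L)
    then have k: "k < t" by auto
    show ?case
    proof (cases c)
      case 0
      then obtain d' where d: "d = Suc d'"
        using add.prems by (cases d) auto
      have "gmon 0 0 0 0 0 0 c d' L + Gt_ends t (b_edge t k) \<in> edge_ring (Gt_edges t)"
        using add d k by (intro edge_ring_add edges) auto
      then show ?thesis
        by (simp only: gmon_add_edge d)
    next
      case (Suc c')
      have "gmon 0 0 0 0 0 0 c' d L + Gt_ends t k \<in> edge_ring (Gt_edges t)"
        using add Suc k by (intro edge_ring_add edges) auto
      then show ?thesis
        by (simp only: gmon_add_edge k Suc)
    qed
  qed
  have "gmon e1 e2 e3 f1 f2 f3 c d L \<in> edge_ring (Gt_edges t)"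
    if L: "c + d = size L" "set_mset L \<subseteq> {..<t}" for e1 e2 e3 f1 f2 f3 c d L
  proof -
    have 1: "gmon e1 0 0 0 0 0 c d L \<in> edge_ring (Gt_edges t)"
      by (induction e1) (simp_all only: 0[OF L] gmon_add_edge(5)[symmetric] add[OF _ edges(4)])
    have 2: "gmon e1 e2 0 0 0 0 c d L \<in> edge_ring (Gt_edges t)"
      by (induction e2) (simp_all only: 1 gmon_add_edge(6)[symmetric] add[OF _ edges(5)])
    have 3: "gmon e1 e2 e3 0 0 0 c d L \<in> edge_ring (Gt_edges t)"
      by (induction e3) (simp_all only: 2 gmon_add_edge(7)[symmetric] add[OF _ edges(6)])
    have 4: "gmon e1 e2 e3 f1 0 0 c d L \<in> edge_ring (Gt_edges t)"
      by (induction f1) (simp_all only: 3 gmon_add_edge(2)[symmetric] add[OF _ edges(1)])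
    have 5: "gmon e1 e2 e3 f1 f2 0 c d L \<in> edge_ring (Gt_edges t)"
      by (induction f2) (simp_all only: 4 gmon_add_edge(3)[symmetric] add[OF _ edges(2)])
    show ?thesis
      by (induction f3) (simp_all only: 5 gmon_add_edge(4)[symmetric] add[OF _ edges(3)])
  qed
  then show "gring \<subseteq> edge_ring (Gt_edges t)"
    by (auto simp: gring_def)
qed

end

section \<open>The regular sequence e1, e3, f2 on the edge ring\<close>

context Gt_koszul
begin

lemma gring_quot_e1: "mod_quot (t + 3) gring = gring_e1"
proof (intro set_eqI iffI)
  fix m assume m: "m \<in> mod_quot (t + 3) gring"
  then obtain e1 e2 e3 f1 f2 f3 c d L where v: "m = gmon e1 e2 e3 f1 f2 f3 c d L"
    "c + d = size L" "set_mset L \<subseteq> {..<t}"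
    unfolding mod_quot_iff gring_def by blast
  have no: "m \<noteq> gmon (Suc e1) e2 e3 f1 f2 f3 c d L"
    if "c + d = size L" "set_mset L \<subseteq> {..<t}" for e1 e2 e3 f1 f2 f3 c d L
  proof -
    have "m \<noteq> gmon e1 e2 e3 f1 f2 f3 c d L + Gt_ends t (t + 3)"
      using m gringI[OF that] unfolding mod_quot_iff by blast
    then show ?thesis
      unfolding gmon_add_edge .
  qed
  have e1: "e1 = 0"
    using no[OF v(2,3)] v(1) by (cases e1) blast+
  have "e2 = 0 \<or> f1 = 0 \<or> f3 = 0 \<or> c \<le> 1"
  proof (rule ccontr)
    assume "\<not> (e2 = 0 \<or> f1 = 0 \<or> f3 = 0 \<or> c \<le> 1)"
    then have "e2 \<noteq> 0" "f1 \<noteq> 0" "f3 \<noteq> 0" "\<not> c \<le> 1"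
      by simp_all
    \<comment> \<open>The relation read backwards: e2 f1 f3 and two a are traded for e1 e3 f2 and
      two b.\<close>
    then have "m = gmon (Suc 0) (e2 - 1) (Suc e3) (f1 - 1) (Suc f2) (f3 - 1) (c - 2) (d + 2) L"
      by (simp add: v(1) e1 gmon_def)
    moreover have "c - 2 + (d + 2) = size L"
      using v(2) \<open>\<not> c \<le> 1\<close> by simp
    ultimately show False
      using no v(3) by blast
  qed
  then show "m \<in> gring_e1"
    unfolding v(1) e1 using v(2,3) by (intro gring_e1I)
next
  fix m assume "m \<in> gring_e1"
  then obtain e2 e3 f1 f2 f3 c d L where v: "m = gmon 0 e2 e3 f1 f2 f3 c d L"
    "c + d = size L" "set_mset L \<subseteq> {..<t}" "e2 = 0 \<or> f1 = 0 \<or> f3 = 0 \<or> c \<le> 1"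
    unfolding gring_e1_def by blast
  have "m \<noteq> m' + Gt_ends t (t + 3)" if "m' \<in> gring" for m'
  proof
    obtain e1' e2' e3' f1' f2' f3' c' d' L' where v': "m' = gmon e1' e2' e3' f1' f2' f3' c' d' L'"
      "c' + d' = size L'"
      using \<open>m' \<in> gring\<close> unfolding gring_def by blast
    assume "m = m' + Gt_ends t (t + 3)"
    then have "gmon 0 e2 e3 f1 f2 f3 c d L = gmon (Suc e1') e2' e3' f1' f2' f3' c' d' L'"
      by (simp only: v(1) v'(1) gmon_add_edge)
    \<comment> \<open>Put s = e1' + 1. Comparing exponents at the vertices gives e2 = e2' + s, f1 =
      f1' + s, f3 = f3' + s and c = c' + 2 s, against the condition on the representation of
      \<open>m\<close>.\<close>
    then show False
      using v(2,4) v'(2) unfolding gmon_def by auto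
  qed
  then show "m \<in> mod_quot (t + 3) gring"
    unfolding mod_quot_iff using gringI[OF v(2,3)] v(1) by blast
qed

text \<open>Without e1 the vertex z1 shows the exponent of e2, and then z2 shows that of e3: after
  the first quotient e3 is a free variable.\<close>

lemma gring_quot_e3: "mod_quot (t + 5) gring_e1 = gring_e1_e3"
proof (intro set_eqI iffI)
  fix m assume m: "m \<in> mod_quot (t + 5) gring_e1"
  then obtain e2 e3 f1 f2 f3 c d L where v: "m = gmon 0 e2 e3 f1 f2 f3 c d L"
    "c + d = size L" "set_mset L \<subseteq> {..<t}" "e2 = 0 \<or> f1 = 0 \<or> f3 = 0 \<or> c \<le> 1"
    unfolding mod_quot_iff gring_e1_def by blast
  have "m \<noteq> gmon 0 e2 (Suc e3') f1 f2 f3 c d L" for e3'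
    using m gring_e1I[OF v(2-4)] unfolding mod_quot_iff gmon_add_edge(7)[symmetric] by blast
  then have "e3 = 0"
    using v(1) by (cases e3) auto
  then show "m \<in> gring_e1_e3"
    unfolding v(1) using gring_e1_e3I[OF v(2-4)] by simp
next
  fix m assume "m \<in> gring_e1_e3"
  then obtain e2 f1 f2 f3 c d L where v: "m = gmon 0 e2 0 f1 f2 f3 c d L"
    "c + d = size L" "set_mset L \<subseteq> {..<t}" "e2 = 0 \<or> f1 = 0 \<or> f3 = 0 \<or> c \<le> 1"
    unfolding gring_e1_e3_def by blast
  have "m \<noteq> m' + Gt_ends t (t + 5)" if m': "m' \<in> gring_e1" for m'
  proof
    obtain e2' e3' f1' f2' f3' c' d' L' where v': "m' = gmon 0 e2' e3' f1' f2' f3' c' d' L'"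
      using m' unfolding gring_e1_def by blast
    assume "m = m' + Gt_ends t (t + 5)"
    then have "gmon 0 e2 0 f1 f2 f3 c d L = gmon 0 e2' (Suc e3') f1' f2' f3' c' d' L'"
      by (simp only: v(1) v' gmon_add_edge)
    then show False
      unfolding gmon_def by auto
  qed
  then show "m \<in> mod_quot (t + 5) gring_e1"
    unfolding mod_quot_iff using gring_e1I[OF v(2-4)] v(1) by blast
qed

text \<open>Without e1 and e3 the exponent of x1 is \<open>c\<close>. This fixes \<open>d\<close>,
  hence f1 + f3 at x2, and the exponents at w1 and w2 then determine f2.\<close>

lemma gring_quot_f2: "mod_quot (t + 1) gring_e1_e3 = gring_e1_e3_f2"
proof (intro set_eqI iffI)
  fix m assume m: "m \<in> mod_quot (t + 1) gring_e1_e3"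
  then obtain e2 f1 f2 f3 c d L where v: "m = gmon 0 e2 0 f1 f2 f3 c d L"
    "c + d = size L" "set_mset L \<subseteq> {..<t}" "e2 = 0 \<or> f1 = 0 \<or> f3 = 0 \<or> c \<le> 1"
    unfolding mod_quot_iff gring_e1_e3_def by blast
  have "m \<noteq> gmon 0 e2 0 f1 (Suc f2') f3 c d L" for f2'
    using m gring_e1_e3I[OF v(2-4)] unfolding mod_quot_iff gmon_add_edge(3)[symmetric] by blast
  then have "f2 = 0"
    using v(1) by (cases f2) auto
  then show "m \<in> gring_e1_e3_f2"
    unfolding v(1) using gring_e1_e3_f2I[OF v(2-4)] by simp
next
  fix m assume "m \<in> gring_e1_e3_f2"
  then obtain e2 f1 f3 c d L where v: "m = gmon 0 e2 0 f1 0 f3 c d L"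
    "c + d = size L" "set_mset L \<subseteq> {..<t}" "e2 = 0 \<or> f1 = 0 \<or> f3 = 0 \<or> c \<le> 1"
    unfolding gring_e1_e3_f2_def by blast
  have "m \<noteq> m' + Gt_ends t (t + 1)" if m': "m' \<in> gring_e1_e3" for m'
  proof
    obtain e2' f1' f2' f3' c' d' L' where v': "m' = gmon 0 e2' 0 f1' f2' f3' c' d' L'" "c' + d' = size L'"
      using m' unfolding gring_e1_e3_def by blast
    assume "m = m' + Gt_ends t (t + 1)"
    then have "gmon 0 e2 0 f1 0 f3 c d L = gmon 0 e2' 0 f1' (Suc f2') f3' c' d' L'"
      by (simp only: v(1) v'(1) gmon_add_edge)
    then show False
      using v(2) v'(2) unfolding gmon_def by auto
  qed
  then show "m \<in> mod_quot (t + 1) gring_e1_e3"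
    unfolding mod_quot_iff using gring_e1_e3I[OF v(2-4)] v(1) by blast
qed

text \<open>This is R[e2, f1, f3] modulo B (a)^2: a multiple of B survives exactly if its
  x1-exponent is at most 1.\<close>

lemma gring_e1_e3_f2_eq:
  "gring_e1_e3_f2 = {m\<in>tri. m \<in> tri_part {0<..} {0<..} {0<..} \<longrightarrow> count m (X 1) \<le> 1}"
proof (intro set_eqI iffI)
  fix m assume "m \<in> gring_e1_e3_f2"
  then obtain e2 f1 f3 c d L where v: "m = gmon 0 e2 0 f1 0 f3 c d L"
    "c + d = size L" "set_mset L \<subseteq> {..<t}" "e2 = 0 \<or> f1 = 0 \<or> f3 = 0 \<or> c \<le> 1"
    unfolding gring_e1_e3_f2_def by blast
  then show "m \<in> {m\<in>tri. m \<in> tri_part {0<..} {0<..} {0<..} \<longrightarrow> count m (X 1) \<le> 1}"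
    by (auto simp: gmon_def)
next
  fix m assume m: "m \<in> {m\<in>tri. m \<in> tri_part {0<..} {0<..} {0<..} \<longrightarrow> count m (X 1) \<le> 1}"
  then obtain c n L z p q where v: "m = vmon c n L z z p q" "p + q \<le> n" "c + n = size L + p + q"
    "set_mset L \<subseteq> {..<t}"
    by (auto elim!: tri_partE)
  then have "z = 0 \<or> p = 0 \<or> q = 0 \<or> c \<le> 1"
    using m by auto
  moreover have "m = gmon 0 z 0 p 0 q c (n - (p + q)) L" "c + (n - (p + q)) = size L"
    using v by (auto simp: gmon_def)
  ultimately show "m \<in> gring_e1_e3_f2"
    using v(4) by (auto intro: gring_e1_e3_f2I)
qed

lemma gring_e1_e3_f2_sub: "(+) B_mon ` tri_lin \<subseteq> gring_e1_e3_f2"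
  unfolding gring_e1_e3_f2_eq tri_lin_B by (auto elim!: tri_partE)

text \<open>The short exact sequence of the extension: the multiples of B form the copy of
  \<open>tri_lin\<close>, and what is left is R[e2, f1, f3] / (B).\<close>

lemma gring_e1_e3_f2_diff: "gring_e1_e3_f2 - (+) B_mon ` tri_lin = tri - (+) B_mon ` tri"
  unfolding gring_e1_e3_f2_eq tri_lin_B tri_B by blast

lemma submod_gring: "submod tri_edges ((+) B_mon ` tri_lin) gring_e1_e3_f2"
  unfolding submod_def
proof (intro conjI ballI impI gring_e1_e3_f2_sub)
  fix m e assume m: "m \<in> (+) B_mon ` tri_lin" and e: "e \<in> tri_edges"
    and h: "m + Gt_ends t e \<in> gring_e1_e3_f2"
  have "m \<in> (+) B_mon ` tri"
    using m by (auto simp: tri_lin_def)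
  then have "m + Gt_ends t e \<in> (+) B_mon ` tri"
    using e by (auto simp: add.assoc intro: tri_add)
  then show "m + Gt_ends t e \<in> (+) B_mon ` tri_lin"
    using h unfolding gring_e1_e3_f2_eq tri_lin_B tri_B by blast
qed

lemma gring_closed:
  "m \<in> gring \<Longrightarrow> m + Gt_ends t (t + 3) \<in> gring"
  "m \<in> gring_e1 \<Longrightarrow> m + Gt_ends t (t + 5) \<in> gring_e1"
  "m \<in> gring_e1_e3 \<Longrightarrow> m + Gt_ends t (t + 1) \<in> gring_e1_e3"
proof -
  show "m \<in> gring \<Longrightarrow> m + Gt_ends t (t + 3) \<in> gring"
    by (rule gring_add) (auto simp: Gt_edges_def)
  show "m \<in> gring_e1 \<Longrightarrow> m + Gt_ends t (t + 5) \<in> gring_e1"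
    unfolding gring_e1_def by (elim CollectE exE conjE) (simp only: gmon_add_edge, blast)
  show "m \<in> gring_e1_e3 \<Longrightarrow> m + Gt_ends t (t + 1) \<in> gring_e1_e3"
    unfolding gring_e1_e3_def by (elim CollectE exE conjE) (simp only: gmon_add_edge, blast)
qed

lemma convex_gring:
  "convex_mod (Gt_edges t) gring"
  "convex_mod (insert (t + 5) (insert (t + 1) tri_edges)) gring_e1"
  "convex_mod (insert (t + 1) tri_edges) gring_e1_e3"
  "convex_mod tri_edges gring_e1_e3_f2"
proof -
  show 0: "convex_mod (Gt_edges t) gring"
    by (rule convex_mod_closed) (rule gring_add)
  show 1: "convex_mod (insert (t + 5) (insert (t + 1) tri_edges)) gring_e1"
    using convex_mod_quot[OF 0[unfolded Gt_edges_eq]] unfolding gring_quot_e1 .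
  show 2: "convex_mod (insert (t + 1) tri_edges) gring_e1_e3"
    using convex_mod_quot[OF 1] unfolding gring_quot_e3 .
  show "convex_mod tri_edges gring_e1_e3_f2"
    using convex_mod_quot[OF 2] unfolding gring_quot_f2 .
qed

lemma tor_zero_gring:
  "tor_zero (Gt_edges t) gring i n \<longleftrightarrow> tor_zero tri_edges gring_e1_e3_f2 i n"
proof -
  have fin: "finite (insert (t + 5) (insert (t + 1) tri_edges))" "finite (insert (t + 1) tri_edges)"
    using finite_tri_edges by simp_all
  have notin: "t + 3 \<notin> insert (t + 5) (insert (t + 1) tri_edges)"
    "t + 5 \<notin> insert (t + 1) tri_edges" "t + 1 \<notin> tri_edges"
    by (auto simp: tri_edges_def ab_edges_def b_edge_def)
  have "tor_zero (Gt_edges t) gring i n \<longleftrightarrow>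
      tor_zero (insert (t + 5) (insert (t + 1) tri_edges)) gring_e1 i n"
    unfolding Gt_edges_eq gring_quot_e1[symmetric]
    by (rule tor_zero_regular[OF fin(1) notin(1) convex_gring(1)[unfolded Gt_edges_eq]]) (rule gring_closed)
  also have "\<dots> \<longleftrightarrow> tor_zero (insert (t + 1) tri_edges) gring_e1_e3 i n"
    unfolding gring_quot_e3[symmetric]
    by (rule tor_zero_regular[OF fin(2) notin(2) convex_gring(2)]) (rule gring_closed)
  also have "\<dots> \<longleftrightarrow> tor_zero tri_edges gring_e1_e3_f2 i n"
    unfolding gring_quot_f2[symmetric]
    by (rule tor_zero_regular[OF finite_tri_edges notin(3) convex_gring(3)]) (rule gring_closed)
  finally show ?thesis .
qed

text \<open>The bound 8 = 2 + 6 comes from \<open>tri_lin\<close> shifted by B; the other piece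
  stays below it, and its projective dimension t + 1 is at most 2t - 1 because t >= 2.\<close>

lemma reg_gring:
  assumes "t \<ge> 2"
  shows "reg_pd_le (Gt_edges t) gring 8 (2 * t - 1)"
proof -
  have "reg_pd_le tri_edges tri_lin 2 (2 * t - 1)"
    using reg_segre_lin assms by (simp add: reg_pd_le_def tor_zero_tri_lin)
  then have "reg_pd_le tri_edges ((+) B_mon ` tri_lin) 8 (2 * t - 1)"
    using reg_pd_le_shift[of tri_edges tri_lin 2 _ B_mon] by (simp add: eval_nat_numeral)
  moreover have "reg_pd_le tri_edges (gring_e1_e3_f2 - (+) B_mon ` tri_lin) 8 (2 * t - 1)"
    unfolding gring_e1_e3_f2_diff by (rule reg_pd_le_mono[OF reg_tri_mod_B]) (use assms in auto)
  ultimately have "reg_pd_le tri_edges gring_e1_e3_f2 8 (2 * t - 1)"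
    by (rule reg_pd_le_extension[OF finite_tri_edges convex_gring(4) submod_gring])
  then show ?thesis
    by (simp add: reg_pd_le_def tor_zero_gring)
qed

section \<open>Regularity and h-polynomial\<close>

text \<open>All 2t variables act by zero on the residue field, so its Koszul differential vanishes
  and the face of all variables is a non-bounding cycle. Its degree is 2 per edge plus 1 for
  \<open>x1\<close>.\<close>

lemma tor_x1: "\<not> tor_zero (ab_edges t) {x1} (2 * t) (4 * t + 1)"
proof
  assume tor: "tor_zero (ab_edges t) {x1} (2 * t) (4 * t + 1)"
  define \<mu> where "\<mu> = x1 + (\<Sum>f\<in>ab_edges t. Gt_ends t f)"
  let ?S = "strand (ab_edges t) {x1} \<mu>"
  have card: "card (ab_edges t) = 2 * t"
    using a_b_disjoint card_b_edges by (simp add: ab_edges_t card_Un_disjoint)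
  have size: "size \<mu> = 4 * t + 1"
    by (simp add: \<mu>_def size_ends card)
  have top: "ab_edges t \<in> ?S"
    by (auto simp: strand_def \<mu>_def)
  have face: "card F = 2 * t" if "F \<in> ?S" for F
  proof -
    have "size \<mu> = 1 + 2 * card F"
      using that by (auto simp: strand_def size_ends)
    then show ?thesis
      using size by simp
  qed
  have "exact_at K ?S (2 * t)"
    using tor size by (simp add: tor_zero_def)
  moreover have "bd ?S (\<lambda>_. 1 :: 'k) G = 0" if "G \<in> ?S" "Suc (card G) = 2 * t" for G
    using face[OF that(1)] that(2) by simp
  ultimately obtain b :: "nat set \<Rightarrow> 'k" where "\<And>F. F \<in> ?S \<Longrightarrow> card F = 2 * t \<Longrightarrow> 1 = bd ?S b F"
    using exact_atE[of K ?S "2 * t" "\<lambda>_. 1"] by blast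
  then have "1 = bd ?S b (ab_edges t)"
    using top card by blast
  also have "\<dots> = 0"
    unfolding bd_def by (rule sum.neutral) (auto simp: strand_def)
  finally show False by simp
qed

text \<open>Vanishing in this degree would propagate through the short exact sequences down to the
  residue field, against \<open>tor_x1\<close>. The size of B accounts for the 6 in
  \<open>4 * t + 6\<close>.\<close>

lemma tor_gring:
  assumes "t \<ge> 2"
  shows "\<not> tor_zero (Gt_edges t) gring (2 * t - 1) (4 * t + 6)"
proof
  assume "tor_zero (Gt_edges t) gring (2 * t - 1) (4 * t + 6)"
  then have "tor_zero tri_edges gring_e1_e3_f2 (2 * t - 1) (4 * t + 6)"
    by (simp add: tor_zero_gring)
  \<comment> \<open>The homological degree is 2t, beyond the projective dimension t + 1 exactly
    because t >= 2.\<close>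
  moreover have "tor_zero tri_edges (gring_e1_e3_f2 - (+) B_mon ` tri_lin) (Suc (2 * t - 1)) (4 * t + 6)"
    unfolding gring_e1_e3_f2_diff by (rule reg_pd_leD[OF reg_tri_mod_B]) (use assms in auto)
  ultimately have "tor_zero tri_edges ((+) B_mon ` tri_lin) (2 * t - 1) (4 * t + 6)"
    by (rule tor_zero_sub[OF finite_tri_edges convex_gring(4) submod_gring])
  moreover have "4 * t + 6 = size B_mon + 4 * t"
    by simp
  ultimately have "tor_zero tri_edges ((+) B_mon ` tri_lin) (2 * t - 1) (size B_mon + 4 * t)"
    by (simp only:)
  then have "tor_zero (ab_edges t) segre_lin (2 * t - 1) (4 * t)"
    unfolding tor_zero_shift tor_zero_tri_lin .
  moreover have "tor_zero (ab_edges t) (segre_lin - segre_one) (Suc (2 * t - 1)) (4 * t)"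
    unfolding segre_lin_diff by (rule reg_pd_leD[OF reg_b_mons_ab_0]) (use assms in auto)
  ultimately have "tor_zero (ab_edges t) segre_one (2 * t - 1) (4 * t)"
    by (rule tor_zero_sub[OF finite_ab_edges convex_segre_lin submod_segre_lin])
  then have "tor_zero (ab_edges t) ((+) x2 ` segre_one) (2 * t - 1) (size x2 + 4 * t)"
    unfolding tor_zero_shift .
  then have sub: "tor_zero (ab_edges t) ((+) x2 ` segre_one) (2 * t - 1) (4 * t + 1)"
    by simp
  \<comment> \<open>The connecting map: K[b] has projective dimension at most t over all variables a
    and b, so it contributes nothing in homological degree 2t.\<close>
  have "tor_zero (ab_edges t) ((+) x1 ` b_mons {..<t} - (+) x2 ` segre_one) (2 * t) (4 * t + 1)"
  proof (rule tor_zero_quotient[OF finite_ab_edges _ submod_segre_one _ sub])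
    show "convex_mod (ab_edges t) ((+) x1 ` b_mons {..<t})"
      unfolding ab_edges_t
      by (rule convex_mod_X1_const[OF convex_b_mons, where c = 1]) (auto simp: b_mons_def)
    show "tor_zero (ab_edges t) ((+) x1 ` b_mons {..<t}) (2 * t) (4 * t + 1)"
      by (rule reg_pd_leD[OF reg_b_mons_ab]) (use assms in auto)
  qed
  then show False
    unfolding segre_one_shift_diff using tor_x1 by blast
qed

lemma hilbert_gring:
  "(1 - fps_X) ^ 3 * hilbert_series 0 gring = hilbert_series 0 gring_e1_e3_f2"
proof -
  have fin: "finite_sizes gring"
    by (rule finite_sizes_vmon) (unfold gring_def gmon_def, blast)
  then have fin1: "finite_sizes gring_e1"
    unfolding gring_quot_e1[symmetric] mod_quot_def by (rule finite_sizes_subset) blast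
  then have fin2: "finite_sizes gring_e1_e3"
    unfolding gring_quot_e3[symmetric] mod_quot_def by (rule finite_sizes_subset) blast
  show ?thesis
    using hilbert_series_regular[OF fin gring_closed(1)] hilbert_series_regular[OF fin1 gring_closed(2)]
      hilbert_series_regular[OF fin2 gring_closed(3)]
    unfolding gring_quot_e1 gring_quot_e3 gring_quot_f2
    by (simp add: power3_eq_cube mult.assoc)
qed

text \<open>R / (a)^2 consists of K[b] and of (a) / (a)^2, which is K[b] without its constant. The
  comparison uses offset 1 because \<open>x1\<close> and \<open>x2\<close> have odd size.\<close>

lemma hilbert_segre_lin:
  "hilbert_series 0 segre_lin = 2 * hilbert_series 0 (b_mons {..<t}) - 1"
proof -
  have fin: "finite_sizes segre_lin"
    by (rule finite_sizes_vmon) (unfold segre_lin_def segre_def, blast)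
  have 1: "hilbert_series 0 (b_mons {..<t}) = hilbert_series 0 segre_lin - hilbert_series 0 segre_one"
    unfolding segre_lin_diff[symmetric]
    by (rule hilbert_series_diff[OF fin]) (auto simp: segre_lin_def segre_one_def)
  have fin': "finite_sizes ((+) x1 ` b_mons {..<t})"
    by (rule finite_sizes_vmon) (force simp: b_mons_def)
  have "hilbert_series 1 ((+) x2 ` segre_one) = fps_X ^ 0 * hilbert_series 0 segre_one"
    by (rule hilbert_series_shift) auto
  moreover have "hilbert_series 1 ((+) x1 ` b_mons {..<t}) = fps_X ^ 0 * hilbert_series 0 (b_mons {..<t})"
    by (rule hilbert_series_shift) auto
  moreover have "hilbert_series 1 ((+) x2 ` segre_one) =
      hilbert_series 1 ((+) x1 ` b_mons {..<t}) - hilbert_series 1 {x1}"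
    unfolding segre_one_shift by (rule hilbert_series_diff[OF fin']) (use x1_in in blast)
  moreover have "hilbert_series 1 {x1} = 1"
  proof (rule fps_ext)
    fix k
    have "{m\<in>{x1}. size m = 2 * k + 1} = (if k = 0 then {x1} else {})"
      by auto
    then show "fps_nth (hilbert_series 1 {x1}) k = fps_nth 1 k"
      by (simp add: hilbert_series_def)
  qed
  ultimately show ?thesis
    using 1 by simp
qed

lemma hilbert_gring_closed_form:
  "(1 - fps_X) ^ (t + 6) * hilbert_series 0 gring =
    1 + of_nat t * fps_X + of_nat t * fps_X ^ 2 + of_nat (t + 1) * fps_X ^ 3 - fps_X ^ 3 * (1 - fps_X) ^ t"
proof -
  let ?q = "1 - fps_X :: int fps" and ?x = "fps_X :: int fps"
  let ?R = "hilbert_series 0 (segre t)" and ?b = "hilbert_series 0 (b_mons {..<t})"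
  have fin: "finite_sizes tri"
    by (rule finite_sizes_vmon) (unfold tri_part_def, blast)
  have fin': "finite_sizes gring_e1_e3_f2"
    by (rule finite_sizes_subset[OF fin]) (auto simp: gring_e1_e3_f2_eq)
  have B: "hilbert_series 0 ((+) B_mon ` P) = ?x ^ 3 * hilbert_series 0 P" for P
    by (rule hilbert_series_shift) auto
  have "(+) B_mon ` tri \<subseteq> tri"
    unfolding tri_B by (auto elim!: tri_partE)
  then have "hilbert_series 0 gring_e1_e3_f2 - hilbert_series 0 ((+) B_mon ` tri_lin) =
      hilbert_series 0 tri - hilbert_series 0 ((+) B_mon ` tri)"
    using hilbert_series_diff[OF fin' gring_e1_e3_f2_sub, of 0] hilbert_series_diff[OF fin, of "(+) B_mon ` tri" 0]
    unfolding gring_e1_e3_f2_diff by simp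
  then have 1: "?q ^ 3 * hilbert_series 0 gring = ?x ^ 3 * hilbert_series 0 tri_lin + (1 - ?x ^ 3) * hilbert_series 0 tri"
    unfolding B hilbert_gring by (simp add: algebra_simps)
  have "?q ^ 6 * hilbert_series 0 gring = ?q ^ 3 * (?q ^ 3 * hilbert_series 0 gring)"
    by (simp flip: mult.assoc power_add)
  also have "\<dots> = ?x ^ 3 * (?q ^ 3 * hilbert_series 0 tri_lin) + (1 - ?x ^ 3) * (?q ^ 3 * hilbert_series 0 tri)"
    unfolding 1 by (simp only: distrib_left mult.left_commute)
  also have "\<dots> = ?x ^ 3 * (2 * ?b - 1) + (1 - ?x ^ 3) * ?R"
    by (simp only: hilbert_tri hilbert_tri_lin hilbert_segre_lin)
  finally have 2: "?q ^ 6 * hilbert_series 0 gring = ?x ^ 3 * (2 * ?b - 1) + (1 - ?x ^ 3) * ?R" .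
  have 3: "?q ^ t * ?b = 1"
    using b_mons_hilbert[of "{..<t}"] by simp
  have 4: "?q ^ t * ?R * ?q = ?q + of_nat t * ?x"
    using segre_hilbert[of t] by (simp add: ac_simps)
  \<comment> \<open>The Segre ring has dimension t + 1, so one extra factor is needed to clear
    denominators; it is cancelled at the end.\<close>
  have "?q ^ (t + 6) * hilbert_series 0 gring * ?q = ?q ^ t * (?q ^ 6 * hilbert_series 0 gring) * ?q"
    by (simp add: power_add ac_simps)
  also have "\<dots> = ?q * ?x ^ 3 * (2 * (?q ^ t * ?b) - ?q ^ t) + (1 - ?x ^ 3) * (?q ^ t * ?R * ?q)"
    unfolding 2 by (simp add: algebra_simps)
  also have "\<dots> = ?q * ?x ^ 3 * (2 - ?q ^ t) + (1 - ?x ^ 3) * (?q + of_nat t * ?x)"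
    unfolding 3 4 by simp
  also have "\<dots> = (1 + of_nat t * ?x + of_nat t * ?x ^ 2 + of_nat (t + 1) * ?x ^ 3 - ?x ^ 3 * ?q ^ t) * ?q"
    by (simp add: algebra_simps power2_eq_square power3_eq_cube)
  finally have "?q ^ (t + 6) * hilbert_series 0 gring * ?q =
    (1 + of_nat t * ?x + of_nat t * ?x ^ 2 + of_nat (t + 1) * ?x ^ 3 - ?x ^ 3 * ?q ^ t) * ?q" .
  moreover have "?q \<noteq> 0"
  proof
    assume "?q = 0"
    then have "fps_nth ?q 0 = 0" by simp
    then show False by simp
  qed
  ultimately show ?thesis
    by simp
qed

lemma cm_reg_Gt:
  assumes "t \<ge> 2"
  shows "cm_reg K (Gt_edges t) (Gt_ends t) = 4"
  unfolding cm_reg_def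
proof (rule Max_eqI)
  have fin: "finite (Gt_edges t)"
    by (simp add: Gt_edges_def)
  let ?M = "{int j - int i | i j. betti K (Gt_edges t) (Gt_ends t) i j \<noteq> 0}"
  \<comment> \<open>\<open>Max\<close> is meaningful only for a finite set, so a lower bound is
    included: \<open>i\<close> edges already have internal degree \<open>i\<close>.\<close>
  have bounds: "0 \<le> x \<and> x \<le> 4" if "x \<in> ?M" for x
  proof -
    from that obtain i j where x: "x = int j - int i"
      and "\<not> tor_zero (Gt_edges t) gring i (2 * j)"
      by (auto simp: betti_eq_zero_iff[OF fin] gring_eq)
    then have "\<not> 2 * j < 2 * i" "\<not> 2 * j > 2 * i + 8"
      using tor_zero_small reg_pd_leD[OF reg_gring[OF assms]] by blast+
    then show ?thesis
      using x by simp
  qed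
  show "finite ?M"
  proof (rule finite_subset[of _ "{0..4}"])
    show "?M \<subseteq> {0..4}"
    proof
      fix x assume "x \<in> ?M"
      from bounds[OF this] show "x \<in> {0..4}" by simp
    qed
  qed simp
  show "x \<le> 4" if "x \<in> ?M" for x
    using bounds[OF that] by simp
  \<comment> \<open>The edge degree 2t + 3 is half of the vertex degree
    \<open>4 * t + 6\<close>.\<close>
  have "betti K (Gt_edges t) (Gt_ends t) (2 * t - 1) (2 * t + 3) \<noteq> 0"
    using tor_gring[OF assms] by (simp add: betti_eq_zero_iff[OF fin] gring_eq)
  moreover have "4 = int (2 * t + 3) - int (2 * t - 1)"
    using assms by simp
  ultimately show "4 \<in> ?M"
    by blast
qed

definition h_poly :: "int poly" where
  "h_poly = [:1, int t, int t, int t + 1:] - monom 1 3 * [:1, -1:] ^ t"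

lemma is_h_poly_Gt: "is_h_poly (Gt_edges t) (Gt_ends t) (t + 6) h_poly"
proof -
  have "hilbert_series 0 gring = Abs_fps (\<lambda>k. int (hilb (Gt_edges t) (Gt_ends t) k))"
    by (simp add: hilbert_series_def hilb_def edge_monos_eq gring_eq)
  moreover have "fps_of_poly h_poly = 1 + of_nat t * fps_X + of_nat t * fps_X ^ 2 +
      of_nat (t + 1) * fps_X ^ 3 - fps_X ^ 3 * (1 - fps_X) ^ t"
    by (simp add: h_poly_def fps_of_poly_simps fps_of_poly_monom fps_of_poly_pCons
        algebra_simps power2_eq_square power3_eq_cube fps_of_nat[symmetric])
  \<comment> \<open>The value is 3t + 2 - 0^t, which is positive for every t.\<close>
  moreover have "poly h_poly 1 \<noteq> 0"
    unfolding h_poly_def by (simp add: poly_monom power_0_left)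
  ultimately show ?thesis
    using hilbert_gring_closed_form by (simp add: is_h_poly_def)
qed

text \<open>For t >= 1 the term x^3 (1 - x)^t has degree above 3, so the cubic part cannot cancel
  its leading coefficient.\<close>

lemma degree_h_poly:
  assumes "t \<ge> 1"
  shows "degree h_poly = t + 3"
proof -
  let ?p = "[:1, int t, int t, int t + 1:]" and ?q = "monom 1 3 * [:1, -1:] ^ t :: int poly"
  have q: "degree ?q = 3 + t"
    by (simp add: degree_mult_eq degree_monom_eq degree_power_eq)
  have "degree ?p < degree (- ?q)"
    unfolding degree_minus q using assms by simp
  from degree_add_eq_right[OF this] have "degree (?p - ?q) = degree ?q"
    unfolding diff_conv_add_uminus degree_minus .
  then show ?thesis
    unfolding h_poly_def q by simp
qed

end

theorem theorem3p9:
  fixes t :: nat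
  assumes "t \<ge> 2"
    and "\<forall>p :: 'k::field_char_0 poly. degree p \<ge> 1 \<longrightarrow> (\<exists>x. poly p x = 0)"
  shows "cm_reg TYPE('k) (Gt_edges t) (Gt_ends t) = 4 \<and>
         (\<exists>d h. is_h_poly (Gt_edges t) (Gt_ends t) d h \<and> degree h = t + 3)"
proof -
  interpret Gt_koszul "TYPE('k)" t .
  show ?thesis
    using cm_reg_Gt is_h_poly_Gt degree_h_poly assms(1) by auto
qed

end
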